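(* Assume that the mixture $\xi$ satisfies the no-overlap gap assumption at zero temperature, i.e. there exists $\gamma_*\in\mathscr U$ strictly increasing on $[0,1)$ such that $\mathsf P(\gamma_* )=\inf_{\gamma\in\mathscr U}\mathsf P(\gamma)$. Then $$\inf_{\gamma\in\mathscr U}\mathsf P(\gamma)=\inf_{\gamma\in\mathscr L}\mathsf P(\gamma).$$
   Context: $\xi(x)=\sum_{k\ge2}c_k^2x^k$ with real coefficients $c_k$ and $\xi(1+\epsilon_0)<\infty$ for some $\epsilon_0>0$. $\mathscr U=\{\gamma:[0,1)\to\mathbb R_{\ge0}:\ \gamma\text{ non-decreasing},\ \int_0^1\gamma(t)\,\mathrm dt<\infty\}$. $\mathscr L=\{\gamma:[0,1)\to\mathbb R_{\ge0}:\ \|\xi''\gamma\|_{\mathrm{TV}[0,t]}<\infty\ \forall t\in[0,1),\ \int_0^1\xi''(t)\gamma(t)\,\mathrm dt<\infty\}$, where $\|\cdot\|_{\mathrm{TV}[0,t]}$ is total variation on $[0,t]$; functions equal a.e. are identified. Parisi PDE: let $\mathsf{SF}_+$ be the set of nonnegative step functions $\sum_{i=1}^m a_i\mathbf 1_{[t_{i-1},t_i)}$, $0=t_0<\dots<t_m=1$, $a_i\ge0$. For $\gamma\in\mathsf{SF}_+$, $\Phi_\gamma:[0,1]\times\mathbb R\to\mathbb R$ is the solution of $\partial_t\Phi_\gamma+\frac12\xi''(t)\big(\partial_x^2\Phi_\gamma+\gamma(t)(\partial_x\Phi_\gamma)^2\big)=0$, $\Phi_\gamma(1,x)=|x|$,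 given by the Cole–Hopf recursion: for $t\in[t_{i-1},t_i)$, $\Phi_\gamma(t,x)=\frac1{a_i}\log\mathbb E\exp\{a_i\Phi_\gamma(t_i,x+\sqrt{\xi'(t_i)-\xi'(t)}\,G)\}$, $G\sim\mathsf N(0,1)$ (with $\Phi_\gamma(t,x)=\mathbb E\,\Phi_\gamma(t_i,x+\sqrt{\xi'(t_i)-\xi'(t)}\,G)$ if $a_i=0$). For $\gamma\in\mathscr L$, $\Phi_\gamma$ is defined by continuity: $\Phi_\gamma=\lim_n\Phi_{\gamma_n}$ for any sequence $\gamma_n\in\mathsf{SF}_+$ with $\int_0^1\xi''|\gamma_n-\gamma|\,\mathrm dt\to0$ (the limit is uniform and independent of the sequence). The Parisi functional is $\mathsf P(\gamma)=\Phi_\gamma(0,0)-\frac12\int_0^1t\,\xi''(t)\gamma(t)\,\mathrm dt$. *)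

theory Defs
  imports "HOL-Probability.Probability"
begin

definition mixture :: "(nat \<Rightarrow> real) \<Rightarrow> real \<Rightarrow> real" where
  "mixture c x = (\<Sum>k. (c (k + 2))\<^sup>2 * x ^ (k + 2))"

definition total_variation :: "(real \<Rightarrow> real) \<Rightarrow> real \<Rightarrow> real \<Rightarrow> ennreal" where
  "total_variation f a b =
     (SUP xs \<in> {xs. sorted xs \<and> set xs \<subseteq> {a..b}}.
        \<Sum>i<length xs - 1. ennreal \<bar>f (xs ! Suc i) - f (xs ! i)\<bar>)"

text \<open>A function on \<open>[0,1)\<close> is represented by a total function on the reals of which only the
  values on \<open>[0,1)\<close> matter: they are the only ones that enter the two classes below and the
  Parisi functional.\<close>

definition U_paths :: "(real \<Rightarrow> real) set" where
  "U_paths = {\<gamma>. (\<forall>t\<in>{0..<1}. \<gamma> t \<ge> 0) \<and> mono_on {0..<1} \<gamma>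
                  \<and> set_integrable lborel {0..<1} \<gamma>}"

text \<open>Almost everywhere equal functions are not identified explicitly; the Parisi functional does
  not distinguish them, so the infimum over representatives is the infimum over classes.\<close>

definition L_paths :: "(real \<Rightarrow> real) \<Rightarrow> (real \<Rightarrow> real) set" where
  "L_paths \<xi> = {\<gamma>. (\<forall>t\<in>{0..<1}. \<gamma> t \<ge> 0)
                  \<and> (\<forall>t\<in>{0..<1}. total_variation (\<lambda>s. deriv (deriv \<xi>) s * \<gamma> s) 0 t < \<infinity>)
                  \<and> set_integrable lborel {0..<1} (\<lambda>t. deriv (deriv \<xi>) t * \<gamma> t)}"

text \<open>The list \<open>[(a\<^sub>1, t\<^sub>1), \<dots>, (a\<^sub>m, t\<^sub>m)]\<close> encodes the step function with value \<open>a\<^sub>i\<close> on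
  \<open>[t\<^sub>i\<^sub>-\<^sub>1, t\<^sub>i)\<close>, where \<open>t\<^sub>0 = 0\<close>.\<close>

definition step_data :: "(real \<times> real) list set" where
  "step_data = {ps. ps \<noteq> [] \<and> sorted_wrt (<) (0 # map snd ps) \<and> snd (last ps) = 1
                  \<and> (\<forall>(a, t) \<in> set ps. a \<ge> 0)}"

primrec step_fun :: "(real \<times> real) list \<Rightarrow> real \<Rightarrow> real" where
  "step_fun [] s = 0"
| "step_fun (p # ps) s = (if s < snd p then fst p else step_fun ps s)"

lemma step_fun_eq_sum:
  assumes "ps \<in> step_data" and "0 \<le> s"
  shows "step_fun ps s =
    (\<Sum>i<length ps. fst (ps ! i) * indicator {(0 # map snd ps) ! i ..< snd (ps ! i)} s)"
proof -
  have gen: "step_fun ps s =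
      (\<Sum>i<length ps. fst (ps ! i) * indicator {(u # map snd ps) ! i ..< snd (ps ! i)} s)"
    if "sorted_wrt (<) (u # map snd ps)" "u \<le> s" for u and ps :: "(real \<times> real) list"
    using that
  proof (induction ps arbitrary: u)
    case Nil
    then show ?case by simp
  next
    case (Cons p ps)
    show ?case
    proof (cases "s < snd p")
      case True
      have "indicator {(snd p # map snd ps) ! i ..< snd (ps ! i)} s = (0::real)"
        if "i < length ps" for i
      proof -
        have "snd p \<le> (snd p # map snd ps) ! i"
          using Cons.prems(1) that by (cases i) (auto simp: less_imp_le)
        then show ?thesis using True by simp
      qed
      then show ?thesis
        using True Cons.prems by (simp add: sum.lessThan_Suc_shift del: sum.lessThan_Suc)
    next
      case False
      then show ?thesis
        using Cons.IH[of "snd p"] Cons.prems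
        by (simp add: sum.lessThan_Suc_shift del: sum.lessThan_Suc)
    qed
  qed
  then show ?thesis
    using assms gen[of 0 ps] unfolding step_data_def by auto
qed

definition cole_hopf :: "real \<Rightarrow> real \<Rightarrow> (real \<Rightarrow> real) \<Rightarrow> real \<Rightarrow> real" where
  "cole_hopf a v f x =
     (if a = 0 then (LINT g|std_normal_distribution. f (x + sqrt v * g))
      else ln (LINT g|std_normal_distribution. exp (a * f (x + sqrt v * g))) / a)"

text \<open>For \<open>s \<in> [t\<^sub>i\<^sub>-\<^sub>1, t\<^sub>i)\<close> the recursion skips the first \<open>i - 1\<close> entries; the remaining list after
  the \<open>i\<close>-th entry then gives the solution at time \<open>t\<^sub>i\<close>.\<close>

primrec Phi_step :: "(real \<Rightarrow> real) \<Rightarrow> (real \<times> real) list \<Rightarrow> real \<Rightarrow> real \<Rightarrow> real" where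
  "Phi_step \<xi> [] s x = \<bar>x\<bar>"
| "Phi_step \<xi> (p # ps) s x =
     (if s < snd p
      then cole_hopf (fst p) (deriv \<xi> (snd p) - deriv \<xi> s) (Phi_step \<xi> ps (snd p)) x
      else Phi_step \<xi> ps s x)"

definition step_approx :: "(real \<Rightarrow> real) \<Rightarrow> (real \<Rightarrow> real) \<Rightarrow> (nat \<Rightarrow> (real \<times> real) list) \<Rightarrow> bool" where
  "step_approx \<xi> \<gamma> D \<longleftrightarrow>
     (\<forall>n. D n \<in> step_data) \<and>
     (\<lambda>n. LBINT t:{0..<1}. deriv (deriv \<xi>) t * \<bar>step_fun (D n) t - \<gamma> t\<bar>) \<longlonglongrightarrow> 0"

definition Phi :: "(real \<Rightarrow> real) \<Rightarrow> (real \<Rightarrow> real) \<Rightarrow> real \<Rightarrow> real \<Rightarrow> real" where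
  "Phi \<xi> \<gamma> t x = (THE y. \<forall>D. step_approx \<xi> \<gamma> D \<longrightarrow> (\<lambda>n. Phi_step \<xi> (D n) t x) \<longlonglongrightarrow> y)"

definition parisi :: "(real \<Rightarrow> real) \<Rightarrow> (real \<Rightarrow> real) \<Rightarrow> real" where
  "parisi \<xi> \<gamma> = Phi \<xi> \<gamma> 0 0 - 1/2 * (LBINT t:{0..<1}. t * deriv (deriv \<xi>) t * \<gamma> t)"

end

theory Submission
  imports Defs "HOL-Real_Asymp.Real_Asymp"
begin

text \<open>
  For step functions the solution of the Parisi PDE is an iterated Cole-Hopf (log-Laplace) map.
  Three properties of this map suffice.

  \<^item> Convexity: \<open>(\<gamma>, x) \<mapsto> \<Phi>\<^sub>\<gamma>(t, x)\<close> is jointly convex, because over short time steps the Cole-Hopf map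
    is a supremum of shifts \<open>E f(x + a v p + \<surd>v G) - a v p\<^sup>2 / 2\<close>.
  \<^item> Lipschitz continuity in \<open>L\<^sup>1(\<xi>'' dt)\<close>: a convex function of the order parameter with bounded slope at
    infinity has the same slope bound everywhere.
  \<^item> Smoothness in the directions \<open>\<gamma> 1\<^bsub>[0,\<tau>)\<^esub>\<close>: scaling \<open>\<gamma>\<close> on \<open>[0,\<tau>)\<close> is the same as scaling
    the datum at time \<open>\<tau>\<close>, and the second difference with respect to that datum is controlled by
    exponential moments.

  If a strictly increasing \<open>\<gamma>\<close> is optimal among non-decreasing functions, it may be perturbed in both
  directions by \<open>\<gamma> \<kappa>(\<gamma>)\<close> with a cutoff \<open>\<kappa>\<close>, and \<open>\<kappa>(\<gamma>)\<close> can be chosen arbitrarily close to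
  \<open>1\<^bsub>[0,\<tau>)\<^esub>\<close>. Smoothness then makes the derivative vanish in all these directions, hence, by convexity,
  in all directions spanned by them; these are dense, and convexity turns the vanishing of the
  derivative into global optimality.\<close>

subsection \<open>Gaussian averages\<close>

text \<open>Being minimal along every line of a spanning family is not enough for a nonsmooth convex
  functional: \<open>\<bar>x - y\<bar> - (x + y) / 2\<close> is minimal at 0 along both axes but not
  along the diagonal. Optimality among monotone functions yields only such lower bounds, one for
  each direction \<gamma> 1_[0,\<tau>) and its negative. The quadratic bound on symmetric second
  differences converts a lower bound in one direction into an upper bound in the opposite one, and
  upper bounds, unlike lower ones, survive the addition of directions by convexity. The time \<tau>
  stays below 1 because \<gamma> may be unbounded near 1, and the smoothness constant depends on a
  bound for \<gamma> on [0,\<tau>). Density holds because \<gamma> is positive on (0,1), so every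
  competitor is almost everywhere \<gamma> times a function. For joint convexity, one deterministic
  shift per short time step takes the place of a stochastic control. Its error is of second order in
  the step for semiconcave data; |x| has a kink, hence the detour through Moreau envelopes.\<close>

abbreviation std_gauss :: "real measure" where
  "std_gauss \<equiv> std_normal_distribution"

text \<open>Closed under sums, products and affine substitution, this class contains
  \<open>exp (c * f y)\<close> for every Lipschitz \<open>f\<close>, so the integrability conditions
  below reduce to introduction rules.\<close>

definition exp_growth :: "(real \<Rightarrow> real) \<Rightarrow> bool" where
  "exp_growth \<phi> \<longleftrightarrow> \<phi> \<in> borel_measurable borel
     \<and> (\<exists>C\<ge>0. \<exists>k\<ge>0. \<forall>x. \<bar>\<phi> x\<bar> \<le> C * exp (k * \<bar>x\<bar>))"

lemma prob_space_std_gauss: "prob_space std_gauss"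
  by (rule prob_space_normal_density) simp

lemma has_integral_gauss_exp_shift:
  fixes s :: real
  shows "integrable lborel (\<lambda>g. std_normal_density g * exp (s * g - s\<^sup>2 / 2))"
    and "(LBINT g. std_normal_density g * exp (s * g - s\<^sup>2 / 2)) = 1"
proof -
  have eq: "std_normal_density g * exp (s * g - s\<^sup>2 / 2) = normal_density s 1 g" for g
    by (simp add: normal_density_def exp_add[symmetric] field_simps power2_eq_square)
  show "integrable lborel (\<lambda>g. std_normal_density g * exp (s * g - s\<^sup>2 / 2))"
    unfolding eq by (rule integrable_normal_density) simp
  show "(LBINT g. std_normal_density g * exp (s * g - s\<^sup>2 / 2)) = 1"
    unfolding eq by (rule integral_normal_density) simp
qed

lemma gauss_exp:
  shows gauss_integrable_exp: "integrable std_gauss (\<lambda>g. exp (s * g))"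
    and gauss_integral_exp: "(LINT g|std_gauss. exp (s * g)) = exp (s\<^sup>2 / 2)"
proof -
  have eq: "std_normal_density g * exp (s * g)
      = exp (s\<^sup>2 / 2) * (std_normal_density g * exp (s * g - s\<^sup>2 / 2))" for g :: real
    by (simp add: exp_diff)
  show "integrable std_gauss (\<lambda>g. exp (s * g))"
    by (subst integrable_density)
      (auto simp: eq has_integral_gauss_exp_shift(1) simp del: times_divide_eq_left)
  show "(LINT g|std_gauss. exp (s * g)) = exp (s\<^sup>2 / 2)"
    by (subst integral_density)
      (auto simp: eq has_integral_gauss_exp_shift(2) simp del: times_divide_eq_left)
qed

text \<open>Completing the square: the weight \<open>exp (s * g)\<close> turns the standard Gaussian
  into its translate by \<open>s\<close>. This one-dimensional Cameron-Martin formula is the source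
  of the shifted arguments in the sequel.\<close>

lemma gauss_shift:
  fixes \<phi> :: "real \<Rightarrow> real"
  assumes [measurable]: "\<phi> \<in> borel_measurable borel"
  shows "(LINT g|std_gauss. \<phi> g * exp (s * g)) = exp (s\<^sup>2 / 2) * (LINT g|std_gauss. \<phi> (g + s))"
proof -
  have eq: "std_normal_density (s + g) * (\<phi> (s + g) * exp (s * (s + g)))
      = exp (s\<^sup>2 / 2) * (std_normal_density g * \<phi> (g + s))" for g :: real
    by (simp add: std_normal_density_def exp_add[symmetric] exp_diff[symmetric] field_simps power2_eq_square)
  have "(LINT g|std_gauss. \<phi> g * exp (s * g))
      = (LBINT g. std_normal_density g * (\<phi> g * exp (s * g)))"
    by (subst integral_density) auto
  also have "\<dots> = (LBINT g. std_normal_density (s + g) * (\<phi> (s + g) * exp (s * (s + g))))"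
    by (subst lborel_integral_real_affine[where c = 1 and t = s]) simp_all
  also have "\<dots> = exp (s\<^sup>2 / 2) * (LINT g|std_gauss. \<phi> (g + s))"
    unfolding eq by (subst integral_density) (auto simp del: times_divide_eq_left)
  finally show ?thesis .
qed

lemma exp_growthI:
  assumes "\<phi> \<in> borel_measurable borel" "\<And>x. \<bar>\<phi> x\<bar> \<le> C * exp (k * \<bar>x\<bar>)"
  shows "exp_growth \<phi>"
proof -
  have C: "0 \<le> C * exp (k * \<bar>x\<bar>)" for x :: real
    using assms(2)[of x] by linarith
  have "0 \<le> C" using C[of 0] by simp
  moreover have "\<bar>\<phi> x\<bar> \<le> C * exp (\<bar>k\<bar> * \<bar>x\<bar>)" for x
    using assms(2)[of x] \<open>0 \<le> C\<close>
    by (smt (verit) exp_le_cancel_iff mult_left_mono mult_right_mono)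
  ultimately show ?thesis
    using assms(1) unfolding exp_growth_def by (intro conjI exI[of _ C] exI[of _ "\<bar>k\<bar>"]) auto
qed

lemma exp_growth_integrable:
  assumes "exp_growth \<phi>"
  shows "integrable std_gauss \<phi>"
proof -
  obtain C k where Ck: "0 \<le> C" "0 \<le> k" "\<And>x. \<bar>\<phi> x\<bar> \<le> C * exp (k * \<bar>x\<bar>)"
    using assms unfolding exp_growth_def by blast
  have "integrable std_gauss (\<lambda>g. C * (exp (k * g) + exp (- k * g)))"
    by (intro integrable_mult_right Bochner_Integration.integrable_add gauss_integrable_exp)
  then show ?thesis
  proof (rule Bochner_Integration.integrable_bound)
    show "\<phi> \<in> borel_measurable std_gauss"
      using assms by (simp add: exp_growth_def)
    have "\<bar>\<phi> x\<bar> \<le> \<bar>C * (exp (k * x) + exp (- k * x))\<bar>" for x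
    proof -
      have "exp (k * \<bar>x\<bar>) \<le> exp (k * x) + exp (- k * x)"
        by (cases "0 \<le> x") (auto simp: add_increasing add_increasing2)
      then show ?thesis
        using Ck(3)[of x] Ck(1) by (smt (verit) mult_left_mono)
    qed
    then show "AE x in std_gauss. norm (\<phi> x) \<le> norm (C * (exp (k * x) + exp (- k * x)))"
      by simp
  qed
qed

lemma exp_growth_const: "exp_growth (\<lambda>_. c)"
  by (rule exp_growthI[where C = "\<bar>c\<bar>" and k = 0]) auto

lemma exp_growth_mult:
  assumes "exp_growth \<phi>" "exp_growth \<psi>"
  shows "exp_growth (\<lambda>x. \<phi> x * \<psi> x)"
proof -
  obtain C k where Ck: "0 \<le> C" "\<And>x. \<bar>\<phi> x\<bar> \<le> C * exp (k * \<bar>x\<bar>)"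
    using assms(1) unfolding exp_growth_def by blast
  obtain D l where Dl: "0 \<le> D" "\<And>x. \<bar>\<psi> x\<bar> \<le> D * exp (l * \<bar>x\<bar>)"
    using assms(2) unfolding exp_growth_def by blast
  have [measurable]: "\<phi> \<in> borel_measurable borel" "\<psi> \<in> borel_measurable borel"
    using assms by (auto simp: exp_growth_def)
  show ?thesis
  proof (rule exp_growthI[where C = "C * D" and k = "k + l"])
    show "\<bar>\<phi> x * \<psi> x\<bar> \<le> C * D * exp ((k + l) * \<bar>x\<bar>)" for x
    proof -
      have "\<bar>\<phi> x\<bar> * \<bar>\<psi> x\<bar> \<le> (C * exp (k * \<bar>x\<bar>)) * (D * exp (l * \<bar>x\<bar>))"
        by (intro mult_mono Ck Dl) (auto simp: Ck(1))
      also have "\<dots> = C * D * exp ((k + l) * \<bar>x\<bar>)"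
        by (simp add: distrib_right exp_add)
      finally show ?thesis by (simp add: abs_mult)
    qed
  qed simp
qed

lemma exp_growth_add:
  assumes "exp_growth \<phi>" "exp_growth \<psi>"
  shows "exp_growth (\<lambda>x. \<phi> x + \<psi> x)"
proof -
  obtain C k where Ck: "0 \<le> C" "0 \<le> k" "\<And>x. \<bar>\<phi> x\<bar> \<le> C * exp (k * \<bar>x\<bar>)"
    using assms(1) unfolding exp_growth_def by blast
  obtain D l where Dl: "0 \<le> D" "0 \<le> l" "\<And>x. \<bar>\<psi> x\<bar> \<le> D * exp (l * \<bar>x\<bar>)"
    using assms(2) unfolding exp_growth_def by blast
  have [measurable]: "\<phi> \<in> borel_measurable borel" "\<psi> \<in> borel_measurable borel"
    using assms by (auto simp: exp_growth_def)
  show ?thesis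
  proof (rule exp_growthI[where C = "C + D" and k = "k + l"])
    show "\<bar>\<phi> x + \<psi> x\<bar> \<le> (C + D) * exp ((k + l) * \<bar>x\<bar>)" for x
    proof -
      have "C * exp (k * \<bar>x\<bar>) \<le> C * exp ((k + l) * \<bar>x\<bar>)"
        using Ck Dl by (intro mult_left_mono) (auto simp: mult_right_mono)
      moreover have "D * exp (l * \<bar>x\<bar>) \<le> D * exp ((k + l) * \<bar>x\<bar>)"
        using Ck Dl by (intro mult_left_mono) (auto simp: mult_right_mono)
      ultimately show ?thesis
        using Ck(3)[of x] Dl(3)[of x] unfolding distrib_right[of C] by linarith
    qed
  qed simp
qed

lemma exp_growth_diff:
  assumes "exp_growth \<phi>" "exp_growth \<psi>"
  shows "exp_growth (\<lambda>x. \<phi> x - \<psi> x)"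
  using exp_growth_add[OF assms(1) exp_growth_mult[OF exp_growth_const[of "-1"] assms(2)]] by simp

lemma exp_growth_affine:
  assumes "exp_growth \<phi>"
  shows "exp_growth (\<lambda>g. \<phi> (x + c * g))"
proof -
  obtain C k where Ck: "0 \<le> C" "0 \<le> k" "\<And>x. \<bar>\<phi> x\<bar> \<le> C * exp (k * \<bar>x\<bar>)"
    using assms(1) unfolding exp_growth_def by blast
  have [measurable]: "\<phi> \<in> borel_measurable borel"
    using assms by (auto simp: exp_growth_def)
  show ?thesis
  proof (rule exp_growthI[where C = "C * exp (k * \<bar>x\<bar>)" and k = "k * \<bar>c\<bar>"])
    show "\<bar>\<phi> (x + c * g)\<bar> \<le> C * exp (k * \<bar>x\<bar>) * exp (k * \<bar>c\<bar> * \<bar>g\<bar>)" for g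
    proof -
      have "\<bar>x + c * g\<bar> \<le> \<bar>x\<bar> + \<bar>c\<bar> * \<bar>g\<bar>"
        by (metis abs_mult abs_triangle_ineq)
      then have "k * \<bar>x + c * g\<bar> \<le> k * \<bar>x\<bar> + k * \<bar>c\<bar> * \<bar>g\<bar>"
        using Ck(2) by (metis distrib_left mult.assoc mult_left_mono)
      then have "C * exp (k * \<bar>x + c * g\<bar>) \<le> C * exp (k * \<bar>x\<bar> + k * \<bar>c\<bar> * \<bar>g\<bar>)"
        using Ck(1) by (intro mult_left_mono) auto
      then show ?thesis using Ck(3)[of "x + c * g"] by (simp add: exp_add mult_ac)
    qed
  qed simp
qed

lemma exp_growth_linear_exp:
  assumes [measurable]: "\<psi> \<in> borel_measurable borel" and "\<And>x. \<psi> x \<le> A + B * \<bar>x\<bar>"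
  shows "exp_growth (\<lambda>x. exp (\<psi> x))"
  by (rule exp_growthI[where C = "exp A" and k = B])
    (use assms(2) in \<open>auto simp: exp_add[symmetric]\<close>)

lemma exp_growth_linear:
  assumes [measurable]: "\<psi> \<in> borel_measurable borel" and "\<And>x. \<bar>\<psi> x\<bar> \<le> A + B * \<bar>x\<bar>"
  shows "exp_growth \<psi>"
proof (rule exp_growthI[where C = "exp A" and k = B])
  show "\<bar>\<psi> x\<bar> \<le> exp A * exp (B * \<bar>x\<bar>)" for x
  proof -
    have "A + B * \<bar>x\<bar> \<le> exp (A + B * \<bar>x\<bar>)"
      using exp_ge_add_one_self[of "A + B * \<bar>x\<bar>"] by linarith
    then show ?thesis using assms(2)[of x] by (simp add: exp_add)
  qed
qed simp

text \<open>The heat semigroup with the variance \<open>v\<close> as time parameter.\<close>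

definition gauss_avg :: "real \<Rightarrow> (real \<Rightarrow> real) \<Rightarrow> real \<Rightarrow> real" where
  "gauss_avg v \<phi> x = (LINT g|std_gauss. \<phi> (x + sqrt v * g))"

lemma gauss_avg_0 [simp]: "gauss_avg 0 \<phi> x = \<phi> x"
  using prob_space.prob_space[OF prob_space_std_gauss] by (simp add: gauss_avg_def)

lemma integrable_gauss_avg: "exp_growth \<phi> \<Longrightarrow> integrable std_gauss (\<lambda>g. \<phi> (x + sqrt v * g))"
  by (intro exp_growth_integrable exp_growth_affine)

lemma gauss_avg_const [simp]: "gauss_avg v (\<lambda>_. c) x = c"
  using prob_space.prob_space[OF prob_space_std_gauss] by (simp add: gauss_avg_def)

lemma gauss_avg_mono:
  assumes "exp_growth \<phi>" "exp_growth \<psi>" "\<And>x. \<phi> x \<le> \<psi> x"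
  shows "gauss_avg v \<phi> x \<le> gauss_avg v \<psi> x"
  unfolding gauss_avg_def by (intro integral_mono integrable_gauss_avg assms)

lemma gauss_avg_add:
  assumes "exp_growth \<phi>" "exp_growth \<psi>"
  shows "gauss_avg v (\<lambda>y. \<phi> y + \<psi> y) x = gauss_avg v \<phi> x + gauss_avg v \<psi> x"
  unfolding gauss_avg_def by (intro Bochner_Integration.integral_add integrable_gauss_avg assms)

lemma gauss_avg_diff:
  assumes "exp_growth \<phi>" "exp_growth \<psi>"
  shows "gauss_avg v (\<lambda>y. \<phi> y - \<psi> y) x = gauss_avg v \<phi> x - gauss_avg v \<psi> x"
  unfolding gauss_avg_def by (intro Bochner_Integration.integral_diff integrable_gauss_avg assms)

lemma gauss_avg_cmult: "gauss_avg v (\<lambda>y. c * \<phi> y) x = c * gauss_avg v \<phi> x"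
  unfolding gauss_avg_def by simp

lemma gauss_avg_translate: "gauss_avg v (\<lambda>y. \<phi> (y + c)) x = gauss_avg v \<phi> (x + c)"
  unfolding gauss_avg_def by (simp add: add_ac)

lemma measurable_gauss_avg [measurable]:
  assumes [measurable]: "\<phi> \<in> borel_measurable borel"
  shows "gauss_avg v \<phi> \<in> borel_measurable borel"
proof -
  interpret prob_space std_gauss by (rule prob_space_std_gauss)
  show ?thesis unfolding gauss_avg_def by measurable
qed

lemma gauss_add_distr:
  assumes "0 < u" "0 < v"
  shows "distr (std_gauss \<Otimes>\<^sub>M std_gauss) lborel (\<lambda>p. sqrt u * fst p + sqrt v * snd p)
    = density lborel (normal_density 0 (sqrt (u + v)))"
proof -
  interpret G: prob_space std_gauss by (rule prob_space_std_gauss)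
  interpret P: pair_prob_space std_gauss std_gauss ..
  let ?M = "std_gauss \<Otimes>\<^sub>M std_gauss"
  have dF: "distr ?M std_gauss fst = std_gauss"
    by (rule G.distr_pair_fst)
  have dS: "distr ?M std_gauss snd = std_gauss"
  proof (rule measure_eqI)
    fix A assume "A \<in> sets (distr ?M std_gauss snd)"
    then have A: "A \<in> sets std_gauss" by simp
    have "snd -` A \<inter> space ?M = space std_gauss \<times> A"
      by (auto simp: space_pair_measure)
    then show "emeasure (distr ?M std_gauss snd) A = emeasure std_gauss A"
      using A G.emeasure_space_1
      by (simp add: emeasure_distr G.emeasure_pair_measure_Times del: sets_density space_density)
  qed simp
  have "P.indep_var std_gauss fst std_gauss snd"
    unfolding P.indep_var_distribution_eq dF dS
    by (auto simp: distr_id2 simp del: sets_density space_density)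
  then have "P.indep_var borel (\<lambda>p. sqrt u * fst p) borel (\<lambda>p. sqrt v * snd p)"
    using P.indep_var_compose[of std_gauss fst std_gauss snd "\<lambda>x. sqrt u * x" borel "\<lambda>x. sqrt v * x" borel]
    by (simp add: o_def)
  moreover have "distributed ?M lborel (\<lambda>p. 0 + sqrt u * fst p) (normal_density (0 + sqrt u * 0) (\<bar>sqrt u\<bar> * 1))"
    by (rule P.normal_density_affine)
      (use assms dF in \<open>auto simp: distributed_def cong: distr_cong\<close>)
  moreover have "distributed ?M lborel (\<lambda>p. 0 + sqrt v * snd p) (normal_density (0 + sqrt v * 0) (\<bar>sqrt v\<bar> * 1))"
    by (rule P.normal_density_affine)
      (use assms dS in \<open>auto simp: distributed_def cong: distr_cong\<close>)
  ultimately have "distributed ?M lborel (\<lambda>p. sqrt u * fst p + sqrt v * snd p)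
      (normal_density (0 + 0) (sqrt ((sqrt u)\<^sup>2 + (sqrt v)\<^sup>2)))"
    using assms by (intro P.add_indep_normal) auto
  then show ?thesis
    using assms by (simp add: distributed_def)
qed

lemma normal_scale:
  assumes "0 < s"
  shows "density lborel (normal_density 0 s) = distr std_gauss lborel (\<lambda>g. s * g)"
proof -
  interpret G: prob_space std_gauss by (rule prob_space_std_gauss)
  have "distributed std_gauss lborel (\<lambda>p. 0 + s * p) (normal_density (0 + s * 0) (\<bar>s\<bar> * 1))"
    by (rule G.normal_density_affine)
      (use assms in \<open>auto simp: distributed_def distr_id2\<close>)
  then show ?thesis using assms by (simp add: distributed_def)
qed

text \<open>Variances of independent centred Gaussians add, and Fubini turns the iterated average
  into an average over the sum. Variance 0 is split off because \<open>normal_density\<close>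
  describes a law only for a positive deviation.\<close>

lemma gauss_avg_gauss_avg:
  assumes "exp_growth \<phi>" "0 \<le> u" "0 \<le> v"
  shows "gauss_avg u (gauss_avg v \<phi>) x = gauss_avg (u + v) \<phi> x"
proof (cases "u = 0 \<or> v = 0")
  case True
  have "gauss_avg 0 \<phi> = \<phi>" by (rule ext) simp
  then show ?thesis using True by auto
next
  case False
  then have uv: "0 < u" "0 < v" using assms by auto
  interpret G: prob_space std_gauss by (rule prob_space_std_gauss)
  interpret P: pair_prob_space std_gauss std_gauss ..
  have [measurable]: "\<phi> \<in> borel_measurable borel"
    using assms by (auto simp: exp_growth_def)
  let ?M = "std_gauss \<Otimes>\<^sub>M std_gauss"
  let ?f = "\<lambda>p. \<phi> (x + (sqrt u * fst p + sqrt v * snd p))"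
  have eq: "distr ?M lborel (\<lambda>p. sqrt u * fst p + sqrt v * snd p)
      = distr std_gauss lborel (\<lambda>g. sqrt (u + v) * g)"
    using gauss_add_distr[OF uv] normal_scale[of "sqrt (u + v)"] uv by simp
  have "integrable std_gauss (\<lambda>g. \<phi> (x + sqrt (u + v) * g))"
    by (rule integrable_gauss_avg[OF assms(1)])
  then have "integrable (distr std_gauss lborel (\<lambda>g. sqrt (u + v) * g)) (\<lambda>y. \<phi> (x + y))"
    by (subst integrable_distr_eq) auto
  then have int: "integrable ?M ?f"
    unfolding eq[symmetric] by (subst (asm) integrable_distr_eq) auto
  have "gauss_avg u (gauss_avg v \<phi>) x = (LINT g|std_gauss. LINT h|std_gauss. ?f (g, h))"
    by (simp add: gauss_avg_def add.assoc)
  also have "\<dots> = (LINT p|?M. ?f p)"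
    using P.integral_fst'[OF int] by simp
  also have "\<dots> = (LINT y|distr ?M lborel (\<lambda>p. sqrt u * fst p + sqrt v * snd p). \<phi> (x + y))"
    by (subst integral_distr) auto
  also have "\<dots> = gauss_avg (u + v) \<phi> x"
    unfolding eq gauss_avg_def by (subst integral_distr) auto
  finally show ?thesis .
qed

lemma gauss_avg_shift:
  assumes [measurable]: "\<phi> \<in> borel_measurable borel" and "0 \<le> v"
  shows "gauss_avg v (\<lambda>y. \<phi> y * exp (k * (y - x))) x = exp (k\<^sup>2 * v / 2) * gauss_avg v \<phi> (x + k * v)"
proof -
  have "gauss_avg v (\<lambda>y. \<phi> y * exp (k * (y - x))) x
      = (LINT g|std_gauss. \<phi> (x + sqrt v * g) * exp ((k * sqrt v) * g))"
    by (simp add: gauss_avg_def mult.assoc)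
  also have "\<dots> = exp ((k * sqrt v)\<^sup>2 / 2) * (LINT g|std_gauss. \<phi> (x + sqrt v * (g + k * sqrt v)))"
    by (rule gauss_shift) simp
  also have "\<dots> = exp (k\<^sup>2 * v / 2) * gauss_avg v \<phi> (x + k * v)"
    using assms(2) by (simp add: gauss_avg_def power_mult_distrib distrib_left add_ac mult.left_commute)
  finally show ?thesis .
qed

subsection \<open>The Cole-Hopf operator\<close>

lemma lip_abs:
  fixes f :: "real \<Rightarrow> real"
  assumes "L-lipschitz_on UNIV f"
  shows "\<bar>f x - f y\<bar> \<le> L * \<bar>x - y\<bar>"
  using lipschitz_onD[OF assms, of x y] by (simp add: dist_real_def)

lemma lipI:
  fixes f :: "real \<Rightarrow> real"
  assumes "\<And>x y. f x - f y \<le> L * \<bar>x - y\<bar>" "0 \<le> L"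
  shows "L-lipschitz_on UNIV f"
proof (rule lipschitz_onI)
  show "dist (f x) (f y) \<le> L * dist x y" for x y
    using assms(1)[of x y] assms(1)[of y x] by (auto simp: dist_real_def abs_minus_commute)
qed (use assms in auto)

lemma lip_measurable [measurable_dest]:
  fixes f :: "real \<Rightarrow> real"
  assumes "L-lipschitz_on UNIV f"
  shows "f \<in> borel_measurable borel"
  using lipschitz_on_continuous_on[OF assms] by (rule borel_measurable_continuous_onI)

lemma lip_exp_growth:
  assumes "L-lipschitz_on UNIV f"
  shows "exp_growth f"
proof (rule exp_growth_linear)
  show "\<bar>f x\<bar> \<le> \<bar>f 0\<bar> + L * \<bar>x\<bar>" for x
    using lip_abs[OF assms, of x 0] by simp
qed (rule lip_measurable[OF assms])

lemma lip_exp_exp_growth: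
  assumes "L-lipschitz_on UNIV f"
  shows "exp_growth (\<lambda>y. exp (c * f y))"
proof (rule exp_growth_linear_exp[where A = "\<bar>c\<bar> * \<bar>f 0\<bar>" and B = "\<bar>c\<bar> * L"])
  show "c * f x \<le> \<bar>c\<bar> * \<bar>f 0\<bar> + \<bar>c\<bar> * L * \<bar>x\<bar>" for x
  proof -
    have "\<bar>f x\<bar> \<le> \<bar>f 0\<bar> + L * \<bar>x\<bar>" using lip_abs[OF assms, of x 0] by simp
    then have "\<bar>c\<bar> * \<bar>f x\<bar> \<le> \<bar>c\<bar> * (\<bar>f 0\<bar> + L * \<bar>x\<bar>)" by (rule mult_left_mono) simp
    then show ?thesis
      using abs_ge_self[of "c * f x"] by (simp add: abs_mult distrib_left mult.assoc)
  qed
qed (use lip_measurable[OF assms] in measurable)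

lemma exp_growth_ident: "exp_growth (\<lambda>y. y)"
  by (rule exp_growth_linear[where A = 0 and B = 1]) auto

lemma exp_growth_exp_lin: "exp_growth (\<lambda>y. exp (k * (y - x)))"
proof (rule exp_growth_linear_exp[where A = "\<bar>k\<bar> * \<bar>x\<bar>" and B = "\<bar>k\<bar>"])
  show "k * (y - x) \<le> \<bar>k\<bar> * \<bar>x\<bar> + \<bar>k\<bar> * \<bar>y\<bar>" for y
  proof -
    have "k * (y - x) \<le> \<bar>k\<bar> * \<bar>y - x\<bar>" by (metis abs_ge_self abs_mult)
    also have "\<dots> \<le> \<bar>k\<bar> * (\<bar>x\<bar> + \<bar>y\<bar>)" by (rule mult_left_mono) auto
    finally show ?thesis by (simp add: distrib_left)
  qed
qed simp

lemma gauss_avg_ident: "gauss_avg v (\<lambda>y. y) x = x"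
proof -
  interpret G: prob_space std_gauss by (rule prob_space_std_gauss)
  have i: "integrable std_gauss (\<lambda>g. g)" by (rule exp_growth_integrable[OF exp_growth_ident])
  have "(LINT g|std_gauss. g) = 0"
    using integral_std_normal_distribution_moment_odd[of 1] by simp
  then show ?thesis unfolding gauss_avg_def using i G.prob_space by simp
qed

lemma gauss_avg_lin: "gauss_avg v (\<lambda>y. k * (y - z)) x = k * (x - z)"
  by (simp add: gauss_avg_cmult gauss_avg_diff exp_growth_ident exp_growth_const gauss_avg_ident)

text \<open>Jensen's inequality, obtained by averaging the tangent line of exp at the mean
  \<open>?c\<close>; the deviation \<open>f y - ?c\<close> averages to 0.\<close>

lemma exp_gauss_avg_le:
  assumes "exp_growth f" "exp_growth (\<lambda>y. exp (f y))"
  shows "exp (gauss_avg v f x) \<le> gauss_avg v (\<lambda>y. exp (f y)) x"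
proof -
  let ?c = "gauss_avg v f x"
  have eg: "exp_growth (\<lambda>y. exp ?c * (1 + (f y - ?c)))"
    by (intro exp_growth_mult exp_growth_const exp_growth_add exp_growth_diff assms)
  have "exp ?c * (1 + (f y - ?c)) \<le> exp (f y)" for y
  proof -
    have "exp ?c * (1 + (f y - ?c)) \<le> exp ?c * exp (f y - ?c)"
      using exp_ge_add_one_self[of "f y - ?c"] by (intro mult_left_mono) auto
    then show ?thesis by (simp add: exp_add[symmetric])
  qed
  then have "gauss_avg v (\<lambda>y. exp ?c * (1 + (f y - ?c))) x \<le> gauss_avg v (\<lambda>y. exp (f y)) x"
    by (intro gauss_avg_mono eg assms)
  moreover have "gauss_avg v (\<lambda>y. exp ?c * (1 + (f y - ?c))) x = exp ?c"
    by (simp add: gauss_avg_cmult gauss_avg_add gauss_avg_diff exp_growth_const exp_growth_diff assms)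
  ultimately show ?thesis by simp
qed

lemma cole_hopf_gauss_avg:
  "cole_hopf a v f x =
    (if a = 0 then gauss_avg v f x else ln (gauss_avg v (\<lambda>y. exp (a * f y)) x) / a)"
  by (simp add: cole_hopf_def gauss_avg_def)

lemma gauss_avg_exp_pos:
  assumes "L-lipschitz_on UNIV f"
  shows "0 < gauss_avg v (\<lambda>y. exp (a * f y)) x"
proof -
  have "exp (gauss_avg v (\<lambda>y. a * f y) x) \<le> gauss_avg v (\<lambda>y. exp (a * f y)) x"
    by (intro exp_gauss_avg_le lip_exp_exp_growth[OF assms] exp_growth_mult exp_growth_const
        lip_exp_growth[OF assms])
  then show ?thesis by (smt (verit) exp_gt_zero)
qed

lemma exp_cole_hopf:
  assumes "L-lipschitz_on UNIV f" "a \<noteq> 0"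
  shows "exp (a * cole_hopf a v f x) = gauss_avg v (\<lambda>y. exp (a * f y)) x"
  using gauss_avg_exp_pos[OF assms(1)] assms(2) by (simp add: cole_hopf_gauss_avg)

text \<open>For \<open>u = cole_hopf a v f x\<close> the right-hand side is 1, so
  \<open>exp (a * (f y - u))\<close> is a probability density with respect to the Gaussian. Many
  estimates below are expectations under this tilted law.\<close>

lemma cole_hopf_tilt:
  assumes "L-lipschitz_on UNIV f" "a \<noteq> 0"
  shows "gauss_avg v (\<lambda>y. exp (a * (f y - u))) x = exp (a * (cole_hopf a v f x - u))"
proof -
  have "(\<lambda>y. exp (a * (f y - u))) = (\<lambda>y. exp (- (a * u)) * exp (a * f y))"
    by (auto simp: exp_add[symmetric] algebra_simps)
  then have "gauss_avg v (\<lambda>y. exp (a * (f y - u))) x = exp (- (a * u)) * gauss_avg v (\<lambda>y. exp (a * f y)) x"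
    by (simp add: gauss_avg_cmult)
  also have "\<dots> = exp (a * (cole_hopf a v f x - u))"
    unfolding exp_cole_hopf[OF assms, symmetric] by (simp add: exp_add[symmetric] algebra_simps)
  finally show ?thesis .
qed

section \<open>Order, translation and convexity properties of the Cole-Hopf operator\<close>

lemma lip_add_const: "L-lipschitz_on UNIV f \<Longrightarrow> L-lipschitz_on UNIV (\<lambda>y. f y + (c::real))" for f :: "real \<Rightarrow> real"
  by (simp add: lipschitz_on_def)

lemma lip_translate: "L-lipschitz_on UNIV f \<Longrightarrow> L-lipschitz_on UNIV (\<lambda>y. f (y + c))" for f :: "real \<Rightarrow> real"
  using lipI[of "\<lambda>y. f (y + c)" L] lip_abs[of L f] lipschitz_on_nonneg[of L UNIV f]
  by (metis abs_ge_self add_diff_cancel_right order_trans)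

lemma cole_hopf_mono:
  assumes "L-lipschitz_on UNIV f" "M-lipschitz_on UNIV g" "0 \<le> a" "\<And>y. f y \<le> g y"
  shows "cole_hopf a v f x \<le> cole_hopf a v g x"
proof (cases "a = 0")
  case True
  then show ?thesis
    using assms by (auto simp: cole_hopf_gauss_avg intro!: gauss_avg_mono lip_exp_growth)
next
  case False
  then have "gauss_avg v (\<lambda>y. exp (a * f y)) x \<le> gauss_avg v (\<lambda>y. exp (a * g y)) x"
    using assms by (intro gauss_avg_mono lip_exp_exp_growth) auto
  then show ?thesis
    using gauss_avg_exp_pos[OF assms(1)] gauss_avg_exp_pos[OF assms(2)] assms(3) False
    by (simp add: cole_hopf_gauss_avg divide_right_mono)
qed

lemma cole_hopf_add_const:
  assumes "L-lipschitz_on UNIV f"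
  shows "cole_hopf a v (\<lambda>y. f y + c) x = cole_hopf a v f x + c"
proof (cases "a = 0")
  case True
  then show ?thesis
    using gauss_avg_add[OF lip_exp_growth[OF assms] exp_growth_const]
    by (simp add: cole_hopf_gauss_avg)
next
  case False
  have "exp (a * (cole_hopf a v (\<lambda>y. f y + c) x - c)) = gauss_avg v (\<lambda>y. exp (a * ((f y + c) - c))) x"
    by (rule cole_hopf_tilt[OF lip_add_const[OF assms] False, symmetric])
  also have "\<dots> = exp (a * cole_hopf a v f x)"
    by (simp add: exp_cole_hopf[OF assms False])
  finally show ?thesis using False by simp
qed

lemma cole_hopf_translate: "cole_hopf a v (\<lambda>y. f (y + c)) x = cole_hopf a v f (x + c)"
  using gauss_avg_translate[of v f c x] gauss_avg_translate[of v "\<lambda>y. exp (a * f y)" c x]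
  by (simp add: cole_hopf_gauss_avg)

text \<open>A monotone operator that commutes with translations and with the addition of constants
  preserves every Lipschitz constant: compare two translates of \<open>f\<close>, which differ by at
  most \<open>L * \<bar>x - y\<bar>\<close>.\<close>

lemma cole_hopf_lip:
  assumes "L-lipschitz_on UNIV f" "0 \<le> a"
  shows "L-lipschitz_on UNIV (cole_hopf a v f)"
proof (rule lipI)
  fix x y
  have le: "f (z + x) \<le> f (z + y) + L * \<bar>x - y\<bar>" for z
    using lip_abs[OF assms(1), of "z + x" "z + y"] by auto
  have "cole_hopf a v (\<lambda>z. f (z + x)) 0 \<le> cole_hopf a v (\<lambda>z. f (z + y) + L * \<bar>x - y\<bar>) 0"
    using assms by (intro cole_hopf_mono lip_add_const lip_translate le)
  then show "cole_hopf a v f x - cole_hopf a v f y \<le> L * \<bar>x - y\<bar>"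
    using cole_hopf_add_const[OF lip_translate[OF assms(1)]] by (simp add: cole_hopf_translate)
qed (use assms lipschitz_on_nonneg in blast)

lemma cole_hopf_le_add:
  assumes "L-lipschitz_on UNIV f" "M-lipschitz_on UNIV g" "0 \<le> a" "\<And>y. f y \<le> g y + c"
  shows "cole_hopf a v f x \<le> cole_hopf a v g x + c"
  using cole_hopf_mono[OF assms(1) lip_add_const[OF assms(2)] assms(3,4)]
    cole_hopf_add_const[OF assms(2)] by simp

lemma cole_hopf_scale:
  assumes "l \<noteq> 0"
  shows "cole_hopf a v (\<lambda>y. l * f y) x = l * cole_hopf (l * a) v f x"
  using assms by (simp add: cole_hopf_gauss_avg gauss_avg_cmult mult_ac)

lemma cole_hopf_semigroup:
  assumes "L-lipschitz_on UNIV f" "0 \<le> a" "0 \<le> u" "0 \<le> v"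
  shows "cole_hopf a u (cole_hopf a v f) x = cole_hopf a (u + v) f x"
proof (cases "a = 0")
  case True
  then have "cole_hopf a v f = gauss_avg v f"
    by (auto simp: cole_hopf_gauss_avg)
  with True show ?thesis
    using assms gauss_avg_gauss_avg[OF lip_exp_growth[OF assms(1)]] by (simp add: cole_hopf_gauss_avg)
next
  case False
  have "exp (a * cole_hopf a u (cole_hopf a v f) x) = exp (a * cole_hopf a (u + v) f x)"
    using assms gauss_avg_gauss_avg[OF lip_exp_exp_growth[OF assms(1)]]
    by (simp add: exp_cole_hopf[OF _ False] exp_cole_hopf[OF cole_hopf_lip[OF assms(1,2)] False])
  then show ?thesis using False by simp
qed

lemma cole_hopf_variance_0 [simp]: "cole_hopf a 0 f x = f x"
  by (simp add: cole_hopf_gauss_avg)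

text \<open>Hoelder's inequality for fixed \<open>a\<close>: both exponentials are normalized to
  mean 1 before convexity of exp is applied pointwise. Three functions instead of one are allowed
  because in the iteration the data belonging to the three parameters differ.\<close>

lemma cole_hopf_convex_triple:
  assumes "K-lipschitz_on UNIV f" "L-lipschitz_on UNIV f1" "M-lipschitz_on UNIV f2"
    and "0 \<le> a" "0 \<le> \<theta>" "\<theta> \<le> 1"
    and "\<And>x y. f (\<theta> * x + (1 - \<theta>) * y) \<le> \<theta> * f1 x + (1 - \<theta>) * f2 y"
  shows "cole_hopf a v f (\<theta> * x + (1 - \<theta>) * y)
    \<le> \<theta> * cole_hopf a v f1 x + (1 - \<theta>) * cole_hopf a v f2 y"
proof -
  let ?z = "\<theta> * x + (1 - \<theta>) * y"
  have pt: "f (u + ?z) \<le> \<theta> * f1 (u + x) + (1 - \<theta>) * f2 (u + y)" for u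
    using assms(7)[of "u + x" "u + y"] by (simp add: algebra_simps)
  note tr = lip_translate[OF assms(1), of ?z] lip_translate[OF assms(2), of x] lip_translate[OF assms(3), of y]
  show ?thesis
  proof (cases "a = 0")
    case True
    have "gauss_avg v (\<lambda>u. f (u + ?z)) 0
        \<le> gauss_avg v (\<lambda>u. \<theta> * f1 (u + x) + (1 - \<theta>) * f2 (u + y)) 0"
      using pt by (intro gauss_avg_mono exp_growth_add exp_growth_mult exp_growth_const
          lip_exp_growth[OF tr(1)] lip_exp_growth[OF tr(2)] lip_exp_growth[OF tr(3)])
    also have "\<dots> = \<theta> * gauss_avg v f1 x + (1 - \<theta>) * gauss_avg v f2 y"
      using gauss_avg_translate[of v f1 x 0] gauss_avg_translate[of v f2 y 0]
      by (subst gauss_avg_add)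
        (auto simp: gauss_avg_cmult intro!: exp_growth_mult exp_growth_const
          lip_exp_growth[OF tr(2)] lip_exp_growth[OF tr(3)])
    finally show ?thesis
      using True gauss_avg_translate[of v f ?z 0] by (simp add: cole_hopf_gauss_avg)
  next
    case False
    let ?u = "cole_hopf a v f1 x" and ?w = "cole_hopf a v f2 y"
    have eg: "exp_growth (\<lambda>u. exp (a * (f1 (u + x) - ?u)))" "exp_growth (\<lambda>u. exp (a * (f2 (u + y) - ?w)))"
      "exp_growth (\<lambda>u. exp (a * (f (u + ?z) - (\<theta> * ?u + (1 - \<theta>) * ?w))))"
      using lip_exp_exp_growth[OF lip_add_const[OF tr(2), of "- ?u"], of a]
        lip_exp_exp_growth[OF lip_add_const[OF tr(3), of "- ?w"], of a]
        lip_exp_exp_growth[OF lip_add_const[OF tr(1), of "- (\<theta> * ?u + (1 - \<theta>) * ?w)"], of a]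
      by (simp_all only: add_uminus_conv_diff)
    have conv: "exp (\<theta> * p + (1 - \<theta>) * q) \<le> \<theta> * exp p + (1 - \<theta>) * exp q" for p q :: real
      using convex_onD[OF exp_convex, of "1 - \<theta>" p q] assms(5,6) by simp
    have "exp (a * (f (u + ?z) - (\<theta> * ?u + (1 - \<theta>) * ?w)))
        \<le> \<theta> * exp (a * (f1 (u + x) - ?u)) + (1 - \<theta>) * exp (a * (f2 (u + y) - ?w))" for u
    proof -
      have "a * (f (u + ?z) - (\<theta> * ?u + (1 - \<theta>) * ?w))
          \<le> a * (\<theta> * f1 (u + x) + (1 - \<theta>) * f2 (u + y) - (\<theta> * ?u + (1 - \<theta>) * ?w))"
        using pt[of u] assms(4) by (intro mult_left_mono) auto
      also have "\<dots> = \<theta> * (a * (f1 (u + x) - ?u)) + (1 - \<theta>) * (a * (f2 (u + y) - ?w))"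
        by (simp add: algebra_simps)
      finally show ?thesis
        using conv order_trans exp_le_cancel_iff by blast
    qed
    then have "gauss_avg v (\<lambda>u. exp (a * (f (u + ?z) - (\<theta> * ?u + (1 - \<theta>) * ?w)))) 0
        \<le> gauss_avg v (\<lambda>u. \<theta> * exp (a * (f1 (u + x) - ?u)) + (1 - \<theta>) * exp (a * (f2 (u + y) - ?w))) 0"
      by (intro gauss_avg_mono exp_growth_add exp_growth_mult exp_growth_const eg)
    also have "\<dots> = \<theta> * gauss_avg v (\<lambda>u. exp (a * (f1 (u + x) - ?u))) 0
        + (1 - \<theta>) * gauss_avg v (\<lambda>u. exp (a * (f2 (u + y) - ?w))) 0"
      by (subst gauss_avg_add)
        (auto simp: gauss_avg_cmult intro!: exp_growth_mult exp_growth_const eg)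
    also have "\<dots> = 1"
      using cole_hopf_tilt[OF tr(2) False] cole_hopf_tilt[OF tr(3) False]
      by (simp add: cole_hopf_translate)
    finally have "exp (a * (cole_hopf a v f ?z - (\<theta> * ?u + (1 - \<theta>) * ?w))) \<le> 1"
      using cole_hopf_tilt[OF tr(1) False, where x = 0] by (simp add: cole_hopf_translate)
    then show ?thesis using False assms(4) by (simp add: mult_le_0_iff)
  qed
qed

lemma cole_hopf_convex:
  assumes "L-lipschitz_on UNIV f" "convex_on UNIV f" "0 \<le> a"
  shows "convex_on UNIV (cole_hopf a v f)"
proof (rule convex_onI)
  fix t x y :: real
  assume t: "0 < t" "t < 1"
  have "f ((1 - t) * x + (1 - (1 - t)) * y) \<le> (1 - t) * f x + (1 - (1 - t)) * f y" for x y
    using convex_onD[OF assms(2), of t x y] t by simp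
  then show "cole_hopf a v f ((1 - t) *\<^sub>R x + t *\<^sub>R y)
      \<le> (1 - t) * cole_hopf a v f x + t * cole_hopf a v f y"
    using cole_hopf_convex_triple[OF assms(1) assms(1) assms(1) assms(3), of "1 - t" v x y] t by simp
qed simp

text \<open>One half of the variational formula for log-Laplace transforms: tilting by a linear
  weight of slope \<open>a * p\<close> moves the Gaussian by \<open>a * v * p\<close>, and Jensen
  bounds what remains. Shift and cost are both linear in \<open>a\<close>, which makes the bound
  useful for convexity in \<open>a\<close>.\<close>

lemma cole_hopf_ge_shift:
  assumes "L-lipschitz_on UNIV f" "0 \<le> a" "0 \<le> v"
  shows "gauss_avg v f (x + a * v * p) - a * v * p\<^sup>2 / 2 \<le> cole_hopf a v f x"
proof (cases "a = 0")
  case True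
  then show ?thesis by (simp add: cole_hopf_gauss_avg)
next
  case False
  define k where "k = a * p"
  have [measurable]: "f \<in> borel_measurable borel" by (rule lip_measurable[OF assms(1)])
  let ?\<phi> = "\<lambda>y. exp (a * f y - k * (y - x))"
  have eg: "exp_growth (\<lambda>y. a * f y - k * (y - x))"
    by (intro exp_growth_diff exp_growth_mult exp_growth_const lip_exp_growth[OF assms(1)] exp_growth_ident)
  have eg2: "exp_growth ?\<phi>"
    using exp_growth_mult[OF lip_exp_exp_growth[OF assms(1), of a] exp_growth_exp_lin[of "- k" x]]
    by (simp add: exp_add[symmetric])
  have "exp (a * cole_hopf a v f x) = gauss_avg v (\<lambda>y. ?\<phi> y * exp (k * (y - x))) x"
    by (simp add: exp_cole_hopf[OF assms(1) False] exp_add[symmetric])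
  also have "\<dots> = exp (k\<^sup>2 * v / 2) * gauss_avg v ?\<phi> (x + k * v)"
    using assms(3) by (rule gauss_avg_shift[rotated]) measurable
  also have "\<dots> \<ge> exp (k\<^sup>2 * v / 2) * exp (gauss_avg v (\<lambda>y. a * f y - k * (y - x)) (x + k * v))"
    by (intro mult_left_mono exp_gauss_avg_le eg eg2) simp
  also have "gauss_avg v (\<lambda>y. a * f y - k * (y - x)) (x + k * v) = a * gauss_avg v f (x + k * v) - k * (k * v)"
    by (subst gauss_avg_diff)
      (auto simp: gauss_avg_lin gauss_avg_cmult intro!: exp_growth_diff exp_growth_mult exp_growth_const
          lip_exp_growth[OF assms(1)] exp_growth_ident)
  finally have "k\<^sup>2 * v / 2 + (a * gauss_avg v f (x + k * v) - k * (k * v)) \<le> a * cole_hopf a v f x"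
    by (simp add: exp_add[symmetric])
  moreover have "k\<^sup>2 * v / 2 + (a * gauss_avg v f (x + k * v) - k * (k * v))
      = a * (gauss_avg v f (x + a * v * p) - a * v * p\<^sup>2 / 2)"
    by (simp add: k_def field_simps power2_eq_square)
  ultimately show ?thesis using False assms(2) by simp
qed

section \<open>Semiconcave data and the short-time upper bound\<close>

definition semiconcave :: "real \<Rightarrow> (real \<Rightarrow> real) \<Rightarrow> bool" where
  "semiconcave K f \<longleftrightarrow> 0 \<le> K \<and> (\<forall>x y. f (x + y) + f (x - y) - 2 * f x \<le> K * y\<^sup>2)"

lemma exp_le_quadratic:
  fixes z M :: real
  assumes "\<bar>z\<bar> \<le> M"
  shows "exp z \<le> 1 + z + z\<^sup>2 * exp M"
proof -
  obtain t where t: "\<bar>t\<bar> \<le> \<bar>z\<bar>" "exp z = (\<Sum>m<2. z ^ m / fact m) + exp t / fact 2 * z ^ 2"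
    using Maclaurin_exp_le[of z 2] by auto
  have "exp t / 2 * z\<^sup>2 \<le> exp M * z\<^sup>2"
  proof (rule mult_right_mono)
    have "exp t \<le> exp M" using t(1) assms by simp
    then show "exp t / 2 \<le> exp M" using exp_gt_zero[of t] by linarith
  qed simp
  then show ?thesis using t(2) by (simp add: numeral_2_eq_2 mult.commute)
qed

text \<open>The constant does not involve \<open>v\<close>, so it serves all intermediate times when
  the variance is subdivided. The summand 2 covers increments \<open>\<bar>y\<bar> \<ge> 1\<close>,
  where the Lipschitz bound \<open>2 * \<bar>y\<bar>\<close> suffices; for smaller ones the tilted
  law averages the second difference of \<open>f\<close>, and \<open>2 * a * exp a\<close> comes
  from the quadratic remainder of exp.\<close>

lemma cole_hopf_semiconcave:
  assumes f: "1-lipschitz_on UNIV f" "semiconcave K f" and a: "0 \<le> a"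
  shows "semiconcave (K + 2 + 2 * a * exp a) (cole_hopf a v f)"
  unfolding semiconcave_def
proof (intro conjI allI)
  have K: "0 \<le> K" "\<And>x y. f (x + y) + f (x - y) - 2 * f x \<le> K * y\<^sup>2"
    using f(2) by (auto simp: semiconcave_def)
  then show "0 \<le> K + 2 + 2 * a * exp a" using a by simp
  fix x y :: real
  let ?T = "cole_hopf a v f"
  note tr = lip_translate[OF f(1), of y] lip_translate[OF f(1), of "- y"]
  have "?T (x + y) + ?T (x - y) - 2 * ?T x \<le> (if 1 \<le> \<bar>y\<bar> then 2 else K + 2 * a * exp a) * y\<^sup>2"
  proof (cases "1 \<le> \<bar>y\<bar>")
    case True
    have "?T (x + y) + ?T (x - y) - 2 * ?T x \<le> 2 * \<bar>y\<bar>"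
      using lip_abs[OF cole_hopf_lip[OF f(1) a], of v "x + y" x]
        lip_abs[OF cole_hopf_lip[OF f(1) a], of v "x - y" x] by auto
    moreover have "\<bar>y\<bar> * 1 \<le> \<bar>y\<bar> * \<bar>y\<bar>"
      using True by (intro mult_left_mono) auto
    ultimately show ?thesis using True by (simp add: power2_eq_square)
  next
    case y: False
    show ?thesis
    proof (cases "a = 0")
      case True
      have "gauss_avg v (\<lambda>z. f (z + y) + f (z + - y) - 2 * f z) x \<le> gauss_avg v (\<lambda>_. K * y\<^sup>2) x"
        using K(2) by (intro gauss_avg_mono exp_growth_add exp_growth_diff exp_growth_mult
            exp_growth_const lip_exp_growth[OF tr(1)] lip_exp_growth[OF tr(2)] lip_exp_growth[OF f(1)]) simp
      moreover have "gauss_avg v (\<lambda>z. f (z + y) + f (z + - y) - 2 * f z) x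
          = gauss_avg v f (x + y) + gauss_avg v f (x + - y) - 2 * gauss_avg v f x"
        unfolding gauss_avg_translate[symmetric, of v f] gauss_avg_cmult[symmetric]
        by (subst gauss_avg_diff gauss_avg_add, intro exp_growth_add exp_growth_diff exp_growth_mult
            exp_growth_const lip_exp_growth[OF tr(1)] lip_exp_growth[OF tr(2)] lip_exp_growth[OF f(1)],
            intro exp_growth_add exp_growth_diff exp_growth_mult
            exp_growth_const lip_exp_growth[OF tr(1)] lip_exp_growth[OF tr(2)] lip_exp_growth[OF f(1)])+
          (rule refl)
      ultimately show ?thesis using True y by (simp add: cole_hopf_gauss_avg)
    next
      case False
      \<comment> \<open>Sum of the bounds \<open>one\<close> for the increments y and -y, with
        semiconcavity applied to the linear terms.\<close>
      let ?c = "2 + a * K * y\<^sup>2 + 2 * a\<^sup>2 * exp a * y\<^sup>2"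
      define q where "q z = exp (a * (f z - ?T x))" for z
      have egq: "exp_growth q"
        unfolding q_def using lip_exp_exp_growth[OF lip_add_const[OF f(1), of "- ?T x"], of a] by simp
      have q1: "gauss_avg v q x = 1"
        unfolding q_def using cole_hopf_tilt[OF f(1) False] by simp
      have e: "exp (a * (?T (x + s) - ?T x)) = gauss_avg v (\<lambda>z. exp (a * (f (z + s) - ?T x))) x" for s
        using cole_hopf_tilt[OF lip_translate[OF f(1)] False] by (simp add: cole_hopf_translate)
      have eg: "exp_growth (\<lambda>z. exp (a * (f (z + s) - ?T x)))" for s
        using lip_exp_exp_growth[OF lip_add_const[OF lip_translate[OF f(1), of s], of "- ?T x"], of a] by simp
      have one: "exp (a * (f (z + s) - f z)) \<le> 1 + a * (f (z + s) - f z) + a\<^sup>2 * y\<^sup>2 * exp a"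
        if "\<bar>s\<bar> = \<bar>y\<bar>" for z s
      proof -
        have "\<bar>f (z + s) - f z\<bar> \<le> \<bar>y\<bar>" using lip_abs[OF f(1), of "z + s" z] that by simp
        then have le: "\<bar>a * (f (z + s) - f z)\<bar> \<le> a * \<bar>y\<bar>"
          using a by (simp add: abs_mult mult_left_mono)
        also have "a * \<bar>y\<bar> \<le> a" using y a by (simp add: mult_left_le)
        finally have "exp (a * (f (z + s) - f z))
            \<le> 1 + a * (f (z + s) - f z) + (a * (f (z + s) - f z))\<^sup>2 * exp a"
          by (rule exp_le_quadratic)
        moreover have "(a * (f (z + s) - f z))\<^sup>2 \<le> (a * \<bar>y\<bar>)\<^sup>2"
          using le by (metis abs_ge_zero power2_abs power_mono)
        then have "(a * (f (z + s) - f z))\<^sup>2 * exp a \<le> (a * \<bar>y\<bar>)\<^sup>2 * exp a"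
          by (rule mult_right_mono) simp
        ultimately show ?thesis by (simp add: power_mult_distrib)
      qed
      have pt: "exp (a * (f (z + y) - ?T x)) + exp (a * (f (z + - y) - ?T x)) \<le> ?c * q z" for z
      proof -
        have fac: "exp (a * (f (z + s) - ?T x)) = q z * exp (a * (f (z + s) - f z))" for s
          by (simp add: q_def exp_add[symmetric] algebra_simps)
        have "exp (a * (f (z + y) - ?T x)) + exp (a * (f (z + - y) - ?T x))
            = q z * (exp (a * (f (z + y) - f z)) + exp (a * (f (z + - y) - f z)))"
          unfolding fac by (rule distrib_left[symmetric])
        also have "\<dots> \<le> q z * ?c"
        proof (rule mult_left_mono)
          have "a * (f (z + y) + f (z - y) - 2 * f z) \<le> a * (K * y\<^sup>2)"
            using K(2)[of z y] a by (rule mult_left_mono)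
          then show "exp (a * (f (z + y) - f z)) + exp (a * (f (z + - y) - f z)) \<le> ?c"
            using one[of y z] one[of "- y" z] by (simp add: algebra_simps)
        qed (simp add: q_def)
        finally show ?thesis by (simp add: mult.commute)
      qed
      have "exp (a * (?T (x + y) - ?T x)) + exp (a * (?T (x + - y) - ?T x))
          = gauss_avg v (\<lambda>z. exp (a * (f (z + y) - ?T x)) + exp (a * (f (z + - y) - ?T x))) x"
        unfolding e by (rule gauss_avg_add[symmetric]) (rule eg)+
      also have "\<dots> \<le> gauss_avg v (\<lambda>z. ?c * q z) x"
        by (intro gauss_avg_mono exp_growth_add exp_growth_mult exp_growth_const eg egq pt)
      also have "\<dots> = ?c" by (simp add: gauss_avg_cmult q1)
      finally have "a * (?T (x + y) - ?T x) + a * (?T (x + - y) - ?T x) \<le> ?c - 2"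
        using exp_ge_add_one_self[of "a * (?T (x + y) - ?T x)"]
          exp_ge_add_one_self[of "a * (?T (x + - y) - ?T x)"] by linarith
      then have "a * (?T (x + y) + ?T (x - y) - 2 * ?T x) \<le> a * ((K + 2 * a * exp a) * y\<^sup>2)"
        by (simp add: algebra_simps power2_eq_square)
      then show ?thesis using False a y by simp
    qed
  qed
  also have "\<dots> \<le> (K + 2 + 2 * a * exp a) * y\<^sup>2"
    using K(1) a by (intro mult_right_mono) auto
  finally show "?T (x + y) + ?T (x - y) - 2 * ?T x \<le> (K + 2 + 2 * a * exp a) * y\<^sup>2" .
qed

lemma convex_lip_subgradient:
  assumes "convex_on UNIV f" "1-lipschitz_on UNIV f"
  obtains p :: real where "\<bar>p\<bar> \<le> 1" "\<And>y. f x + p * (y - x) \<le> f y"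
proof -
  define p where "p = Inf ((\<lambda>t. (f x - f t) / (x - t)) ` ({x<..} \<inter> UNIV))"
  have p: "f x + p * (y - x) \<le> f y" for y
    using convex_le_Inf_differential[OF assms(1), of x y] by (simp add: p_def)
  have "\<bar>p\<bar> \<le> 1"
    using p[of "x + 1"] p[of "x - 1"] lip_abs[OF assms(2), of "x + 1" x] lip_abs[OF assms(2), of "x - 1" x]
    by auto
  with p that show ?thesis by blast
qed

lemma pow4_le_exp:
  fixes u :: real
  assumes "0 \<le> u"
  shows "u ^ 4 \<le> 24 * exp u"
proof -
  have "u ^ 4 /\<^sub>R fact 4 \<le> (\<Sum>n. u ^ n /\<^sub>R fact n)"
    using sum_le_suminf[OF summable_exp_generic[of u], of "{4}"] assms by auto
  then show ?thesis by (simp add: exp_def fact_numeral)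
qed

text \<open>The bound \<open>cole_hopf_ge_shift\<close> is sharp to second order in \<open>v\<close>
  when \<open>p\<close> is a subgradient at \<open>x\<close>. Removing the supporting line leaves
  \<open>R\<close> with \<open>0 \<le> R y\<close> and \<open>R y \<le> K * (y - x)\<^sup>2\<close>;
  as y - x is of order sqrt v, the quadratic remainder of \<open>exp (a * R y)\<close> is of order
  \<open>v\<^sup>2\<close>. The constant depends on \<open>a\<close> and \<open>K\<close> only, not
  on the function.\<close>

lemma cole_hopf_le_shift:
  assumes "0 < a" "0 \<le> K"
  obtains C where "0 \<le> C"
    "\<And>\<phi> v x. 1-lipschitz_on UNIV \<phi> \<Longrightarrow> convex_on UNIV \<phi> \<Longrightarrow> semiconcave K \<phi> \<Longrightarrow> 0 \<le> v \<Longrightarrow> v \<le> 1 \<Longrightarrow>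
      \<exists>p. cole_hopf a v \<phi> x \<le> gauss_avg v \<phi> (x + a * v * p) - a * v * p\<^sup>2 / 2 + C * v\<^sup>2"
proof -
  \<comment> \<open>Product of \<open>exp (\<bar>g\<bar> + a)\<close>, which dominates the fourth
    power of \<open>\<bar>g\<bar> + a\<close> up to the factor 24, and of
    \<open>exp (2 * a * (\<bar>g\<bar> + a))\<close>, which dominates
    \<open>exp (a * R y)\<close>.\<close>
  define h where "h g = exp ((2 * a + 1) * (\<bar>g\<bar> + a))" for g :: real
  have egh: "exp_growth h"
    unfolding h_def using assms
    by (intro exp_growth_linear_exp[where A = "(2 * a + 1) * a" and B = "2 * a + 1"])
      (auto simp: algebra_simps)
  define M where "M = 24 * a\<^sup>2 * K\<^sup>2 * (LINT g|std_gauss. h g)"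
  have M0: "0 \<le> M"
    unfolding M_def by (intro mult_nonneg_nonneg integral_nonneg_AE) (auto simp: h_def)
  show ?thesis
  proof (rule that[of "M / a"])
    show "0 \<le> M / a" using M0 assms by simp
    fix \<phi> :: "real \<Rightarrow> real" and v x :: real
    assume lip: "1-lipschitz_on UNIV \<phi>" and cvx: "convex_on UNIV \<phi>" and sc: "semiconcave K \<phi>"
      and v: "0 \<le> v" "v \<le> 1"
    have [measurable]: "\<phi> \<in> borel_measurable borel" by (rule lip_measurable[OF lip])
    obtain p where p: "\<bar>p\<bar> \<le> 1" "\<And>y. \<phi> x + p * (y - x) \<le> \<phi> y"
      using convex_lip_subgradient[OF cvx lip] by blast
    define R where "R y = \<phi> y - \<phi> x - p * (y - x)" for y
    have [measurable]: "R \<in> borel_measurable borel" unfolding R_def by measurable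
    have R0: "0 \<le> R y" for y using p(2)[of y] by (simp add: R_def)
    \<comment> \<open>The subgradient inequality at the reflected point 2x - y turns the second
      difference into a bound on \<open>R y\<close> alone.\<close>
    have R1: "R y \<le> K * (y - x)\<^sup>2" for y
    proof -
      have "\<phi> (x + (y - x)) + \<phi> (x - (y - x)) - 2 * \<phi> x \<le> K * (y - x)\<^sup>2"
        using sc unfolding semiconcave_def by blast
      moreover have "x - (y - x) = 2 * x - y" "p * (2 * x - y - x) = - (p * (y - x))"
        by (simp_all add: algebra_simps)
      ultimately show ?thesis
        using p(2)[of "2 * x - y"] unfolding R_def by simp
    qed
    have R2: "R y \<le> 2 * \<bar>y - x\<bar>" for y
    proof -
      have "\<bar>p * (y - x)\<bar> \<le> 1 * \<bar>y - x\<bar>" unfolding abs_mult by (rule mult_right_mono) (use p in auto)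
      then show ?thesis using lip_abs[OF lip, of y x] unfolding R_def by linarith
    qed
    have egR: "exp_growth R"
      unfolding R_def by (intro exp_growth_diff exp_growth_mult exp_growth_const exp_growth_ident lip_exp_growth[OF lip])
    have egeR: "exp_growth (\<lambda>y. exp (a * R y))"
    proof -
      have "(\<lambda>y. exp (a * R y)) = (\<lambda>y. exp (a * \<phi> y) * (exp (- (a * p) * (y - x)) * exp (- (a * \<phi> x))))"
        by (auto simp: R_def exp_add[symmetric] algebra_simps)
      then show ?thesis
        by (simp only:) (intro exp_growth_mult lip_exp_exp_growth[OF lip] exp_growth_exp_lin exp_growth_const)
    qed
    define k where "k = a * p"
    let ?z = "x + k * v"
    have "exp (a * cole_hopf a v \<phi> x) = gauss_avg v (\<lambda>y. (exp (a * \<phi> x) * exp (a * R y)) * exp (k * (y - x))) x"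
      using assms lip by (simp add: exp_cole_hopf exp_add[symmetric] R_def k_def algebra_simps)
    also have "\<dots> = exp (k\<^sup>2 * v / 2) * gauss_avg v (\<lambda>y. exp (a * \<phi> x) * exp (a * R y)) ?z"
      using v(1) by (rule gauss_avg_shift[rotated]) measurable
    also have "\<dots> = exp (k\<^sup>2 * v / 2 + a * \<phi> x) * gauss_avg v (\<lambda>y. exp (a * R y)) ?z"
      by (simp add: gauss_avg_cmult exp_add)
    also have "gauss_avg v (\<lambda>y. exp (a * R y)) ?z \<le> 1 + a * gauss_avg v R ?z + M * v\<^sup>2"
    proof -
      have "gauss_avg v (\<lambda>y. exp (a * R y)) ?z - (1 + a * gauss_avg v R ?z)
          = gauss_avg v (\<lambda>y. exp (a * R y) - (1 + a * R y)) ?z"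
        by (simp add: gauss_avg_diff gauss_avg_add gauss_avg_cmult exp_growth_add exp_growth_mult
            exp_growth_const egR egeR)
      also have "\<dots> \<le> (LINT g|std_gauss. v\<^sup>2 * (24 * a\<^sup>2 * K\<^sup>2) * h g)"
        unfolding gauss_avg_def
      proof (rule integral_mono)
        show "integrable std_gauss (\<lambda>g. exp (a * R (?z + sqrt v * g)) - (1 + a * R (?z + sqrt v * g)))"
          by (rule integrable_gauss_avg) (intro exp_growth_diff exp_growth_add exp_growth_mult
            exp_growth_const egR egeR)
        show "integrable std_gauss (\<lambda>g. v\<^sup>2 * (24 * a\<^sup>2 * K\<^sup>2) * h g)"
          using exp_growth_integrable[OF egh] by (rule integrable_mult_right)
        fix g
        define y where "y = ?z + sqrt v * g"
        \<comment> \<open>The drift \<open>k * v\<close> is absorbed because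
          \<open>v \<le> 1\<close> gives \<open>v \<le> sqrt v\<close>.\<close>
        have yx: "\<bar>y - x\<bar> \<le> sqrt v * (\<bar>g\<bar> + a)"
        proof -
          have "\<bar>k * v\<bar> \<le> a * sqrt v"
          proof -
            have "\<bar>k\<bar> \<le> a * 1" unfolding k_def abs_mult using p(1) assms by (intro mult_mono) auto
            moreover have "v \<le> sqrt v" using v by (metis real_sqrt_le_1_iff real_sqrt_pow2 power2_eq_square mult_left_le real_sqrt_ge_zero)
            ultimately show ?thesis unfolding abs_mult using v assms by (intro mult_mono) auto
          qed
          moreover have "\<bar>sqrt v * g\<bar> = sqrt v * \<bar>g\<bar>" using v by (simp add: abs_mult)
          ultimately show ?thesis by (simp add: y_def algebra_simps)
        qed
        have yx1: "\<bar>y - x\<bar> \<le> \<bar>g\<bar> + a"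
        proof -
          have "sqrt v * (\<bar>g\<bar> + a) \<le> 1 * (\<bar>g\<bar> + a)"
            using v assms by (intro mult_right_mono) auto
          then show ?thesis using yx by simp
        qed
        have "(a * R y)\<^sup>2 \<le> (a * (K * (sqrt v * (\<bar>g\<bar> + a))\<^sup>2))\<^sup>2"
        proof -
          have "(y - x)\<^sup>2 \<le> (sqrt v * (\<bar>g\<bar> + a))\<^sup>2"
            using yx by (metis abs_ge_zero power2_abs power_mono)
          then have "R y \<le> K * (sqrt v * (\<bar>g\<bar> + a))\<^sup>2"
            using R1[of y] assms(2) by (meson mult_left_mono order_trans)
          then show ?thesis using R0[of y] assms by (intro power_mono mult_left_mono) auto
        qed
        also have "\<dots> = v\<^sup>2 * (a\<^sup>2 * K\<^sup>2) * (\<bar>g\<bar> + a) ^ 4"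
          using v by (simp add: power_mult_distrib power_mult[symmetric])
        also have "\<dots> \<le> v\<^sup>2 * (a\<^sup>2 * K\<^sup>2) * (24 * exp (\<bar>g\<bar> + a))"
          using assms by (intro mult_left_mono pow4_le_exp) auto
        finally have b1: "(a * R y)\<^sup>2 \<le> v\<^sup>2 * (24 * a\<^sup>2 * K\<^sup>2) * exp (\<bar>g\<bar> + a)" by simp
        have b2: "exp (a * R y) \<le> exp (2 * a * (\<bar>g\<bar> + a))"
          using R2[of y] yx1 assms by (simp add: mult_left_mono) 
        have "exp (a * R y) - (1 + a * R y) \<le> (a * R y)\<^sup>2 * exp (a * R y)"
          using exp_le_quadratic[of "a * R y" "a * R y"] R0[of y] assms by simp
        also have "\<dots> \<le> (v\<^sup>2 * (24 * a\<^sup>2 * K\<^sup>2) * exp (\<bar>g\<bar> + a)) * exp (2 * a * (\<bar>g\<bar> + a))"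
          using b1 b2 by (intro mult_mono) auto
        also have "\<dots> = v\<^sup>2 * (24 * a\<^sup>2 * K\<^sup>2) * h g"
          by (simp add: h_def exp_add[symmetric] algebra_simps)
        finally show "exp (a * R (?z + sqrt v * g)) - (1 + a * R (?z + sqrt v * g))
            \<le> v\<^sup>2 * (24 * a\<^sup>2 * K\<^sup>2) * h g" by (simp add: y_def)
      qed
      also have "\<dots> = M * v\<^sup>2" by (simp add: M_def)
      finally show ?thesis by simp
    qed
    also have "\<dots> \<le> exp (a * gauss_avg v R ?z + M * v\<^sup>2)"
      using exp_ge_add_one_self[of "a * gauss_avg v R ?z + M * v\<^sup>2"] by linarith
    finally have "a * cole_hopf a v \<phi> x \<le> k\<^sup>2 * v / 2 + a * \<phi> x + (a * gauss_avg v R ?z + M * v\<^sup>2)"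
      by (simp add: exp_add[symmetric])
    also have "gauss_avg v R ?z = gauss_avg v \<phi> ?z - \<phi> x - p * (k * v)"
      unfolding R_def
      by (simp add: gauss_avg_diff gauss_avg_lin exp_growth_diff exp_growth_mult
            exp_growth_const exp_growth_ident lip_exp_growth[OF lip])
    finally have "a * cole_hopf a v \<phi> x
        \<le> a * (gauss_avg v \<phi> (x + a * v * p) - a * v * p\<^sup>2 / 2 + M / a * v\<^sup>2)"
      using assms by (simp add: k_def algebra_simps power2_eq_square)
    then show "\<exists>p. cole_hopf a v \<phi> x \<le> gauss_avg v \<phi> (x + a * v * p) - a * v * p\<^sup>2 / 2 + M / a * v\<^sup>2"
      using assms by auto
  qed
qed

subsection \<open>Joint convexity in the order parameter and the space variable\<close>

text \<open>Infimal convolution with the parabola (x - z)^2 / (2 \<eta>): in x, each competitor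
  gains at most y^2 / \<eta> over \<open>f z\<close> in the second difference, and an infimum
  inherits this upper bound. The error \<eta> / 2 is the maximum of r - r^2 / (2 \<eta>) over the
  distance r = |x - z|.\<close>

lemma moreau_envelope:
  fixes f :: "real \<Rightarrow> real"
  assumes lip: "1-lipschitz_on UNIV f" and cvx: "convex_on UNIV f" and \<eta>: "0 < \<eta>"
  obtains g where "1-lipschitz_on UNIV g" "convex_on UNIV g" "semiconcave (1 / \<eta>) g"
    "\<And>x. g x \<le> f x" "\<And>x. f x \<le> g x + \<eta> / 2"
proof -
  define q where "q x z = f z + (x - z)\<^sup>2 / (2 * \<eta>)" for x z
  define g where "g x = (INF z. q x z)" for x
  have q_ge: "f x - \<eta> / 2 \<le> q x z" for x z
  proof -
    have "f x - \<bar>x - z\<bar> \<le> f z" using lip_abs[OF lip, of x z] by auto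
    moreover have "0 \<le> (\<bar>x - z\<bar> - \<eta>)\<^sup>2 / (2 * \<eta>)" using \<eta> by simp
    moreover have "(\<bar>x - z\<bar> - \<eta>)\<^sup>2 / (2 * \<eta>) = (x - z)\<^sup>2 / (2 * \<eta>) - \<bar>x - z\<bar> + \<eta> / 2"
      using \<eta> by (simp add: power2_diff field_simps power2_eq_square)
    ultimately show ?thesis by (simp add: q_def)
  qed
  have bdd: "bdd_below (range (q x))" for x
    using q_ge by (intro bdd_belowI2)
  have g_le: "g x \<le> q x z" for x z
    unfolding g_def by (rule cINF_lower[OF bdd]) simp
  have near: "\<exists>z. q x z < g x + e" if "0 < e" for x e
  proof -
    have "g x < g x + e" using that by simp
    then show ?thesis unfolding g_def[of x]
      using cINF_less_iff[OF _ bdd[of x], of "Inf (range (q x)) + e"] by auto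
  qed
  show ?thesis
  proof (rule that[of g])
    show "g x \<le> f x" for x using g_le[of x x] by (simp add: q_def)
    show "f x \<le> g x + \<eta> / 2" for x
    proof -
      have "f x - \<eta> / 2 \<le> g x" unfolding g_def by (rule cINF_greatest) (use q_ge in auto)
      then show ?thesis by simp
    qed
    show "1-lipschitz_on UNIV g"
    proof (rule lipI)
      fix x y
      have "g x - g y \<le> \<bar>x - y\<bar> + e" if e: "0 < e" for e
      proof -
        obtain z where z: "q y z < g y + e" using near[OF e] by blast
        have "g x \<le> q x (z + (x - y))" by (rule g_le)
        also have "\<dots> = f (z + (x - y)) + (y - z)\<^sup>2 / (2 * \<eta>)" by (simp add: q_def algebra_simps)
        also have "\<dots> \<le> q y z + \<bar>x - y\<bar>"
          using lip_abs[OF lip, of "z + (x - y)" z] by (simp add: q_def)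
        finally show ?thesis using z by simp
      qed
      then show "g x - g y \<le> 1 * \<bar>x - y\<bar>" by (simp add: field_le_epsilon)
    qed simp
    show "convex_on UNIV g"
    proof (rule convex_onI)
      fix t x y :: real
      assume t: "0 < t" "t < 1"
      show "g ((1 - t) *\<^sub>R x + t *\<^sub>R y) \<le> (1 - t) * g x + t * g y"
      proof (rule field_le_epsilon)
        fix e :: real assume e: "0 < e"
        obtain z w where z: "q x z < g x + e" and w: "q y w < g y + e" using near[OF e] by blast
        have sq: "((1 - t) * (x - z) + t * (y - w))\<^sup>2 \<le> (1 - t) * (x - z)\<^sup>2 + t * (y - w)\<^sup>2"
        proof -
          have "(1 - t) * (x - z)\<^sup>2 + t * (y - w)\<^sup>2 - ((1 - t) * (x - z) + t * (y - w))\<^sup>2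
              = t * (1 - t) * ((x - z) - (y - w))\<^sup>2"
            by (simp add: power2_eq_square algebra_simps)
          also have "\<dots> \<ge> 0" using t by simp
          finally show ?thesis by simp
        qed
        have "g ((1 - t) *\<^sub>R x + t *\<^sub>R y) \<le> q ((1 - t) * x + t * y) ((1 - t) * z + t * w)"
          using g_le by simp
        also have "\<dots> = f ((1 - t) * z + t * w) + ((1 - t) * (x - z) + t * (y - w))\<^sup>2 / (2 * \<eta>)"
          by (simp add: q_def algebra_simps)
        also have "\<dots> \<le> ((1 - t) * f z + t * f w) + ((1 - t) * (x - z)\<^sup>2 + t * (y - w)\<^sup>2) / (2 * \<eta>)"
          using convex_onD[OF cvx, of t z w] t sq \<eta> by (intro add_mono divide_right_mono) auto
        also have "\<dots> = (1 - t) * q x z + t * q y w"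
          by (simp add: q_def add_divide_distrib diff_divide_distrib algebra_simps)
        also have "\<dots> \<le> (1 - t) * (g x + e) + t * (g y + e)"
          using z w t by (intro add_mono mult_left_mono) auto
        finally show "g ((1 - t) *\<^sub>R x + t *\<^sub>R y) \<le> (1 - t) * g x + t * g y + e"
          by (simp add: algebra_simps)
      qed
    qed simp
    show "semiconcave (1 / \<eta>) g"
      unfolding semiconcave_def
    proof (intro conjI allI)
      show "0 \<le> 1 / \<eta>" using \<eta> by simp
      fix x y
      have "g (x + y) + g (x - y) \<le> (2 * g x + 1 / \<eta> * y\<^sup>2) + e" if e: "0 < e" for e
      proof -
        have e2: "0 < e / 2" using e by simp
        obtain z where z: "q x z < g x + e / 2" using near[OF e2] by blast
        have "g (x + y) + g (x - y) \<le> q (x + y) z + q (x - y) z"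
          by (intro add_mono g_le)
        also have "\<dots> = 2 * q x z + 1 / \<eta> * y\<^sup>2"
        proof -
          have "(x + y - z)\<^sup>2 + (x - y - z)\<^sup>2 = 2 * (x - z)\<^sup>2 + 2 * y\<^sup>2"
            by (simp add: power2_eq_square algebra_simps)
          then have "(x + y - z)\<^sup>2 / (2 * \<eta>) + (x - y - z)\<^sup>2 / (2 * \<eta>)
              = 2 * ((x - z)\<^sup>2 / (2 * \<eta>)) + 1 / \<eta> * y\<^sup>2"
            using \<eta> by (simp add: add_divide_distrib[symmetric] field_simps)
          then show ?thesis by (simp add: q_def)
        qed
        finally show ?thesis using z by simp
      qed
      then show "g (x + y) + g (x - y) - 2 * g x \<le> 1 / \<eta> * y\<^sup>2"
        using field_le_epsilon[of "g (x + y) + g (x - y)"] by (smt (verit))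
    qed
  qed
qed

text \<open>The variance is split into \<open>n\<close> equal pieces; over one piece the Cole-Hopf operator agrees
  up to \<open>O(1/n\<^sup>2)\<close> with the shift bound at a subgradient, and the shift bound, unlike the operator
  itself, is visibly compatible with convex combinations of \<open>(a, f, x)\<close>.\<close>

lemma cole_hopf_joint_convex_smooth:
  assumes g: "1-lipschitz_on UNIV g" "convex_on UNIV g" "semiconcave K g"
    and f1: "1-lipschitz_on UNIV f1" and f2: "1-lipschitz_on UNIV f2"
    and a: "0 \<le> a1" "0 \<le> a2" and \<theta>: "0 \<le> \<theta>" "\<theta> \<le> 1" and v: "0 \<le> v"
    and pos: "0 < \<theta> * a1 + (1 - \<theta>) * a2"
    and le: "\<And>x y. g (\<theta> * x + (1 - \<theta>) * y) \<le> \<theta> * f1 x + (1 - \<theta>) * f2 y"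
  shows "cole_hopf (\<theta> * a1 + (1 - \<theta>) * a2) v g (\<theta> * x + (1 - \<theta>) * y)
    \<le> \<theta> * cole_hopf a1 v f1 x + (1 - \<theta>) * cole_hopf a2 v f2 y"
proof -
  define a where "a = \<theta> * a1 + (1 - \<theta>) * a2"
  have a0: "0 < a" using pos by (simp add: a_def)
  \<comment> \<open>A semiconcavity constant valid for \<open>cole_hopf a s g\<close> at every s, so
    that \<open>C\<close> below is uniform over all time steps.\<close>
  define K' where "K' = K + 2 + 2 * a * exp a"
  have K': "0 \<le> K'" using g(3) a0 by (auto simp: K'_def semiconcave_def)
  obtain C where C: "0 \<le> C"
    "\<And>\<phi> v x. 1-lipschitz_on UNIV \<phi> \<Longrightarrow> convex_on UNIV \<phi> \<Longrightarrow> semiconcave K' \<phi> \<Longrightarrow> 0 \<le> v \<Longrightarrow> v \<le> 1 \<Longrightarrow>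
      \<exists>p. cole_hopf a v \<phi> x \<le> gauss_avg v \<phi> (x + a * v * p) - a * v * p\<^sup>2 / 2 + C * v\<^sup>2"
    using cole_hopf_le_shift[OF a0 K'] by blast
  have step: "cole_hopf a (real j * h) g (\<theta> * x + (1 - \<theta>) * y)
      \<le> \<theta> * cole_hopf a1 (real j * h) f1 x + (1 - \<theta>) * cole_hopf a2 (real j * h) f2 y + real j * (C * h\<^sup>2)"
    if h: "0 \<le> h" "h \<le> 1" for j h x y
  proof (induction j arbitrary: x y)
    case 0
    show ?case using le by simp
  next
    case (Suc j)
    define G where "G = cole_hopf a (real j * h) g"
    define F1 where "F1 = cole_hopf a1 (real j * h) f1"
    define F2 where "F2 = cole_hopf a2 (real j * h) f2"
    have jh: "0 \<le> real j * h" using h by simp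
    have G: "1-lipschitz_on UNIV G" "convex_on UNIV G" "semiconcave K' G"
      unfolding G_def K'_def using g a0
      by (auto intro!: cole_hopf_lip cole_hopf_convex cole_hopf_semiconcave)
    have F: "1-lipschitz_on UNIV F1" "1-lipschitz_on UNIV F2"
      unfolding F1_def F2_def using f1 f2 a by (auto intro!: cole_hopf_lip)
    have sg: "cole_hopf a (real (Suc j) * h) g = cole_hopf a h G"
      "cole_hopf a1 (real (Suc j) * h) f1 = cole_hopf a1 h F1"
      "cole_hopf a2 (real (Suc j) * h) f2 = cole_hopf a2 h F2"
      using cole_hopf_semigroup[OF g(1) _ h(1) jh, of a] cole_hopf_semigroup[OF f1 a(1) h(1) jh]
        cole_hopf_semigroup[OF f2 a(2) h(1) jh] a0
      by (auto simp: G_def F1_def F2_def distrib_right fun_eq_iff)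
    let ?z = "\<theta> * x + (1 - \<theta>) * y"
    let ?e = "real j * (C * h\<^sup>2)"
    \<comment> \<open>The same p is used in both components: as \<open>a\<close> is the convex
      combination of \<open>a1\<close> and \<open>a2\<close>, the shift \<open>a * h * p\<close> and
      its cost split accordingly.\<close>
    obtain p where p: "cole_hopf a h G ?z \<le> gauss_avg h G (?z + a * h * p) - a * h * p\<^sup>2 / 2 + C * h\<^sup>2"
      using C(2)[OF G h] by blast
    let ?x = "x + a1 * h * p" and ?y = "y + a2 * h * p"
    note tr = lip_translate[OF G(1), of "?z + a * h * p"] lip_translate[OF F(1), of ?x] lip_translate[OF F(2), of ?y]
    have "gauss_avg h G (?z + a * h * p) = gauss_avg h (\<lambda>u. G (u + (?z + a * h * p))) 0"
      by (simp add: gauss_avg_translate)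
    also have "\<dots> \<le> gauss_avg h (\<lambda>u. (\<theta> * F1 (u + ?x) + (1 - \<theta>) * F2 (u + ?y)) + ?e) 0"
    proof (rule gauss_avg_mono)
      fix u
      have "u + (?z + a * h * p) = \<theta> * (u + ?x) + (1 - \<theta>) * (u + ?y)"
        by (simp add: a_def algebra_simps)
      then show "G (u + (?z + a * h * p)) \<le> (\<theta> * F1 (u + ?x) + (1 - \<theta>) * F2 (u + ?y)) + ?e"
        using Suc.IH[of "u + ?x" "u + ?y"] by (simp add: G_def F1_def F2_def)
    qed (intro exp_growth_add exp_growth_mult exp_growth_const lip_exp_growth[OF tr(1)]
        lip_exp_growth[OF tr(2)] lip_exp_growth[OF tr(3)])+
    also have "\<dots> = \<theta> * gauss_avg h F1 ?x + (1 - \<theta>) * gauss_avg h F2 ?y + ?e"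
      using gauss_avg_translate[of h F1 ?x 0] gauss_avg_translate[of h F2 ?y 0]
      by (simp add: gauss_avg_add gauss_avg_cmult exp_growth_add exp_growth_mult exp_growth_const
          lip_exp_growth[OF tr(2)] lip_exp_growth[OF tr(3)])
    finally have "cole_hopf a h G ?z \<le> \<theta> * gauss_avg h F1 ?x + (1 - \<theta>) * gauss_avg h F2 ?y + ?e
        - a * h * p\<^sup>2 / 2 + C * h\<^sup>2"
      using p by linarith
    also have "\<dots> = \<theta> * (gauss_avg h F1 ?x - a1 * h * p\<^sup>2 / 2)
        + (1 - \<theta>) * (gauss_avg h F2 ?y - a2 * h * p\<^sup>2 / 2) + real (Suc j) * (C * h\<^sup>2)"
      by (simp add: a_def algebra_simps add_divide_distrib diff_divide_distrib)
    also have "\<dots> \<le> \<theta> * cole_hopf a1 h F1 x + (1 - \<theta>) * cole_hopf a2 h F2 y + real (Suc j) * (C * h\<^sup>2)"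
      using \<theta> by (intro add_right_mono add_mono mult_left_mono
          cole_hopf_ge_shift[OF F(1) a(1) h(1)] cole_hopf_ge_shift[OF F(2) a(2) h(1)]) auto
    finally show ?case unfolding sg .
  qed
  \<comment> \<open>With n + 1 pieces of length v / (n + 1) the accumulated error is C v^2 / (n +
    1), which vanishes in the limit.\<close>
  have "cole_hopf a v g (\<theta> * x + (1 - \<theta>) * y)
      \<le> (\<theta> * cole_hopf a1 v f1 x + (1 - \<theta>) * cole_hopf a2 v f2 y) + C * v\<^sup>2 / real (Suc n)"
    if n: "v \<le> real (Suc n)" for n
  proof -
    let ?h = "v / real (Suc n)"
    have h: "0 \<le> ?h" "?h \<le> 1" using v n by (auto simp: divide_le_eq)
    have r: "real (Suc n) * ?h = v" "real (Suc n) * (C * ?h\<^sup>2) = C * v\<^sup>2 / real (Suc n)"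
      by (simp_all add: power_divide power2_eq_square del: of_nat_Suc)
    show ?thesis using step[OF h, of "Suc n" x y] unfolding r by simp
  qed
  then have ev: "eventually (\<lambda>n. cole_hopf a v g (\<theta> * x + (1 - \<theta>) * y)
      \<le> (\<theta> * cole_hopf a1 v f1 x + (1 - \<theta>) * cole_hopf a2 v f2 y) + C * v\<^sup>2 / real (Suc n)) sequentially"
    by (intro eventually_sequentiallyI[of "nat \<lceil>v\<rceil>"]) (meson le_SucI nat_ceiling_le_eq)
  have "(\<lambda>n. (\<theta> * cole_hopf a1 v f1 x + (1 - \<theta>) * cole_hopf a2 v f2 y) + C * v\<^sup>2 / real (Suc n))
      \<longlonglongrightarrow> (\<theta> * cole_hopf a1 v f1 x + (1 - \<theta>) * cole_hopf a2 v f2 y) + 0"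
    by (intro tendsto_add tendsto_const lim_const_over_n[THEN LIMSEQ_Suc])
  from tendsto_lowerbound[OF this ev] show ?thesis by (simp add: a_def)
qed

text \<open>Semiconcavity is removed by approximation: a Moreau envelope lies below
  \<open>f\<close>, so it inherits \<open>le\<close>, and it costs at most e / 2 because the
  operator is monotone and commutes with constants. If the averaged parameter is 0, each parameter
  of positive weight is 0 and the fixed-parameter inequality applies.\<close>

lemma cole_hopf_joint_convex:
  assumes f: "1-lipschitz_on UNIV f" "convex_on UNIV f"
    and f1: "1-lipschitz_on UNIV f1" and f2: "1-lipschitz_on UNIV f2"
    and a: "0 \<le> a1" "0 \<le> a2" and \<theta>: "0 \<le> \<theta>" "\<theta> \<le> 1" and v: "0 \<le> v"
    and le: "\<And>x y. f (\<theta> * x + (1 - \<theta>) * y) \<le> \<theta> * f1 x + (1 - \<theta>) * f2 y"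
  shows "cole_hopf (\<theta> * a1 + (1 - \<theta>) * a2) v f (\<theta> * x + (1 - \<theta>) * y)
    \<le> \<theta> * cole_hopf a1 v f1 x + (1 - \<theta>) * cole_hopf a2 v f2 y"
proof (cases "\<theta> * a1 + (1 - \<theta>) * a2 = 0")
  case True
  then have z: "\<theta> * a1 = 0" "(1 - \<theta>) * a2 = 0"
    using a \<theta> by (smt (verit) mult_nonneg_nonneg)+
  have eq: "\<theta> * cole_hopf a1 v f1 x = \<theta> * cole_hopf 0 v f1 x" "(1 - \<theta>) * cole_hopf a2 v f2 y = (1 - \<theta>) * cole_hopf 0 v f2 y"
    using z by auto
  show ?thesis
    unfolding True eq by (rule cole_hopf_convex_triple[OF f(1) f1 f2 order_refl \<theta> le])
next
  case False
  then have pos: "0 < \<theta> * a1 + (1 - \<theta>) * a2"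
    using a \<theta> by (smt (verit) mult_nonneg_nonneg)
  show ?thesis
  proof (rule field_le_epsilon)
    fix e :: real assume e: "0 < e"
    obtain g where g: "1-lipschitz_on UNIV g" "convex_on UNIV g" "semiconcave (1 / e) g"
      "\<And>x. g x \<le> f x" "\<And>x. f x \<le> g x + e / 2"
      using moreau_envelope[OF f e] by blast
    have "cole_hopf (\<theta> * a1 + (1 - \<theta>) * a2) v f (\<theta> * x + (1 - \<theta>) * y)
        \<le> cole_hopf (\<theta> * a1 + (1 - \<theta>) * a2) v g (\<theta> * x + (1 - \<theta>) * y) + e / 2"
      using pos by (intro cole_hopf_le_add[OF f(1) g(1)] g(5)) auto
    also have "cole_hopf (\<theta> * a1 + (1 - \<theta>) * a2) v g (\<theta> * x + (1 - \<theta>) * y)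
        \<le> \<theta> * cole_hopf a1 v f1 x + (1 - \<theta>) * cole_hopf a2 v f2 y"
      by (rule cole_hopf_joint_convex_smooth[OF g(1-3) f1 f2 a \<theta> v pos])
        (meson g(4) le order_trans)
    finally show "cole_hopf (\<theta> * a1 + (1 - \<theta>) * a2) v f (\<theta> * x + (1 - \<theta>) * y)
        \<le> \<theta> * cole_hopf a1 v f1 x + (1 - \<theta>) * cole_hopf a2 v f2 y + e"
      using e by simp
  qed
qed

section \<open>Dependence of one Cole-Hopf step on its parameter\<close>

lemma gauss_avg_exp_lin: "0 \<le> v \<Longrightarrow> gauss_avg v (\<lambda>y. exp (k * (y - x))) x = exp (k\<^sup>2 * v / 2)"
  using gauss_avg_shift[of "\<lambda>_. 1" v k x] by simp

text \<open>For large \<open>c\<close> the bound is asymptotically linear with slope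
  \<open>v / 2\<close>, the slope at infinity that controls the convex dependence on the parameter.
  The term with ln 2 comes from exp |u| \<le> exp u + exp (-u).\<close>

lemma cole_hopf_growth:
  assumes f: "1-lipschitz_on UNIV f" and c: "0 < c" and v: "0 \<le> v"
  shows "cole_hopf c v f x \<le> f x + c * v / 2 + ln 2 / c"
proof -
  have "exp (c * (cole_hopf c v f x - f x)) = gauss_avg v (\<lambda>y. exp (c * (f y - f x))) x"
    using c by (intro cole_hopf_tilt[OF f, symmetric]) simp
  also have "\<dots> \<le> gauss_avg v (\<lambda>y. exp (c * (y - x)) + exp (- c * (y - x))) x"
  proof (rule gauss_avg_mono)
    show "exp_growth (\<lambda>y. exp (c * (f y - f x)))"
      using lip_exp_exp_growth[OF lip_add_const[OF f, of "- f x"], of c] by simp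
    fix y
    have "c * (f y - f x) \<le> c * \<bar>y - x\<bar>"
      using lip_abs[OF f, of y x] c by (intro mult_left_mono) auto
    then have "exp (c * (f y - f x)) \<le> exp (c * \<bar>y - x\<bar>)" by simp
    also have "\<dots> \<le> exp (c * (y - x)) + exp (- c * (y - x))"
    proof (cases "x \<le> y")
      case False
      then have "c * \<bar>y - x\<bar> = - c * (y - x)" by (simp add: algebra_simps)
      then show ?thesis by (simp only:) (simp del: mult_minus_left)
    qed simp
    finally show "exp (c * (f y - f x)) \<le> exp (c * (y - x)) + exp (- c * (y - x))" .
  qed (intro exp_growth_add exp_growth_exp_lin)
  also have "\<dots> = 2 * exp (c\<^sup>2 * v / 2)"
    using v gauss_avg_exp_lin[of v c x] gauss_avg_exp_lin[of v "- c" x]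
    by (subst gauss_avg_add[OF exp_growth_exp_lin exp_growth_exp_lin]) simp
  also have "\<dots> = exp (ln 2 + c\<^sup>2 * v / 2)" by (simp add: exp_add)
  finally have "c * (cole_hopf c v f x - f x) \<le> ln 2 + c\<^sup>2 * v / 2" by simp
  also have "\<dots> = c * (c * v / 2 + ln 2 / c)" using c by (simp add: field_simps power2_eq_square)
  finally show ?thesis using c by simp
qed

lemma cole_hopf_param_convex:
  assumes f: "1-lipschitz_on UNIV f" "convex_on UNIV f" and v: "0 \<le> v"
    and abc: "0 \<le> a" "a \<le> b" "b \<le> c" "a < c"
  shows "cole_hopf b v f x - cole_hopf a v f x
    \<le> (b - a) / (c - a) * (cole_hopf c v f x - cole_hopf a v f x)"
proof -
  define u where "u = (b - a) / (c - a)"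
  have u: "0 \<le> u" "u \<le> 1" using abc by (auto simp: u_def field_simps)
  have b: "(1 - u) * a + (1 - (1 - u)) * c = b"
  proof -
    have "u * (c - a) = b - a" using abc by (simp add: u_def)
    then show ?thesis by (simp add: algebra_simps)
  qed
  have le: "f ((1 - u) * x + (1 - (1 - u)) * y) \<le> (1 - u) * f x + (1 - (1 - u)) * f y" for x y
    using convex_onD[OF f(2), of u x y] u by simp
  have x: "(1 - u) * x + (1 - (1 - u)) * x = x" by (simp add: algebra_simps)
  have "cole_hopf b v f x \<le> (1 - u) * cole_hopf a v f x + (1 - (1 - u)) * cole_hopf c v f x"
    using cole_hopf_joint_convex[OF f f(1) f(1) _ _ _ _ v le, of a c x x] u abc unfolding b x by simp
  then have "cole_hopf b v f x - cole_hopf a v f x \<le> u * (cole_hopf c v f x - cole_hopf a v f x)"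
    by (simp add: algebra_simps)
  then show ?thesis unfolding u_def .
qed

text \<open>The shift bound with \<open>p = 0\<close> shows that parameter 0 is minimal, and a
  convex function on the half-line that is minimal at 0 is non-decreasing.\<close>

lemma cole_hopf_param_mono:
  assumes f: "1-lipschitz_on UNIV f" "convex_on UNIV f" and v: "0 \<le> v" and ab: "0 \<le> a" "a \<le> b"
  shows "cole_hopf a v f x \<le> cole_hopf b v f x"
proof (cases "b = 0")
  case True
  then show ?thesis using ab by simp
next
  case False
  have "cole_hopf 0 v f x \<le> cole_hopf b v f x"
    using cole_hopf_ge_shift[OF f(1), of b v x 0] ab v by (simp add: cole_hopf_gauss_avg)
  moreover have "cole_hopf a v f x - cole_hopf 0 v f x \<le> a / b * (cole_hopf b v f x - cole_hopf 0 v f x)"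
    using cole_hopf_param_convex[OF f v, of 0 a b x] ab False by simp
  moreover have "a / b * (cole_hopf b v f x - cole_hopf 0 v f x) \<le> 1 * (cole_hopf b v f x - cole_hopf 0 v f x)"
    using calculation ab False by (intro mult_right_mono) (auto simp: divide_le_eq)
  ultimately show ?thesis by simp
qed

text \<open>A convex function of the parameter that grows at most linearly with slope \<open>v/2\<close> at infinity
  has slope at most \<open>v/2\<close> everywhere.\<close>

lemma cole_hopf_param_lip:
  assumes f: "1-lipschitz_on UNIV f" "convex_on UNIV f" and v: "0 \<le> v" and ab: "0 \<le> a" "0 \<le> b"
  shows "\<bar>cole_hopf b v f x - cole_hopf a v f x\<bar> \<le> \<bar>b - a\<bar> * v / 2"
proof -
  have main: "cole_hopf b v f x - cole_hopf a v f x \<le> (b - a) * v / 2" if ab: "0 \<le> a" "a < b" for a b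
  proof (rule tendsto_lowerbound)
    let ?r = "\<lambda>c. (b - a) / (c - a) * (f x + c * v / 2 + ln 2 / c - cole_hopf a v f x)"
    show "(?r \<longlongrightarrow> (b - a) * v / 2) at_top"
    proof -
      have "((\<lambda>c. (b - a) / (c - a)) \<longlongrightarrow> 0) at_top" "((\<lambda>c. (b - a) / (c - a) * c) \<longlongrightarrow> (b - a)) at_top"
        "((\<lambda>c. ln 2 / c) \<longlongrightarrow> (0::real)) at_top"
        by real_asymp+
      then have "((\<lambda>c. (b - a) / (c - a) * (f x - cole_hopf a v f x + ln 2 / c) + (b - a) / (c - a) * c * (v / 2))
          \<longlongrightarrow> 0 * (f x - cole_hopf a v f x + 0) + (b - a) * (v / 2)) at_top"
        by (intro tendsto_intros)
      moreover have "u * (f x + c * v / 2 + l - cole_hopf a v f x)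
          = u * (f x - cole_hopf a v f x + l) + u * c * (v / 2)" for u l c
        by (simp add: algebra_simps)
      ultimately show ?thesis by (simp only:) simp
    qed
    show "\<forall>\<^sub>F c in at_top. cole_hopf b v f x - cole_hopf a v f x \<le> ?r c"
      using eventually_gt_at_top[of b]
    proof eventually_elim
      case (elim c)
      have "cole_hopf b v f x - cole_hopf a v f x
          \<le> (b - a) / (c - a) * (cole_hopf c v f x - cole_hopf a v f x)"
        using elim ab by (intro cole_hopf_param_convex f v) auto
      also have "\<dots> \<le> ?r c"
        using cole_hopf_growth[OF f(1), of c v x] v elim ab by (intro mult_left_mono) auto
      finally show ?case .
    qed
  qed simp
  show ?thesis
    using main[of a b] main[of b a] cole_hopf_param_mono[OF f v, of a b x]
      cole_hopf_param_mono[OF f v, of b a x] ab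
    by (cases a b rule: linorder_cases) auto
qed

text \<open>Under the tilted law with density \<open>exp (a * (f y - cole_hopf a v f x))\<close> the
  average of \<open>exp (a * (h y - f y))\<close> is the exponential of \<open>a\<close> times the
  difference of the two values. Raising to the power r = A / a \<ge> 1 and applying Jensen replaces
  \<open>a\<close> by \<open>A\<close>, so one exponent can be kept through steps with different
  parameters.\<close>

lemma exp_cole_hopf_diff_le:
  assumes f: "L-lipschitz_on UNIV f" and h: "M-lipschitz_on UNIV h" and a: "0 \<le> a" "a \<le> A" and A: "0 < A"
  shows "exp (A * (cole_hopf a v h x - cole_hopf a v f x))
    \<le> gauss_avg v (\<lambda>y. exp (a * (f y - cole_hopf a v f x)) * exp (A * (h y - f y))) x"
proof (cases "a = 0")
  case True
  have "exp_growth (\<lambda>y. exp (A * h y) * exp (- A * f y))"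
    by (intro exp_growth_mult lip_exp_exp_growth[OF f] lip_exp_exp_growth[OF h])
  then have "exp_growth (\<lambda>y. exp (A * (h y - f y)))"
    by (simp add: exp_add[symmetric] algebra_simps)
  then have "exp (gauss_avg v (\<lambda>y. A * (h y - f y)) x) \<le> gauss_avg v (\<lambda>y. exp (A * (h y - f y))) x"
    by (intro exp_gauss_avg_le exp_growth_mult exp_growth_diff exp_growth_const lip_exp_growth[OF f] lip_exp_growth[OF h])
  moreover have "gauss_avg v (\<lambda>y. A * (h y - f y)) x = A * (gauss_avg v h x - gauss_avg v f x)"
    by (simp add: gauss_avg_cmult gauss_avg_diff lip_exp_growth[OF f] lip_exp_growth[OF h])
  ultimately show ?thesis using True by (simp add: cole_hopf_gauss_avg)
next
  case False
  then have a0: "0 < a" using a by simp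
  define u where "u = cole_hopf a v h x - cole_hopf a v f x"
  define r where "r = A / a"
  have r: "1 \<le> r" using a a0 by (simp add: r_def)
  let ?q = "\<lambda>y. exp (a * (f y - cole_hopf a v f x))"
  let ?w = "\<lambda>y. exp (a * (h y - cole_hopf a v h x))"
  have egq: "exp_growth ?q"
    using lip_exp_exp_growth[OF lip_add_const[OF f, of "- cole_hopf a v f x"], of a] by simp
  have egw: "exp_growth ?w"
    using lip_exp_exp_growth[OF lip_add_const[OF h, of "- cole_hopf a v h x"], of a] by simp
  have egd: "exp_growth (\<lambda>y. ?q y * exp (A * (h y - f y)))"
  proof -
    have "exp_growth (\<lambda>y. ?q y * (exp (A * h y) * exp (- A * f y)))"
      by (intro exp_growth_mult egq lip_exp_exp_growth[OF f] lip_exp_exp_growth[OF h])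
    then show ?thesis by (simp add: exp_add[symmetric] algebra_simps)
  qed
  have q1: "gauss_avg v ?q x = 1" "gauss_avg v ?w x = 1"
    using cole_hopf_tilt[OF f False] cole_hopf_tilt[OF h False] by simp_all
  \<comment> \<open>Jensen for the power r in tangent form: (1 - r) + r exp t \<le> exp (r t); by
    \<open>q1\<close> the average of the left side is explicit.\<close>
  have pt: "exp (A * u) * ((1 - r) * ?q y + r * ?w y) \<le> ?q y * exp (A * (h y - f y))" for y
  proof -
    define t where "t = a * (h y - f y - u)"
    have "exp ((1 - 1 / r) * 0 + 1 / r * (r * t)) \<le> (1 - 1 / r) * exp 0 + 1 / r * exp (r * t)"
      using convex_onD[OF exp_convex, of "1 / r" 0 "r * t"] r by simp
    then have "exp t \<le> (1 - 1 / r) + 1 / r * exp (r * t)" using r by simp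
    then have "r * exp t \<le> r * ((1 - 1 / r) + 1 / r * exp (r * t))" using r by (intro mult_left_mono) auto
    also have "\<dots> = (r - 1) + exp (r * t)" using r by (simp add: field_simps)
    finally have "(1 - r) + r * exp t \<le> exp (r * t)" by simp
    then have "(exp (A * u) * ?q y) * ((1 - r) + r * exp t) \<le> (exp (A * u) * ?q y) * exp (r * t)"
      by (rule mult_left_mono) simp
    moreover have w: "?w y = ?q y * exp t"
      by (simp add: t_def u_def exp_add[symmetric] algebra_simps)
    moreover have "exp (A * u) * ((1 - r) * ?q y + r * (?q y * exp t)) = (exp (A * u) * ?q y) * ((1 - r) + r * exp t)"
      by (simp add: algebra_simps)
    moreover have "r * t = A * (h y - f y) - A * u"
      using a0 by (simp add: r_def t_def algebra_simps)
    then have "exp (A * (h y - f y)) = exp (A * u) * exp (r * t)" by (simp add: exp_add[symmetric])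
    ultimately show ?thesis by (simp only: mult_ac)
  qed
  have "gauss_avg v (\<lambda>y. exp (A * u) * ((1 - r) * ?q y + r * ?w y)) x
      \<le> gauss_avg v (\<lambda>y. ?q y * exp (A * (h y - f y))) x"
    by (intro gauss_avg_mono exp_growth_mult exp_growth_add exp_growth_const egq egw egd pt)
  moreover have "gauss_avg v (\<lambda>y. exp (A * u) * ((1 - r) * ?q y + r * ?w y)) x = exp (A * u)"
    by (simp add: gauss_avg_cmult gauss_avg_add exp_growth_mult exp_growth_const egq egw q1)
  ultimately show ?thesis by (simp add: u_def)
qed

text \<open>A Gaussian shift by \<open>k * v\<close> produces the factor with
  \<open>k\<^sup>2 / 2\<close>; shifting the density as well costs at most
  \<open>a * \<bar>k\<bar> * v\<close> in the exponent because \<open>f\<close> is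
  1-Lipschitz.\<close>

lemma tilted_exp_le:
  assumes f: "1-lipschitz_on UNIV f" and a: "0 \<le> a" and v: "0 \<le> v"
  shows "gauss_avg v (\<lambda>y. exp (a * (f y - cole_hopf a v f x)) * exp (k * y)) x
    \<le> exp ((k\<^sup>2 / 2 + a * \<bar>k\<bar>) * v) * exp (k * x)"
proof -
  let ?q = "\<lambda>y. exp (a * (f y - cole_hopf a v f x))"
  have [measurable]: "f \<in> borel_measurable borel" by (rule lip_measurable[OF f])
  have egq: "exp_growth (\<lambda>y. ?q (y + c))" for c
    using lip_exp_exp_growth[OF lip_add_const[OF lip_translate[OF f, of c], of "- cole_hopf a v f x"], of a] by simp
  have q1: "gauss_avg v ?q x = 1"
    using cole_hopf_tilt[OF f, of a v "cole_hopf a v f x" x] by (cases "a = 0") auto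
  have "gauss_avg v (\<lambda>y. ?q y * exp (k * y)) x = gauss_avg v (\<lambda>y. exp (k * x) * (?q y * exp (k * (y - x)))) x"
    by (simp add: exp_add[symmetric] algebra_simps)
  also have "\<dots> = exp (k * x) * (exp (k\<^sup>2 * v / 2) * gauss_avg v (\<lambda>y. ?q (y + k * v)) x)"
    unfolding gauss_avg_cmult gauss_avg_translate[of v ?q]
    using v by (subst gauss_avg_shift[symmetric]) auto
  also have "\<dots> \<le> exp (k * x) * (exp (k\<^sup>2 * v / 2) * gauss_avg v (\<lambda>y. exp (a * \<bar>k\<bar> * v) * ?q (y + 0)) x)"
  proof (intro mult_left_mono gauss_avg_mono egq exp_growth_mult exp_growth_const)
    fix y
    have "f (y + k * v) \<le> f y + \<bar>k\<bar> * v"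
      using lip_abs[OF f, of "y + k * v" y] v by (simp add: abs_mult)
    then have "a * (f (y + k * v) - cole_hopf a v f x) \<le> a * (f y + \<bar>k\<bar> * v - cole_hopf a v f x)"
      using a by (intro mult_left_mono) auto
    also have "\<dots> = a * \<bar>k\<bar> * v + a * (f (y + 0) - cole_hopf a v f x)" by (simp add: algebra_simps)
    finally show "?q (y + k * v) \<le> exp (a * \<bar>k\<bar> * v) * ?q (y + 0)"
      unfolding exp_add[symmetric] by simp
  qed auto
  also have "\<dots> = exp ((k\<^sup>2 / 2 + a * \<bar>k\<bar>) * v) * exp (k * x)"
    unfolding gauss_avg_cmult add_0_right q1 mult_1_right
    by (simp add: exp_add[symmetric] algebra_simps)
  finally show ?thesis .
qed

text \<open>The second difference of an iterated Cole-Hopf map along a pair of perturbations is read off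
  from the sum of two exponentials, a quantity that each step increases by a controlled factor only.\<close>

lemma cole_hopf_second_difference_step:
  assumes f: "1-lipschitz_on UNIV f" and fp: "L-lipschitz_on UNIV fp" and fm: "M-lipschitz_on UNIV fm"
    and a: "0 \<le> a" "a \<le> A" and A: "0 < A" and v: "0 \<le> v" and K: "0 \<le> K"
    and le: "\<And>y. exp (A * (fp y - f y)) + exp (A * (fm y - f y)) \<le> 2 + K * (exp (A * y) + exp (- A * y))"
  shows "exp (A * (cole_hopf a v fp x - cole_hopf a v f x)) + exp (A * (cole_hopf a v fm x - cole_hopf a v f x))
    \<le> 2 + K * exp (3 / 2 * A\<^sup>2 * v) * (exp (A * x) + exp (- A * x))"
proof -
  let ?q = "\<lambda>y. exp (a * (f y - cole_hopf a v f x))"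
  have egq: "exp_growth ?q"
    using lip_exp_exp_growth[OF lip_add_const[OF f, of "- cole_hopf a v f x"], of a] by simp
  have egd: "exp_growth (\<lambda>y. ?q y * exp (A * (h y - f y)))" if h: "N-lipschitz_on UNIV h" for h N
  proof -
    have "exp_growth (\<lambda>y. ?q y * (exp (A * h y) * exp (- A * f y)))"
      by (intro exp_growth_mult egq lip_exp_exp_growth[OF f] lip_exp_exp_growth[OF h])
    then show ?thesis by (simp add: exp_add[symmetric] algebra_simps)
  qed
  have ege: "exp_growth (\<lambda>y. exp (k * y))" for k using exp_growth_exp_lin[of k 0] by simp
  have ek: "exp_growth (\<lambda>y. ?q y * exp (k * y))" for k by (intro exp_growth_mult egq ege)
  have q1: "gauss_avg v ?q x = 1"
    using cole_hopf_tilt[OF f, of a v "cole_hopf a v f x" x] by (cases "a = 0") auto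
  \<comment> \<open>In \<open>tilted_exp_le\<close> with |k| = A, the exponent k^2 / 2 + a |k| is at
    most A^2 / 2 + A^2 since \<open>a \<le> A\<close>.\<close>
  let ?E = "exp (3 / 2 * A\<^sup>2 * v)"
  have tilt: "gauss_avg v (\<lambda>y. ?q y * exp (k * y)) x \<le> ?E * exp (k * x)" if k: "\<bar>k\<bar> = A" for k
  proof -
    have "k\<^sup>2 = A\<^sup>2" using k by (metis power2_abs)
    moreover have "a * A \<le> A * A" using a A by (intro mult_right_mono) auto
    ultimately have "(k\<^sup>2 / 2 + a * \<bar>k\<bar>) * v \<le> (3 / 2 * A\<^sup>2) * v"
      using v k by (intro mult_right_mono) (auto simp: power2_eq_square mult.commute)
    then have "exp ((k\<^sup>2 / 2 + a * \<bar>k\<bar>) * v) * exp (k * x) \<le> ?E * exp (k * x)"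
      by simp
    with tilted_exp_le[OF f a(1) v, of x k] show ?thesis by (rule order_trans)
  qed
  have "exp (A * (cole_hopf a v fp x - cole_hopf a v f x)) + exp (A * (cole_hopf a v fm x - cole_hopf a v f x))
      \<le> gauss_avg v (\<lambda>y. ?q y * exp (A * (fp y - f y))) x + gauss_avg v (\<lambda>y. ?q y * exp (A * (fm y - f y))) x"
    by (intro add_mono exp_cole_hopf_diff_le[OF f fp a A] exp_cole_hopf_diff_le[OF f fm a A])
  also have "\<dots> = gauss_avg v (\<lambda>y. ?q y * exp (A * (fp y - f y)) + ?q y * exp (A * (fm y - f y))) x"
    by (rule gauss_avg_add[symmetric]) (rule egd[OF fp] egd[OF fm])+
  also have "\<dots> \<le> gauss_avg v (\<lambda>y. 2 * ?q y + K * (?q y * exp (A * y) + ?q y * exp (- A * y))) x"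
  proof (rule gauss_avg_mono)
    fix y
    have "?q y * (exp (A * (fp y - f y)) + exp (A * (fm y - f y))) \<le> ?q y * (2 + K * (exp (A * y) + exp (- A * y)))"
      by (rule mult_left_mono[OF le]) simp
    then show "?q y * exp (A * (fp y - f y)) + ?q y * exp (A * (fm y - f y))
        \<le> 2 * ?q y + K * (?q y * exp (A * y) + ?q y * exp (- A * y))"
      by (simp add: algebra_simps)
  qed (intro exp_growth_add exp_growth_mult exp_growth_const egq ege egd[OF fp] egd[OF fm])+
  also have "\<dots> = 2 + K * (gauss_avg v (\<lambda>y. ?q y * exp (A * y)) x + gauss_avg v (\<lambda>y. ?q y * exp (- A * y)) x)"
    unfolding gauss_avg_cmult gauss_avg_add[OF ek ek] q1
      gauss_avg_add[OF exp_growth_mult[OF exp_growth_const egq]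
        exp_growth_mult[OF exp_growth_const exp_growth_add[OF ek ek]]] by simp
  also have "\<dots> \<le> 2 + K * (?E * exp (A * x) + ?E * exp (- A * x))"
    using tilt[of A] tilt[of "- A"] A K by (intro add_left_mono mult_left_mono add_mono) auto
  finally show ?thesis by (simp add: algebra_simps)
qed

subsection \<open>Iterated Cole-Hopf operators\<close>

text \<open>\<open>g\<close> is read only at the left endpoints of the grid cells, so it may be any
  function; \<open>d\<close> stands for the derivative of the mixture, whose increments are the
  variances.\<close>

primrec flow :: "(real \<Rightarrow> real) \<Rightarrow> (real \<Rightarrow> real) \<Rightarrow> real \<Rightarrow> real list \<Rightarrow> (real \<Rightarrow> real) \<Rightarrow> real \<Rightarrow> real" where
  "flow d g u [] f = f"
| "flow d g u (t # ts) f = cole_hopf (g u) (d t - d u) (flow d g t ts f)"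

text \<open>A left-endpoint Riemann-Stieltjes sum of \<open>h\<close> with respect to
  \<open>d\<close>; for a step function on a grid containing its jumps it is the exact weighted
  integral.\<close>

primrec weighted_sum :: "(real \<Rightarrow> real) \<Rightarrow> (real \<Rightarrow> real) \<Rightarrow> real \<Rightarrow> real list \<Rightarrow> real" where
  "weighted_sum d h u [] = 0"
| "weighted_sum d h u (t # ts) = (d t - d u) * h u + weighted_sum d h t ts"

abbreviation grid :: "real \<Rightarrow> real list \<Rightarrow> bool" where
  "grid u ts \<equiv> sorted_wrt (<) (u # ts) \<and> set (u # ts) \<subseteq> {0..1}"

lemma grid_Cons: "grid u (t # ts) \<Longrightarrow> grid t ts \<and> 0 \<le> u \<and> u < t \<and> t \<le> 1"
  by auto

lemma flow_lip:
  assumes "L-lipschitz_on UNIV f" "grid u ts" "\<And>s. s \<in> {0..<1} \<Longrightarrow> 0 \<le> g s"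
  shows "L-lipschitz_on UNIV (flow d g u ts f)"
  using assms(2)
proof (induction ts arbitrary: u)
  case (Cons t ts)
  then show ?case using assms(3)[of u] grid_Cons[OF Cons.prems] by (auto intro!: cole_hopf_lip)
qed (use assms in simp)

lemma flow_convex:
  assumes "1-lipschitz_on UNIV f" "convex_on UNIV f" "grid u ts" "\<And>s. s \<in> {0..<1} \<Longrightarrow> 0 \<le> g s"
  shows "convex_on UNIV (flow d g u ts f)"
  using assms(3)
proof (induction ts arbitrary: u)
  case (Cons t ts)
  note gr = grid_Cons[OF Cons.prems]
  show ?case unfolding flow.simps
    by (rule cole_hopf_convex[OF flow_lip[OF assms(1) _ assms(4)] Cons.IH])
      (use gr assms(4)[of u] in auto)
qed (use assms in simp)

lemma flow_mono:
  assumes "L-lipschitz_on UNIV f" "M-lipschitz_on UNIV h" "grid u ts" "\<And>s. s \<in> {0..<1} \<Longrightarrow> 0 \<le> g s"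
    and "\<And>y. f y \<le> h y"
  shows "flow d g u ts f x \<le> flow d g u ts h x"
  using assms(3)
proof (induction ts arbitrary: u x)
  case (Cons t ts)
  note gr = grid_Cons[OF Cons.prems]
  show ?case unfolding flow.simps
    by (rule cole_hopf_mono[OF flow_lip[OF assms(1) _ assms(4)] flow_lip[OF assms(2) _ assms(4)] _ Cons.IH])
      (use gr assms(4)[of u] in auto)
qed (use assms in simp)

lemma flow_add_const:
  assumes "L-lipschitz_on UNIV f" "grid u ts" "\<And>s. s \<in> {0..<1} \<Longrightarrow> 0 \<le> g s"
  shows "flow d g u ts (\<lambda>y. f y + c) x = flow d g u ts f x + c"
  using assms(2)
proof (induction ts arbitrary: u x)
  case (Cons t ts)
  note gr = grid_Cons[OF Cons.prems]
  then have "flow d g t ts (\<lambda>y. f y + c) = (\<lambda>y. flow d g t ts f y + c)"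
    using Cons.IH by auto
  then show ?case
    using cole_hopf_add_const[OF flow_lip[OF assms(1) _ assms(3), where u = t and ts = ts and d = d]] gr by simp
qed simp

lemma flow_scale:
  assumes "l \<noteq> 0"
  shows "flow d g u ts (\<lambda>y. l * f y) x = l * flow d (\<lambda>s. l * g s) u ts f x"
proof (induction ts arbitrary: u x)
  case (Cons t ts)
  have "flow d g t ts (\<lambda>y. l * f y) = (\<lambda>x. l * flow d (\<lambda>s. l * g s) t ts f x)"
    using Cons.IH by auto
  then show ?case using cole_hopf_scale[OF assms] by simp
qed simp

lemma flow_append: "flow d g u (ts @ ss) f = flow d g u ts (flow d g (last (u # ts)) ss f)"
  by (induction ts arbitrary: u) auto

lemma flow_cong:
  assumes "\<And>s. s \<in> set (butlast (u # ts)) \<Longrightarrow> g s = h s"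
  shows "flow d g u ts f = flow d h u ts f"
  using assms by (induction ts arbitrary: u) (auto split: if_splits)

lemma flow_nonneg:
  assumes "1-lipschitz_on UNIV f" "grid u ts" "\<And>s. s \<in> {0..<1} \<Longrightarrow> 0 \<le> g s" "\<And>y. 0 \<le> f y"
  shows "0 \<le> flow d g u ts f x"
proof -
  have z: "flow d g u ts (\<lambda>_. 0) x = 0" for u ts x
  proof (induction ts arbitrary: u x)
    case (Cons t ts)
    then have "flow d g t ts (\<lambda>_. 0) = (\<lambda>_. 0)" by auto
    then show ?case by (simp add: cole_hopf_gauss_avg)
  qed simp
  show ?thesis
    using flow_mono[of 0 "\<lambda>_. 0" 1 f u ts g d x] assms z by (auto simp: lipschitz_on_def)
qed

text \<open>By induction the inner flows at the three parameters satisfy the hypothesis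
  \<open>le\<close> of \<open>cole_hopf_joint_convex\<close>, which is why that lemma admits three
  functions.\<close>

lemma flow_joint_convex:
  assumes f: "1-lipschitz_on UNIV f" "convex_on UNIV f" and gr: "grid u ts"
    and d: "mono_on {0..1} d"
    and g: "\<And>s. s \<in> {0..<1} \<Longrightarrow> 0 \<le> g1 s" "\<And>s. s \<in> {0..<1} \<Longrightarrow> 0 \<le> g2 s"
    and \<theta>: "0 \<le> \<theta>" "\<theta> \<le> 1"
  shows "flow d (\<lambda>s. \<theta> * g1 s + (1 - \<theta>) * g2 s) u ts f (\<theta> * x + (1 - \<theta>) * y)
    \<le> \<theta> * flow d g1 u ts f x + (1 - \<theta>) * flow d g2 u ts f y"
  using gr
proof (induction ts arbitrary: u x y)
  case Nil
  show ?case using convex_onD[OF f(2), of "1 - \<theta>" x y] \<theta> by simp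
next
  case (Cons t ts)
  note gr = grid_Cons[OF Cons.prems]
  have gg: "0 \<le> \<theta> * g1 s + (1 - \<theta>) * g2 s" if "s \<in> {0..<1}" for s
    using g[OF that] \<theta> by simp
  have u: "u \<in> {0..<1}" using gr by auto
  have v: "0 \<le> d t - d u" using mono_onD[OF d, of u t] gr by auto
  show ?case unfolding flow.simps
    by (rule cole_hopf_joint_convex[OF flow_lip[OF f(1) _ gg] flow_convex[OF f _ gg]
          flow_lip[OF f(1) _ g(1)] flow_lip[OF f(1) _ g(2)] g(1)[OF u] g(2)[OF u] \<theta> v Cons.IH])
      (use gr in auto)
qed

text \<open>Each step is nonexpansive for the sup norm and has slope at most half its variance in
  the parameter, so the errors of the cells add up.\<close>

lemma flow_param_lip:
  assumes f: "1-lipschitz_on UNIV f" "convex_on UNIV f" and gr: "grid u ts"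
    and d: "mono_on {0..1} d"
    and g: "\<And>s. s \<in> {0..<1} \<Longrightarrow> 0 \<le> g1 s" "\<And>s. s \<in> {0..<1} \<Longrightarrow> 0 \<le> g2 s"
  shows "flow d g1 u ts f x \<le> flow d g2 u ts f x + weighted_sum d (\<lambda>s. \<bar>g1 s - g2 s\<bar>) u ts / 2"
  using gr
proof (induction ts arbitrary: u x)
  case (Cons t ts)
  note gr = grid_Cons[OF Cons.prems]
  have u: "u \<in> {0..<1}" using gr by auto
  have v: "0 \<le> d t - d u" using mono_onD[OF d, of u t] gr by auto
  let ?c = "weighted_sum d (\<lambda>s. \<bar>g1 s - g2 s\<bar>) t ts / 2"
  have "flow d g1 u (t # ts) f x \<le> cole_hopf (g1 u) (d t - d u) (flow d g2 t ts f) x + ?c"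
    unfolding flow.simps
    by (rule cole_hopf_le_add[OF flow_lip[OF f(1) _ g(1)] flow_lip[OF f(1) _ g(2)] g(1)[OF u] Cons.IH])
      (use gr in auto)
  also have "cole_hopf (g1 u) (d t - d u) (flow d g2 t ts f) x
      \<le> cole_hopf (g2 u) (d t - d u) (flow d g2 t ts f) x + \<bar>g1 u - g2 u\<bar> * (d t - d u) / 2"
  proof -
    have grt: "grid t ts" using gr by blast
    have fl: "1-lipschitz_on UNIV (flow d g2 t ts f)" by (rule flow_lip[OF f(1) grt g(2)])
    have fc: "convex_on UNIV (flow d g2 t ts f)" by (rule flow_convex[OF f grt g(2)])
    from cole_hopf_param_lip[OF fl fc v g(2)[OF u] g(1)[OF u], of x] show ?thesis
      unfolding abs_le_iff by linarith
  qed
  finally show ?case by (simp add: field_simps)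
qed simp

text \<open>Termwise comparison of the cosh series: \<open>s ^ n \<le> s\<^sup>2\<close> for even n
  \<ge> 2, while the constant terms differ by 1 - s^2.\<close>

lemma cosh_scale_le:
  fixes s u :: real
  assumes "0 \<le> s" "s \<le> 1"
  shows "exp (s * u) + exp (- (s * u)) \<le> 2 + s\<^sup>2 * (exp u + exp (- u))"
proof -
  let ?t = "\<lambda>x n. if even n then x ^ n /\<^sub>R fact n else (0::real)"
  have "?t (s * u) n \<le> s\<^sup>2 * ?t u n + (if n = 0 then 1 - s\<^sup>2 else 0)" for n
  proof (cases "n = 0 \<or> odd n")
    case False
    then obtain k where "n = 2 * k" "k \<noteq> 0" by (metis evenE mult_0_right)
    then have "2 \<le> n" by simp
    then have "s ^ n \<le> s\<^sup>2" using assms by (intro power_decreasing) auto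
    moreover have "0 \<le> u ^ n" using False by auto
    ultimately have "s ^ n * u ^ n \<le> s\<^sup>2 * u ^ n" by (rule mult_right_mono)
    then show ?thesis using False by (auto simp: power_mult_distrib divide_simps)
  qed (use assms in auto)
  moreover have "?t (s * u) sums cosh (s * u)" by (rule cosh_converges)
  moreover have "(\<lambda>n. s\<^sup>2 * ?t u n + (if n = 0 then 1 - s\<^sup>2 else 0)) sums (s\<^sup>2 * cosh u + (1 - s\<^sup>2))"
    using sums_single[of 0 "\<lambda>_. 1 - s\<^sup>2"]
    by (intro sums_add sums_mult cosh_converges) (simp add: eq_commute)
  ultimately have "cosh (s * u) \<le> s\<^sup>2 * cosh u + (1 - s\<^sup>2)" by (rule sums_le)
  moreover have e: "exp z + exp (- z) = 2 * cosh z" for z :: real by (simp add: cosh_def)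
  ultimately show ?thesis
    unfolding e mult.left_commute[of _ 2] using zero_le_power2[of s] by linarith
qed

text \<open>The factors gained in the steps multiply and their exponents telescope along
  \<open>d\<close>, so the total depends on the time span and not on the fineness of the
  grid.\<close>

lemma flow_second_difference_exp:
  assumes f: "1-lipschitz_on UNIV f" and fp: "L-lipschitz_on UNIV fp" and fm: "M-lipschitz_on UNIV fm"
    and gr: "grid u ts" and d: "mono_on {0..1} d"
    and g: "\<And>s. s \<in> {0..<1} \<Longrightarrow> 0 \<le> g s"
    and gA: "\<And>s. s \<in> set (butlast (u # ts)) \<Longrightarrow> g s \<le> A" and A: "0 < A" and K: "0 \<le> K"
    and le: "\<And>y. exp (A * (fp y - f y)) + exp (A * (fm y - f y)) \<le> 2 + K * (exp (A * y) + exp (- A * y))"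
  shows "exp (A * (flow d g u ts fp x - flow d g u ts f x)) + exp (A * (flow d g u ts fm x - flow d g u ts f x))
    \<le> 2 + K * exp (3 / 2 * A\<^sup>2 * (d (last (u # ts)) - d u)) * (exp (A * x) + exp (- A * x))"
  using gr gA
proof (induction ts arbitrary: u x)
  case Nil
  show ?case using le[of x] by simp
next
  case (Cons t ts)
  note gr = grid_Cons[OF Cons.prems(1)]
  have u: "u \<in> {0..<1}" using gr by auto
  have v: "0 \<le> d t - d u" using mono_onD[OF d, of u t] gr by auto
  let ?K = "K * exp (3 / 2 * A\<^sup>2 * (d (last (t # ts)) - d t))"
  have IH: "exp (A * (flow d g t ts fp x - flow d g t ts f x)) + exp (A * (flow d g t ts fm x - flow d g t ts f x))
    \<le> 2 + ?K * (exp (A * x) + exp (- A * x))" for x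
    using Cons.IH[of t x] gr Cons.prems(2) by auto
  have K': "0 \<le> ?K" using K by simp
  have "g u \<le> A" using Cons.prems(2)[of u] by simp
  from cole_hopf_second_difference_step[OF flow_lip[OF f _ g] flow_lip[OF fp _ g] flow_lip[OF fm _ g] g[OF u] this A v K' IH]
  have "exp (A * (flow d g u (t # ts) fp x - flow d g u (t # ts) f x))
      + exp (A * (flow d g u (t # ts) fm x - flow d g u (t # ts) f x))
    \<le> 2 + ?K * exp (3 / 2 * A\<^sup>2 * (d t - d u)) * (exp (A * x) + exp (- A * x))"
    using gr by simp
  also have "?K * exp (3 / 2 * A\<^sup>2 * (d t - d u)) = K * exp (3 / 2 * A\<^sup>2 * (d (last (u # t # ts)) - d u))"
  proof -
    have "3 / 2 * A\<^sup>2 * (d (last (t # ts)) - d t) + 3 / 2 * A\<^sup>2 * (d t - d u)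
        = 3 / 2 * A\<^sup>2 * (d (last (u # t # ts)) - d u)"
      by (simp only: distrib_left[symmetric]) simp
    then show ?thesis by (simp only: mult.assoc exp_add[symmetric])
  qed
  finally show ?case .
qed

text \<open>Scaling the order parameter by \<open>\<lambda>\<close> amounts to scaling the terminal condition by \<open>\<lambda>\<close> and the
  solution by \<open>1/\<lambda>\<close>, so smoothness in \<open>\<lambda>\<close> follows from smoothness in the terminal condition.\<close>

lemma flow_scaling_smooth:
  assumes f: "1-lipschitz_on UNIV f" "\<And>y. 0 \<le> f y"
    and gr: "grid u ts" and d: "mono_on {0..1} d"
    and g: "\<And>s. s \<in> {0..<1} \<Longrightarrow> 0 \<le> g s"
    and gA: "\<And>s. s \<in> set (butlast (u # ts)) \<Longrightarrow> g s \<le> A" and A: "0 < A"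
    and s: "0 \<le> s" "s \<le> 1 / 2"
  shows "flow d (\<lambda>t. (1 + s) * g t) u ts f 0 + flow d (\<lambda>t. (1 - s) * g t) u ts f 0 - 2 * flow d g u ts f 0
    \<le> s\<^sup>2 * (4 * exp (3 / 2 * A\<^sup>2 * (d (last (u # ts)) - d u)) / A + 4 * flow d g u ts f 0)"
proof -
  let ?E = "exp (3 / 2 * A\<^sup>2 * (d (last (u # ts)) - d u))"
  \<comment> \<open>Value for the datum scaled by l; \<open>V\<close> recovers the flow with scaled
    parameter as W l / l.\<close>
  define W where "W l = flow d g u ts (\<lambda>y. l * f y) 0" for l
  have lip: "l-lipschitz_on UNIV (\<lambda>y. l * f y)" if "0 \<le> l" for l
  proof (rule lipI)
    fix x y
    have "l * (f x - f y) \<le> l * \<bar>x - y\<bar>" 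
      using lip_abs[OF f(1), of x y] that by (intro mult_left_mono) auto
    then show "l * f x - l * f y \<le> l * \<bar>x - y\<bar>" by (simp add: algebra_simps)
  qed fact
  have W1: "W 1 = flow d g u ts f 0" by (simp add: W_def)
  have Wpos: "0 \<le> W 1" unfolding W1 by (rule flow_nonneg[OF f(1) gr g f(2)])
  have V: "flow d (\<lambda>t. l * g t) u ts f 0 = W l / l" if "0 < l" for l
    using flow_scale[of l d g u ts f 0] that by (simp add: W_def)
  have mono: "W (1 - s) \<le> W (1 + s)"
    unfolding W_def using s f(2)
    by (intro flow_mono[OF lip lip gr g] mult_right_mono) auto
  have W2: "W (1 + s) + W (1 - s) - 2 * W 1 \<le> 2 * s\<^sup>2 * ?E / A"
  proof -
    \<comment> \<open>The constants recentre the perturbations to \<plusminus> s (f - f 0), of size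
      at most s |y|; in the second difference they cancel.\<close>
    define fp fm where "fp y = (1 + s) * f y + - s * f 0" and "fm y = (1 - s) * f y + s * f 0" for y
    have lp: "(1 + s)-lipschitz_on UNIV fp" "(1 - s)-lipschitz_on UNIV fm"
      unfolding fp_def fm_def
      using lip_add_const[OF lip[of "1 + s"], of "- s * f 0"] lip_add_const[OF lip[of "1 - s"], of "s * f 0"] s
      by simp_all
    have le: "exp (A * (fp y - f y)) + exp (A * (fm y - f y)) \<le> 2 + s\<^sup>2 * (exp (A * y) + exp (- A * y))" for y
    proof -
      let ?D = "A * (f y - f 0)"
      have e: "A * (fp y - f y) = s * ?D" "A * (fm y - f y) = - (s * ?D)"
        by (simp_all add: fp_def fm_def algebra_simps)
      have "exp (A * (fp y - f y)) + exp (A * (fm y - f y)) \<le> 2 + s\<^sup>2 * (exp ?D + exp (- ?D))"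
        unfolding e by (rule cosh_scale_le) (use s in auto)
      also have "exp ?D + exp (- ?D) \<le> exp (A * y) + exp (- A * y)"
      proof -
        have "\<bar>?D\<bar> \<le> \<bar>A * y\<bar>"
          using lip_abs[OF f(1), of y 0] A by (simp add: abs_mult)
        then have "cosh \<bar>?D\<bar> \<le> cosh \<bar>A * y\<bar>" by (subst cosh_real_nonneg_le_iff) auto
        then have "cosh ?D \<le> cosh (A * y)" unfolding cosh_real_abs .
        then show ?thesis by (simp add: cosh_def)
      qed
      finally show ?thesis by (simp add: mult_left_mono)
    qed
    have "exp (A * (flow d g u ts fp 0 - flow d g u ts f 0)) + exp (A * (flow d g u ts fm 0 - flow d g u ts f 0))
      \<le> 2 + s\<^sup>2 * ?E * (exp (A * 0) + exp (- A * 0))"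
      by (rule flow_second_difference_exp[OF f(1) lp gr d g gA A _ le]) simp_all
    also have "\<dots> = 2 + 2 * s\<^sup>2 * ?E" by simp
    finally have "A * (flow d g u ts fp 0 - flow d g u ts f 0) + A * (flow d g u ts fm 0 - flow d g u ts f 0)
      \<le> 2 * s\<^sup>2 * ?E"
      using exp_ge_add_one_self[of "A * (flow d g u ts fp 0 - flow d g u ts f 0)"]
        exp_ge_add_one_self[of "A * (flow d g u ts fm 0 - flow d g u ts f 0)"] by linarith
    moreover have "flow d g u ts fp 0 = W (1 + s) + - s * f 0"
      unfolding fp_def W_def by (rule flow_add_const[OF lip gr g]) (use s in simp_all)
    moreover have "flow d g u ts fm 0 = W (1 - s) + s * f 0"
      unfolding fm_def W_def by (rule flow_add_const[OF lip gr g]) (use s in simp_all)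
    ultimately have "A * (W (1 + s) + W (1 - s) - 2 * W 1) \<le> 2 * s\<^sup>2 * ?E"
      by (simp add: W1 algebra_simps)
    then show ?thesis using A by (simp add: pos_le_divide_eq mult.commute)
  qed
  have s2: "3 / 4 \<le> 1 - s\<^sup>2" using s power_mono[of s "1/2" 2] by (simp add: power2_eq_square)
  have B: "0 \<le> s\<^sup>2 * (2 * ?E / A + 2 * W 1)" using Wpos A by simp
  \<comment> \<open>Passing from W l to W l / l adds a cross term, of favourable sign because W (1 -
    s) \<le> W (1 + s), and a term of order s^2; division by 1 - s^2 \<ge> 3/4 is absorbed in a
    factor 2.\<close>
  have "W (1 + s) / (1 + s) + W (1 - s) / (1 - s) - 2 * W 1
      = ((W (1 + s) + W (1 - s) - 2 * W 1) - s * (W (1 + s) - W (1 - s)) + 2 * s\<^sup>2 * W 1) / (1 - s\<^sup>2)"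
  proof -
    have nz: "1 + s \<noteq> 0" "1 - s \<noteq> 0" "1 - s\<^sup>2 \<noteq> 0" using s s2 by auto
    have fac: "1 - s\<^sup>2 = (1 + s) * (1 - s)" by (simp add: power2_eq_square algebra_simps)
    have "W (1 + s) / (1 + s) + W (1 - s) / (1 - s) - 2 * W 1
        = (W (1 + s) * (1 - s) + W (1 - s) * (1 + s)) / (1 - s\<^sup>2) - 2 * W 1 * (1 - s\<^sup>2) / (1 - s\<^sup>2)"
      using nz(3) unfolding add_frac_eq[OF nz(1,2)] fac by simp
    also have "\<dots> = (W (1 + s) * (1 - s) + W (1 - s) * (1 + s) - 2 * W 1 * (1 - s\<^sup>2)) / (1 - s\<^sup>2)"
      by (rule diff_divide_distrib[symmetric])
    also have "W (1 + s) * (1 - s) + W (1 - s) * (1 + s) - 2 * W 1 * (1 - s\<^sup>2)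
        = (W (1 + s) + W (1 - s) - 2 * W 1) - s * (W (1 + s) - W (1 - s)) + 2 * s\<^sup>2 * W 1"
      by (simp add: algebra_simps)
    finally show ?thesis .
  qed
  also have "\<dots> \<le> (s\<^sup>2 * (2 * ?E / A + 2 * W 1)) / (1 - s\<^sup>2)"
  proof (rule divide_right_mono)
    have "0 \<le> s * (W (1 + s) - W (1 - s))" using mono s by simp
    moreover have "s\<^sup>2 * (2 * ?E / A + 2 * W 1) = 2 * s\<^sup>2 * ?E / A + 2 * s\<^sup>2 * W 1"
      by (simp add: distrib_left)
    ultimately show "(W (1 + s) + W (1 - s) - 2 * W 1) - s * (W (1 + s) - W (1 - s)) + 2 * s\<^sup>2 * W 1
        \<le> s\<^sup>2 * (2 * ?E / A + 2 * W 1)"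
      using W2 by linarith
  qed (use s2 in simp)
  also have "\<dots> \<le> 2 * (s\<^sup>2 * (2 * ?E / A + 2 * W 1))"
  proof -
    have "X / (1 - s\<^sup>2) \<le> 2 * X" if "0 \<le> X" for X
    proof -
      have "X * 1 \<le> X * (2 * (1 - s\<^sup>2))"
        using s2 that by (intro mult_left_mono) auto
      then show ?thesis using s2 by (simp add: pos_divide_le_eq mult_ac)
    qed
    then show ?thesis using B by blast
  qed
  finally show ?thesis using s V[of "1 + s"] V[of "1 - s"] by (simp add: W1 algebra_simps)
qed

text \<open>\<open>S\<close> contains the jumps of \<open>g\<close>. The cell \<open>{s<..t}\<close>
  is open on the left, so a new value is taken at the jump itself: for finite \<open>S\<close> these
  functions are right-continuous, like \<open>step_fun\<close>.\<close>

definition step_on :: "real set \<Rightarrow> (real \<Rightarrow> real) \<Rightarrow> bool" where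
  "step_on S g \<longleftrightarrow> (\<forall>s t. 0 \<le> s \<and> s \<le> t \<and> t < 1 \<and> S \<inter> {s<..t} = {} \<longrightarrow> g s = g t)"

text \<open>A grid point at which \<open>g\<close> does not jump splits a cell into two with the
  same parameter, and the semigroup law joins them again.\<close>

lemma flow_insort:
  assumes f: "1-lipschitz_on UNIV f" and gr: "grid u ts" and d: "mono_on {0..1} d"
    and g: "\<And>s. s \<in> {0..<1} \<Longrightarrow> 0 \<le> g s"
    and st: "step_on S g" "S \<inter> {u<..} \<subseteq> set ts" and r: "u < r" "r \<notin> set ts" "ts \<noteq> []" "r < last ts"
  shows "flow d g u (insort r ts) f = flow d g u ts f"
  using gr st(2) r
proof (induction ts arbitrary: u)
  case (Cons t ts)
  note gr = grid_Cons[OF Cons.prems(1)]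
  have u: "u \<in> {0..<1}" using gr by auto
  show ?case
  proof (cases "r \<le> t")
    case True
    then have rt: "r < t" using Cons.prems(4) by auto
    have "S \<inter> {u<..r} = {}"
      using Cons.prems(1,2) rt by fastforce
    then have gu: "g u = g r" using st(1) gr rt Cons.prems(3) unfolding step_on_def by auto
    have v: "0 \<le> d r - d u" "0 \<le> d t - d r"
      using mono_onD[OF d, of u r] mono_onD[OF d, of r t] gr rt Cons.prems(3) by auto
    have grt: "grid t ts" using gr by blast
    have fl: "1-lipschitz_on UNIV (flow d g t ts f)" by (rule flow_lip[OF f grt g])
    have "flow d g u (insort r (t # ts)) f x = flow d g u (t # ts) f x" for x
      using cole_hopf_semigroup[OF fl g[OF u] v] rt gu by simp
    then show ?thesis by auto
  next
    case False
    then have "flow d g t (insort r ts) f = flow d g t ts f"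
      using Cons.prems gr by (intro Cons.IH) (auto split: if_splits)
    then show ?thesis using False by simp
  qed
qed simp

definition grid_value :: "(real \<Rightarrow> real) \<Rightarrow> real set \<Rightarrow> (real \<Rightarrow> real) \<Rightarrow> real" where
  "grid_value d S g = flow d g 0 (sorted_list_of_set (insert 1 S)) abs 0"

lemma abs_lip: "1-lipschitz_on UNIV (abs :: real \<Rightarrow> real)"
  by (rule lipI) auto

lemma abs_convex: "convex_on UNIV (abs :: real \<Rightarrow> real)"
  using convex_on_dist[of UNIV "0::real"] by (simp add: convex_on_def dist_real_def)

lemma grid_sorted_list:
  assumes "finite S" "S \<subseteq> {0<..<1}"
  shows "grid 0 (sorted_list_of_set (insert 1 S))"
  using assms by (auto simp: strict_sorted_list_of_set simp del: sorted_list_of_set_insert_remove)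

lemma sorted_le_last: "sorted xs \<Longrightarrow> x \<in> set xs \<Longrightarrow> x \<le> last xs" for x :: real
  by (induction xs) auto

lemma grid_value_insert:
  assumes S: "finite S" "S \<subseteq> {0<..<1}" and d: "mono_on {0..1} d"
    and g: "\<And>s. s \<in> {0..<1} \<Longrightarrow> 0 \<le> g s" and st: "step_on S g" and r: "r \<in> {0<..<1}"
  shows "grid_value d (insert r S) g = grid_value d S g"
proof (cases "r \<in> S")
  case True
  then show ?thesis by (simp add: insert_absorb)
next
  case False
  let ?ts = "sorted_list_of_set (insert 1 S)"
  have fin: "finite (insert 1 S)" using S by simp
  have ne: "?ts \<noteq> []" using fin by (metis insert_not_empty set_empty set_sorted_list_of_set)
  have l: "last ?ts = 1"
  proof -
    have "1 \<in> set ?ts" using fin by (metis insertI1 set_sorted_list_of_set)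
    then have "1 \<le> last ?ts" by (rule sorted_le_last[rotated]) simp
    moreover have "last ?ts \<in> insert 1 S" using last_in_set[OF ne] set_sorted_list_of_set[OF fin] by blast
    ultimately show ?thesis using S by auto
  qed
  have "sorted_list_of_set (insert r (insert 1 S)) = insort r ?ts"
    by (rule sorted_list_of_set_insert) (use False r fin in auto)
  then have eq: "sorted_list_of_set (insert 1 (insert r S)) = insort r ?ts"
    by (simp only: insert_commute)
  show ?thesis unfolding grid_value_def eq
  proof (rule fun_cong[OF flow_insort[OF abs_lip grid_sorted_list[OF S] d g st]])
    show "S \<inter> {0<..} \<subseteq> set ?ts" "r \<notin> set ?ts"
      using False r set_sorted_list_of_set[OF fin] by auto
  qed (use r ne l in auto)
qed

lemma step_on_mono: "step_on S g \<Longrightarrow> S \<subseteq> S' \<Longrightarrow> step_on S' g"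
  unfolding step_on_def by blast

text \<open>Iterated insertion of grid points; it lets two step paths with different jump sets be
  compared on the union of these sets.\<close>

lemma grid_value_mono:
  assumes S: "finite S" "S \<subseteq> {0<..<1}" and T: "finite T" "T \<subseteq> {0<..<1}" and d: "mono_on {0..1} d"
    and g: "\<And>s. s \<in> {0..<1} \<Longrightarrow> 0 \<le> g s" and st: "step_on S g"
  shows "grid_value d (T \<union> S) g = grid_value d S g"
  using T
proof (induction T rule: finite_induct)
  case (insert r T)
  have "grid_value d (insert r (T \<union> S)) g = grid_value d (T \<union> S) g"
    by (rule grid_value_insert[OF _ _ d g step_on_mono[OF st]]) (use insert S in auto)
  then show ?case using insert by simp
qed simp

subsection \<open>Density of step functions\<close>

text \<open>Boundedness and measurability are imposed on the whole line so that a step path may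
  multiply any integrable function without further conditions.\<close>

definition step_path :: "real set \<Rightarrow> (real \<Rightarrow> real) \<Rightarrow> bool" where
  "step_path S g \<longleftrightarrow> finite S \<and> S \<subseteq> {0<..<1} \<and> step_on S g
     \<and> g \<in> borel_measurable borel \<and> (\<exists>B. \<forall>t. \<bar>g t\<bar> \<le> B)"

lemma step_path_const: "step_path {} (\<lambda>_. c)"
  unfolding step_path_def step_on_def by auto

lemma step_path_comp2:
  assumes "step_path S g" "step_path T h" and [measurable]: "(\<lambda>t. \<phi> (g t) (h t)) \<in> borel_measurable borel"
    and "\<And>A B x y. \<bar>x\<bar> \<le> A \<Longrightarrow> \<bar>y\<bar> \<le> B \<Longrightarrow> \<bar>\<phi> x y\<bar> \<le> \<beta> A B"
  shows "step_path (S \<union> T) (\<lambda>t. \<phi> (g t) (h t))"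
proof -
  obtain A B where AB: "\<And>t. \<bar>g t\<bar> \<le> A" "\<And>t. \<bar>h t\<bar> \<le> B"
    using assms(1,2) unfolding step_path_def by blast
  have "step_on (S \<union> T) g" "step_on (S \<union> T) h"
    using assms(1,2) step_on_mono unfolding step_path_def by blast+
  then have eq: "g s = g t \<and> h s = h t" if "0 \<le> s \<and> s \<le> t \<and> t < 1 \<and> (S \<union> T) \<inter> {s<..t} = {}" for s t
    using that unfolding step_on_def by blast
  have "step_on (S \<union> T) (\<lambda>t. \<phi> (g t) (h t))"
    unfolding step_on_def
  proof (intro allI impI)
    fix s t :: real assume "0 \<le> s \<and> s \<le> t \<and> t < 1 \<and> (S \<union> T) \<inter> {s<..t} = {}"
    from eq[OF this] show "\<phi> (g s) (h s) = \<phi> (g t) (h t)" by simp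
  qed
  moreover have "\<exists>C. \<forall>t. \<bar>\<phi> (g t) (h t)\<bar> \<le> C"
    using assms(4)[OF AB] by blast
  ultimately show ?thesis
    using assms(1-3) unfolding step_path_def by simp
qed

lemma step_path_add:
  assumes g: "step_path S g" and h: "step_path T h"
  shows "step_path (S \<union> T) (\<lambda>t. g t + h t)"
proof (rule step_path_comp2[OF g h, where \<phi> = "\<lambda>x y. x + y" and \<beta> = "\<lambda>A B. A + B"])
  have [measurable]: "g \<in> borel_measurable borel" "h \<in> borel_measurable borel"
    using g h by (simp_all add: step_path_def)
  show "(\<lambda>t. g t + h t) \<in> borel_measurable borel" by measurable
  fix A B x y :: real assume "\<bar>x\<bar> \<le> A" "\<bar>y\<bar> \<le> B"
  then show "\<bar>x + y\<bar> \<le> A + B" by linarith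
qed

lemma step_path_diff:
  assumes g: "step_path S g" and h: "step_path T h"
  shows "step_path (S \<union> T) (\<lambda>t. g t - h t)"
proof (rule step_path_comp2[OF g h, where \<phi> = "\<lambda>x y. x - y" and \<beta> = "\<lambda>A B. A + B"])
  have [measurable]: "g \<in> borel_measurable borel" "h \<in> borel_measurable borel"
    using g h by (simp_all add: step_path_def)
  show "(\<lambda>t. g t - h t) \<in> borel_measurable borel" by measurable
  fix A B x y :: real assume "\<bar>x\<bar> \<le> A" "\<bar>y\<bar> \<le> B"
  then show "\<bar>x - y\<bar> \<le> A + B" by linarith
qed

lemma step_path_mult:
  assumes g: "step_path S g" and h: "step_path T h"
  shows "step_path (S \<union> T) (\<lambda>t. g t * h t)"
proof (rule step_path_comp2[OF g h, where \<phi> = "\<lambda>x y. x * y" and \<beta> = "\<lambda>A B. A * B"])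
  have [measurable]: "g \<in> borel_measurable borel" "h \<in> borel_measurable borel"
    using g h by (simp_all add: step_path_def)
  show "(\<lambda>t. g t * h t) \<in> borel_measurable borel" by measurable
  fix A B x y :: real assume "\<bar>x\<bar> \<le> A" "\<bar>y\<bar> \<le> B"
  then show "\<bar>x * y\<bar> \<le> A * B" unfolding abs_mult by (rule mult_mono') simp_all
qed

lemma step_path_max:
  assumes g: "step_path S g" and h: "step_path T h"
  shows "step_path (S \<union> T) (\<lambda>t. max (g t) (h t))"
proof (rule step_path_comp2[OF g h, where \<phi> = "max" and \<beta> = "\<lambda>A B. max A B"])
  have [measurable]: "g \<in> borel_measurable borel" "h \<in> borel_measurable borel"
    using g h by (simp_all add: step_path_def)
  show "(\<lambda>t. max (g t) (h t)) \<in> borel_measurable borel" by measurable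
  fix A B x y :: real assume "\<bar>x\<bar> \<le> A" "\<bar>y\<bar> \<le> B"
  then show "\<bar>max x y\<bar> \<le> max A B" by linarith
qed

lemma step_path_cmult: "step_path S g \<Longrightarrow> step_path S (\<lambda>t. c * g t)"
  using step_path_mult[OF step_path_const, of S g c] by simp

lemma step_path_lessThan: "step_path ({a} \<inter> {0<..<1}) (indicator {..<a})"
proof -
  have "\<exists>B. \<forall>t. \<bar>indicator {..<a} t :: real\<bar> \<le> B"
    by (rule exI[of _ 1]) (auto simp: indicator_def)
  then show ?thesis
    unfolding step_path_def step_on_def by (auto simp: indicator_def)
qed

lemma step_path_less: "step_path ({a} \<inter> {0<..<1}) (\<lambda>t. if t < a then 1 else 0)"
proof -
  have "(\<lambda>t. if t < a then 1 else 0 :: real) = indicator {..<a}" by (auto simp: indicator_def)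
  then show ?thesis using step_path_lessThan by simp
qed

section \<open>L1 density of step functions for a finite Borel measure\<close>

context
  fixes M :: "real measure"
  assumes M: "finite_measure M" "sets M = sets borel"
begin

interpretation finite_measure M by (rule M)

definition approximable :: "(real \<Rightarrow> real) \<Rightarrow> bool" where
  "approximable h \<longleftrightarrow> (\<forall>e>0. \<exists>S g. step_path S g \<and> (LINT t|M. \<bar>g t - h t\<bar>) < e)"

lemma step_path_integrable:
  assumes "step_path S g"
  shows "integrable M g"
proof -
  obtain B where "\<And>t. \<bar>g t\<bar> \<le> B" using assms unfolding step_path_def by blast
  moreover have "g \<in> borel_measurable M"
    using assms M(2) measurable_cong_sets[of M borel borel borel] unfolding step_path_def by auto
  ultimately show ?thesis by (intro integrable_const_bound[where B = B]) auto
qed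

lemma approximable_step: "step_path S g \<Longrightarrow> approximable g"
  unfolding approximable_def by (intro allI impI exI[of _ S] exI[of _ g]) auto

lemma approximable_close:
  assumes h: "integrable M h"
    and "\<And>e. 0 < e \<Longrightarrow> \<exists>h'. integrable M h' \<and> approximable h' \<and> (LINT t|M. \<bar>h' t - h t\<bar>) < e"
  shows "approximable h"
  unfolding approximable_def
proof (intro allI impI)
  fix e :: real assume "0 < e"
  then have e: "0 < e / 2" by simp
  obtain h' where h': "integrable M h'" "approximable h'" "(LINT t|M. \<bar>h' t - h t\<bar>) < e / 2"
    using assms(2)[OF e] by blast
  obtain S g where g: "step_path S g" "(LINT t|M. \<bar>g t - h' t\<bar>) < e / 2"
    using h'(2) e unfolding approximable_def by blast
  note ig = step_path_integrable[OF g(1)]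
  have "(LINT t|M. \<bar>g t - h t\<bar>) \<le> (LINT t|M. \<bar>g t - h' t\<bar> + \<bar>h' t - h t\<bar>)"
    by (rule integral_mono) (auto intro!: Bochner_Integration.integrable_add integrable_abs Bochner_Integration.integrable_diff ig h h'(1))
  also have "\<dots> = (LINT t|M. \<bar>g t - h' t\<bar>) + (LINT t|M. \<bar>h' t - h t\<bar>)"
    by (rule Bochner_Integration.integral_add) (auto intro!: integrable_abs Bochner_Integration.integrable_diff ig h h'(1))
  also have "\<dots> < e" using g(2) h'(3) by simp
  finally show "\<exists>S g. step_path S g \<and> (LINT t|M. \<bar>g t - h t\<bar>) < e" using g(1) by blast
qed

lemma approximable_add:
  assumes "integrable M h" "integrable M k" "approximable h" "approximable k"
  shows "approximable (\<lambda>t. h t + k t)"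
  unfolding approximable_def
proof (intro allI impI)
  fix e :: real assume "0 < e"
  then have e: "0 < e / 2" by simp
  obtain S g where g: "step_path S g" "(LINT t|M. \<bar>g t - h t\<bar>) < e / 2"
    using assms(3) e unfolding approximable_def by blast
  obtain T f where f: "step_path T f" "(LINT t|M. \<bar>f t - k t\<bar>) < e / 2"
    using assms(4) e unfolding approximable_def by blast
  note i = step_path_integrable[OF g(1)] step_path_integrable[OF f(1)]
  have "(LINT t|M. \<bar>(g t + f t) - (h t + k t)\<bar>) \<le> (LINT t|M. \<bar>g t - h t\<bar> + \<bar>f t - k t\<bar>)"
    by (rule integral_mono) (auto intro!: Bochner_Integration.integrable_add integrable_abs Bochner_Integration.integrable_diff i assms)
  also have "\<dots> = (LINT t|M. \<bar>g t - h t\<bar>) + (LINT t|M. \<bar>f t - k t\<bar>)"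
    by (rule Bochner_Integration.integral_add) (auto intro!: integrable_abs Bochner_Integration.integrable_diff i assms)
  also have "\<dots> < e" using g(2) f(2) by simp
  finally show "\<exists>S g. step_path S g \<and> (LINT t|M. \<bar>g t - (h t + k t)\<bar>) < e"
    using step_path_add[OF g(1) f(1)] by blast
qed

lemma approximable_cmult:
  assumes "integrable M h" "approximable h"
  shows "approximable (\<lambda>t. c * h t)"
proof (cases "c = 0")
  case True
  then show ?thesis using approximable_step[OF step_path_const[of 0]] by simp
next
  case False
  show ?thesis
    unfolding approximable_def
  proof (intro allI impI)
    fix e :: real assume "0 < e"
    then have e: "0 < e / \<bar>c\<bar>" using False by simp
    obtain S g where g: "step_path S g" "(LINT t|M. \<bar>g t - h t\<bar>) < e / \<bar>c\<bar>"
      using assms(2) e unfolding approximable_def by blast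
    have "(LINT t|M. \<bar>c * g t - c * h t\<bar>) = \<bar>c\<bar> * (LINT t|M. \<bar>g t - h t\<bar>)"
      by (simp add: abs_mult[symmetric] right_diff_distrib flip: integral_mult_right_zero)
    also have "\<dots> < e" using g(2) False by (simp add: pos_less_divide_eq mult.commute)
    finally show "\<exists>S g. step_path S g \<and> (LINT t|M. \<bar>g t - c * h t\<bar>) < e"
      using step_path_cmult[OF g(1)] by blast
  qed
qed

text \<open>Dominated convergence gives L1 convergence, and approximability is closed under L1
  limits by \<open>approximable_close\<close>.\<close>

lemma approximable_lim:
  assumes "integrable M H" "\<And>i. integrable M (s i)" "integrable M h" "\<And>i. approximable (s i)"
    and "\<And>x. (\<lambda>i. s i x) \<longlonglongrightarrow> h x" "\<And>i x. \<bar>s i x\<bar> \<le> H x"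
  shows "approximable h"
proof (rule approximable_close[OF assms(3)])
  fix e :: real assume e: "0 < e"
  have "(\<lambda>i. LINT t|M. \<bar>s i t - h t\<bar>) \<longlonglongrightarrow> (LINT t|M. 0)"
  proof (rule integral_dominated_convergence[where w = "\<lambda>t. H t + \<bar>h t\<bar>"])
    show "integrable M (\<lambda>t. H t + \<bar>h t\<bar>)" using assms by auto
    show "AE t in M. (\<lambda>i. \<bar>s i t - h t\<bar>) \<longlonglongrightarrow> 0"
      by (rule AE_I2) (use assms(5) tendsto_rabs_zero LIM_zero in blast)
    show "AE t in M. norm \<bar>s i t - h t\<bar> \<le> H t + \<bar>h t\<bar>" for i
      by (rule AE_I2) (use assms(6) in \<open>auto intro: order_trans[OF abs_triangle_ineq4] add_right_mono\<close>)
  qed (use assms(2,3) in auto)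
  then have "eventually (\<lambda>i. (LINT t|M. \<bar>s i t - h t\<bar>) < e) sequentially"
    using e by (simp add: order_tendstoD(2))
  then obtain i where "(LINT t|M. \<bar>s i t - h t\<bar>) < e"
    using eventually_happens'[OF sequentially_bot] by blast
  then show "\<exists>h'. integrable M h' \<and> approximable h' \<and> (LINT t|M. \<bar>h' t - h t\<bar>) < e"
    using assms(2,4) by blast
qed

lemma integrable_ind: "A \<in> sets borel \<Longrightarrow> integrable M (indicator A :: real \<Rightarrow> real)"
  using M(2) by (intro integrable_real_indicator) (auto simp: less_top[symmetric] emeasure_finite)

text \<open>Dynkin's pi-lambda argument: the half-lines \<open>{..<a}\<close> are stable under
  intersection and generate the Borel sets, their indicators are step functions, and the
  approximable sets are closed under complements and countable disjoint unions.\<close>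

lemma approximable_set:
  assumes "A \<in> sets borel"
  shows "approximable (indicator A)"
proof -
  let ?G = "range (lessThan :: real \<Rightarrow> real set)"
  have "Int_stable ?G"
  proof -
    have "{..<a} \<inter> {..<b} = {..<min a b}" for a b :: real by auto
    then show ?thesis unfolding Int_stable_def by blast
  qed
  moreover have "?G \<subseteq> Pow UNIV" by simp
  moreover have "A \<in> sigma_sets UNIV ?G"
    using assms unfolding borel_Iio[where 'a = real] by (simp add: sets_measure_of)
  ultimately show ?thesis
  proof (induction rule: sigma_sets_induct_disjoint)
    case (basic A)
    then obtain a where "A = {..<a}" by auto
    then show ?case using approximable_step[OF step_path_lessThan] by simp
  next
    case empty
    then show ?case using approximable_step[OF step_path_const[of 0]] by (simp add: indicator_def)
  next
    case (compl A)
    then have A: "A \<in> sets borel" unfolding borel_Iio[where 'a = real] by (simp add: sets_measure_of)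
    note ia = integrable_ind[OF A]
    have "approximable (\<lambda>t. 1 + - 1 * indicator A t)"
      by (rule approximable_add[OF _ integrable_mult_right[OF ia] approximable_step[OF step_path_const]
          approximable_cmult[OF ia compl.IH]]) simp
    moreover have "(\<lambda>t. 1 + - 1 * indicator A t :: real) = indicator (UNIV - A)"
      by (auto simp: indicator_def)
    ultimately show ?case by simp
  next
    case (union A)
    then have A: "A i \<in> sets borel" for i
      unfolding borel_Iio[where 'a = real] by (auto simp: sets_measure_of)
    have fin: "approximable (indicator (\<Union>i<n. A i))" for n
    proof (induction n)
      case 0
      have "indicator (\<Union>i<0. A i) = (\<lambda>_. 0 :: real)" by (auto simp: indicator_def)
      then show ?case using approximable_step[OF step_path_const[of 0]] by simp
    next
      case (Suc n)
      have "approximable (\<lambda>t. indicator (\<Union>i<n. A i) t + indicator (A n) t)"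
      proof (rule approximable_add[OF integrable_ind integrable_ind Suc union(3)])
        show "(\<Union>i<n. A i) \<in> sets borel" by (intro sets.finite_UN finite_lessThan A)
      qed (rule A)
      moreover have "(\<lambda>t. indicator (\<Union>i<n. A i) t + indicator (A n) t :: real) = indicator (\<Union>i<Suc n. A i)"
      proof -
        have "(\<Union>i<n. A i) \<inter> A n = {}"
        proof (rule ccontr)
          assume "(\<Union>i<n. A i) \<inter> A n \<noteq> {}"
          then obtain i x where "i < n" "x \<in> A i \<inter> A n" by blast
          then show False using disjoint_family_onD[OF union(1), of i n] by simp
        qed
        moreover have "(\<Union>i<Suc n. A i) = (\<Union>i<n. A i) \<union> A n" by (auto simp: lessThan_Suc)
        ultimately show ?thesis
          by (simp add: indicator_disj_union fun_eq_iff)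
      qed
      ultimately show ?case by simp
    qed
    show ?case
    proof (rule approximable_lim[where H = "\<lambda>_. 1" and s = "\<lambda>n. indicator (\<Union>i<n. A i)"])
      show "(\<lambda>n. indicator (\<Union>i<n. A i) x :: real) \<longlonglongrightarrow> indicator (\<Union>i. A i) x" for x
        by (rule LIMSEQ_indicator_UN)
      show "integrable M (\<lambda>_. 1 :: real)" by simp
      show "integrable M (indicator (\<Union>i<n. A i) :: real \<Rightarrow> real)" for n
        using A by (intro integrable_ind) auto
      show "integrable M (indicator (\<Union>i. A i) :: real \<Rightarrow> real)"
        using A by (intro integrable_ind) auto
      show "approximable (indicator (\<Union>i<n. A i))" for n by (rule fin)
      show "\<bar>indicator (\<Union>i<n. A i) x :: real\<bar> \<le> 1" for n x by (simp add: indicator_def)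
    qed
  qed
qed

lemma approximable_integrable:
  assumes "integrable M h"
  shows "approximable h"
  using assms
proof (induction rule: integrable_induct)
  case (base A c)
  have "approximable (\<lambda>t. c * indicator A t)"
    using base M(2) by (intro approximable_cmult integrable_ind approximable_set) auto
  then show ?case by (simp add: mult.commute)
next
  case (add f g)
  then show ?case by (intro approximable_add)
next
  case (lim f s)
  show ?case
    by (rule approximable_lim[where H = "\<lambda>x. 2 * \<bar>f x\<bar>" and s = s])
      (use lim sets_eq_imp_space_eq[OF M(2)] in auto)
qed

end

text \<open>The weighted problem is an unweighted one for the measure u dt, in which k / u has to be
  approximated. On [0,1), where u vanishes so does k, hence u * (k / u) = k with the convention x /
  0 = 0.\<close>

lemma step_path_dense:
  assumes u: "set_integrable lborel {0..<1} u" "\<And>t. t \<in> {0..<1} \<Longrightarrow> 0 \<le> u t"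
    and k: "set_integrable lborel {0..<1} k" "\<And>t. t \<in> {0..<1} \<Longrightarrow> u t = 0 \<Longrightarrow> k t = 0"
    and e: "0 < e"
  obtains S g where "step_path S g" "(LBINT t:{0..<1}. \<bar>u t * g t - k t\<bar>) < e"
proof -
  define U where "U t = indicator {0..<1} t * u t" for t
  define k' where "k' t = indicator {0..<1} t * k t" for t
  have Ui: "integrable lborel U" "integrable lborel k'"
    using u(1) k(1) unfolding set_integrable_def U_def[abs_def] k'_def[abs_def] by simp_all
  have U0: "0 \<le> U t" for t using u(2) by (auto simp: U_def indicator_def)
  define M where "M = density lborel U"
  have sM: "sets M = sets borel" by (simp add: M_def)
  have [measurable]: "U \<in> borel_measurable borel" "k' \<in> borel_measurable borel"
    using Ui borel_measurable_integrable by fastforce+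
  have fM: "finite_measure M"
  proof
    have "emeasure M (space M) = (\<integral>\<^sup>+ t. ennreal (U t) \<partial>lborel)"
      unfolding M_def by (subst emeasure_density) auto
    also have "\<dots> = ennreal (integral\<^sup>L lborel U)" by (rule nn_integral_eq_integral[OF Ui(1)]) (simp add: U0)
    finally show "emeasure M (space M) \<noteq> \<infinity>" by simp
  qed
  have Uk: "U t * (k' t / U t) = k' t" for t
    using k(2)[of t] by (auto simp: U_def k'_def indicator_def)
  have "integrable M (\<lambda>t. k' t / U t)"
    unfolding M_def by (subst integrable_density) (simp_all only: real_scaleR_def Uk Ui(2), auto simp: U0)
  from approximable_integrable[OF fM sM this] e obtain S g
    where g: "step_path S g" "(LINT t|M. \<bar>g t - k' t / U t\<bar>) < e"
    unfolding approximable_def[OF fM sM] by blast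
  have [measurable]: "g \<in> borel_measurable borel" using g(1) by (simp add: step_path_def)
  have "(LINT t|M. \<bar>g t - k' t / U t\<bar>) = (LBINT t. U t * \<bar>g t - k' t / U t\<bar>)"
    unfolding M_def by (subst integral_density) (auto simp: U0)
  also have "\<dots> = (LBINT t:{0..<1}. \<bar>u t * g t - k t\<bar>)"
    unfolding set_lebesgue_integral_def
  proof (rule Bochner_Integration.integral_cong[OF refl])
    fix t
    have "U t * \<bar>g t - k' t / U t\<bar> = \<bar>U t * (g t - k' t / U t)\<bar>"
      using U0[of t] by (simp add: abs_mult)
    also have "\<dots> = \<bar>U t * g t - k' t\<bar>" using Uk[of t] by (simp add: right_diff_distrib)
    also have "\<dots> = indicator {0..<1} t *\<^sub>R \<bar>u t * g t - k t\<bar>"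
      by (auto simp: U_def k'_def indicator_def)
    finally show "U t * \<bar>g t - k' t / U t\<bar> = indicator {0..<1} t *\<^sub>R \<bar>u t * g t - k t\<bar>" .
  qed
  finally show ?thesis using that g by simp
qed

subsection \<open>Step data and grid values\<close>

fun step_list :: "(real \<Rightarrow> real) \<Rightarrow> real \<Rightarrow> real list \<Rightarrow> (real \<times> real) list" where
  "step_list g u [] = []"
| "step_list g u (t # ts) = (g u, t) # step_list g t ts"

lemma map_snd_step_list [simp]: "map snd (step_list g u ts) = ts"
  by (induction ts arbitrary: u) auto

lemma step_fun_step_list:
  assumes "grid u ts" "step_on S g" "S \<inter> {u<..} \<subseteq> set ts" "u \<le> s" "s < last (u # ts)"
  shows "step_fun (step_list g u ts) s = g s"
  using assms(1,3-)
proof (induction ts arbitrary: u)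
  case (Cons t ts)
  note gr = grid_Cons[OF Cons.prems(1)]
  show ?case
  proof (cases "s < t")
    case True
    have "S \<inter> {u<..s} = {}"
    proof (rule ccontr)
      assume "S \<inter> {u<..s} \<noteq> {}"
      then obtain r where r: "r \<in> S" "u < r" "r \<le> s" by auto
      then have "r \<in> set (t # ts)" using Cons.prems(2) by auto
      then have "t \<le> r" using Cons.prems(1) by auto
      then show False using r True by simp
    qed
    then have "g u = g s"
      using assms(2) gr True Cons.prems(3) unfolding step_on_def by auto
    then show ?thesis using True by simp
  next
    case False
    have "step_fun (step_list g t ts) s = g s"
      using gr False Cons.prems by (intro Cons.IH) (auto split: if_splits)
    then show ?thesis using False by simp
  qed
qed simp

lemma last_sorted_list:
  assumes "finite S" "S \<subseteq> {0<..<1}"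
  shows "sorted_list_of_set (insert 1 S) \<noteq> []" "last (sorted_list_of_set (insert 1 S)) = (1::real)"
proof -
  let ?ts = "sorted_list_of_set (insert 1 S)"
  have fin: "finite (insert 1 S)" using assms by simp
  have set: "set ?ts = insert 1 S" by (rule set_sorted_list_of_set[OF fin])
  show ne: "?ts \<noteq> []" using set by auto
  have "1 \<le> last ?ts" by (rule sorted_le_last) (use set in auto)
  moreover have "last ?ts \<in> insert 1 S" using last_in_set[OF ne] set by auto
  ultimately show "last ?ts = 1" using assms(2) by auto
qed

lemma step_list_data:
  assumes "finite S" "S \<subseteq> {0<..<1}" "\<And>s. s \<in> {0..<1} \<Longrightarrow> 0 \<le> g s"
  shows "step_list g 0 (sorted_list_of_set (insert 1 S)) \<in> step_data"
proof -
  let ?ts = "sorted_list_of_set (insert 1 S)"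
  have gr: "grid 0 ?ts" by (rule grid_sorted_list[OF assms(1,2)])
  note ne = last_sorted_list(1)[OF assms(1,2)] and l = last_sorted_list(2)[OF assms(1,2)]
  have nn: "0 \<le> fst p" if "p \<in> set (step_list g u ts)" "grid u ts" for p u and ts :: "real list"
    using that assms(3) by (induction ts arbitrary: u) auto
  have nil: "step_list g u ts \<noteq> []" if "ts \<noteq> []" for u and ts :: "real list" using that by (cases ts) auto
  have "snd (last (step_list g 0 ?ts)) = last (map snd (step_list g 0 ?ts))"
    by (rule last_map[OF nil[OF ne], symmetric])
  then have "snd (last (step_list g 0 ?ts)) = 1" using l by simp
  moreover have "\<forall>(a, t)\<in>set (step_list g 0 ?ts). 0 \<le> a" using nn[OF _ gr] by fastforce
  ultimately show ?thesis
    unfolding step_data_def mem_Collect_eq map_snd_step_list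
    using nil[OF ne, of 0] gr by blast
qed

lemma step_fun_const_on:
  assumes "0 \<le> s" "s \<le> t" "set (map snd ps) \<inter> {s<..t} = {}"
  shows "step_fun ps s = step_fun ps t"
  using assms(3)
proof (induction ps)
  case (Cons p ps)
  have "snd p \<notin> {s<..t}" using Cons.prems by auto
  then have "s < snd p \<longleftrightarrow> t < snd p" using assms(2) by auto
  then show ?case using Cons by auto
qed simp

lemma step_fun_bound: "\<exists>B. \<forall>t. \<bar>step_fun ps t\<bar> \<le> B"
proof (induction ps)
  case Nil
  show ?case by (rule exI[of _ 0]) simp
next
  case (Cons p ps)
  then obtain B where "\<And>t. \<bar>step_fun ps t\<bar> \<le> B" by blast
  then have "\<bar>step_fun (p # ps) t\<bar> \<le> max \<bar>fst p\<bar> B" for t by (simp add: le_max_iff_disj)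
  then show ?case by blast
qed

lemma step_fun_measurable: "step_fun ps \<in> borel_measurable borel"
proof (induction ps)
  case (Cons p ps)
  have [measurable]: "step_fun ps \<in> borel_measurable borel" by (rule Cons)
  show ?case unfolding step_fun.simps by measurable
qed simp

lemma step_data_snd:
  assumes "ps \<in> step_data"
  shows "set (map snd ps) \<subseteq> {0<..1}" "1 \<in> set (map snd ps)" "sorted_wrt (<) (0 # map snd ps)"
proof -
  have s: "sorted_wrt (<) (0 # map snd ps)" "ps \<noteq> []" "snd (last ps) = 1"
    using assms by (auto simp: step_data_def)
  have l: "last (map snd ps) = 1" using s by (simp add: last_map)
  then show "1 \<in> set (map snd ps)" using s(2) last_in_set[of "map snd ps"] by auto
  have "sorted (map snd ps)" using s(1) strict_sorted_imp_sorted by auto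
  then have "x \<le> 1" if "x \<in> set (map snd ps)" for x using sorted_le_last[OF _ that] l by auto
  moreover have "0 < x" if "x \<in> set (map snd ps)" for x using s(1) that by auto
  ultimately show "set (map snd ps) \<subseteq> {0<..1}" by (meson greaterThanAtMost_iff subsetI)
  show "sorted_wrt (<) (0 # map snd ps)" by fact
qed

lemma step_path_step_fun:
  assumes "ps \<in> step_data"
  shows "step_path (set (map snd ps) - {1}) (step_fun ps)"
  unfolding step_path_def step_on_def
proof (intro conjI allI impI)
  fix s t :: real assume st: "0 \<le> s \<and> s \<le> t \<and> t < 1 \<and> (set (map snd ps) - {1}) \<inter> {s<..t} = {}"
  then show "step_fun ps s = step_fun ps t" by (intro step_fun_const_on) auto
qed (use step_data_snd(1)[OF assms] step_fun_measurable step_fun_bound in auto)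

lemma step_fun_nonneg:
  assumes "ps \<in> step_data"
  shows "0 \<le> step_fun ps s"
proof -
  have "\<forall>p\<in>set ps. 0 \<le> fst p" using assms by (auto simp: step_data_def split_beta)
  then show ?thesis by (induction ps) auto
qed

text \<open>The recursion takes the parameter from the list entry, \<open>flow\<close> from the
  function; dropping the first entry does not change \<open>step_fun\<close> from that entry's time
  on, so \<open>flow_cong\<close> applies.\<close>

lemma Phi_step_flow:
  assumes "sorted_wrt (<) (u # map snd ps)"
  shows "Phi_step \<xi> ps u = flow (deriv \<xi>) (step_fun ps) u (map snd ps) abs"
  using assms
proof (induction ps arbitrary: u)
  case (Cons p ps)
  have "Phi_step \<xi> ps (snd p) = flow (deriv \<xi>) (step_fun ps) (snd p) (map snd ps) abs"
    using Cons by simp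
  also have "\<dots> = flow (deriv \<xi>) (step_fun (p # ps)) (snd p) (map snd ps) abs"
  proof (rule flow_cong)
    fix s assume "s \<in> set (butlast (snd p # map snd ps))"
    then have "s \<in> set (snd p # map snd ps)" by (rule in_set_butlastD)
    then have "snd p \<le> s" using Cons.prems by auto
    then show "step_fun ps s = step_fun (p # ps) s" by simp
  qed
  finally have eq: "Phi_step \<xi> ps (snd p) = flow (deriv \<xi>) (step_fun (p # ps)) (snd p) (map snd ps) abs" .
  have "step_fun (p # ps) u = fst p" using Cons.prems by simp
  then show ?case
    by (intro ext) (use Cons.prems in \<open>simp add: eq del: step_fun.simps\<close>)
qed auto

lemma Phi_step_grid_value:
  assumes "ps \<in> step_data"
  shows "Phi_step \<xi> ps 0 0 = grid_value (deriv \<xi>) (set (map snd ps) - {1}) (step_fun ps)"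
proof -
  note s = step_data_snd[OF assms]
  have "insert 1 (set (map snd ps) - {1}) = set (map snd ps)" using s(2) by auto
  moreover have "sorted_list_of_set (set (map snd ps)) = map snd ps"
    by (rule sorted_list_of_set.idem_if_sorted_distinct) (use s(3) in \<open>simp_all add: strict_sorted_iff\<close>)
  ultimately show ?thesis
    unfolding grid_value_def Phi_step_flow[OF s(3)] by simp
qed

text \<open>The analysis of the Parisi functional uses the mixture only through these properties.
  For a mixture the derivative is two-sided even at 1 because the defining series converges beyond
  1.\<close>

locale smooth_mixture =
  fixes \<xi> :: "real \<Rightarrow> real"
  assumes deriv2: "\<And>t. t \<in> {0..1} \<Longrightarrow> (deriv \<xi> has_real_derivative deriv (deriv \<xi>) t) (at t)"
    and cont2: "continuous_on {0..1} (deriv (deriv \<xi>))"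
    and nonneg2: "\<And>t. t \<in> {0..1} \<Longrightarrow> 0 \<le> deriv (deriv \<xi>) t"
begin

abbreviation d :: "real \<Rightarrow> real" where "d \<equiv> deriv \<xi>"
abbreviation w :: "real \<Rightarrow> real" where "w \<equiv> deriv (deriv \<xi>)"

lemma d_mono: "mono_on {0..1} d"
proof (rule mono_onI)
  fix r s :: real assume rs: "r \<in> {0..1}" "s \<in> {0..1}" "r \<le> s"
  show "d r \<le> d s"
  proof (rule DERIV_nonneg_imp_nondecreasing[OF rs(3)])
    fix x assume "r \<le> x" "x \<le> s"
    then have "x \<in> {0..1}" using rs by auto
    then show "\<exists>y. (d has_real_derivative y) (at x) \<and> 0 \<le> y" using deriv2 nonneg2 by blast
  qed
qed

lemma w_integral:
  assumes "0 \<le> a" "a \<le> b" "b \<le> 1"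
  shows "set_integrable lborel {a..<b} w" "(LBINT t:{a..<b}. w t) = d b - d a"
proof -
  have "has_bochner_integral lborel (\<lambda>x. indicator {a..b} x *\<^sub>R w x) (d b - d a)"
  proof (rule has_bochner_integral_FTC_Icc)
    show "(d has_vector_derivative w x) (at x within {a..b})" if "a \<le> x" "x \<le> b" for x
      using deriv2[of x] that assms
      by (auto simp: has_real_derivative_iff_has_vector_derivative intro: has_vector_derivative_at_within)
    show "continuous_on {a..b} w" using cont2 assms by (auto intro: continuous_on_subset)
  qed (use assms in simp)
  then have c: "set_integrable lborel {a..b} w" "(LBINT t:{a..b}. w t) = d b - d a"
    by (auto simp: has_bochner_integral_iff set_integrable_def set_lebesgue_integral_def)
  show i: "set_integrable lborel {a..<b} w" by (rule set_integrable_subset[OF c(1)]) auto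
  have "(LBINT t:{a..<b}. w t) = (LBINT t:{a..b}. w t)"
    unfolding set_lebesgue_integral_def
  proof (rule integral_cong_AE)
    show "(\<lambda>x. indicator {a..<b} x *\<^sub>R w x) \<in> borel_measurable lborel"
      using i unfolding set_integrable_def by (rule borel_measurable_integrable)
    show "(\<lambda>x. indicator {a..b} x *\<^sub>R w x) \<in> borel_measurable lborel"
      using c(1) unfolding set_integrable_def by (rule borel_measurable_integrable)
    show "AE x in lborel. indicator {a..<b} x *\<^sub>R w x = indicator {a..b} x *\<^sub>R w x"
      using AE_lborel_singleton[of b] by eventually_elim (auto simp: indicator_def)
  qed
  then show "(LBINT t:{a..<b}. w t) = d b - d a" using c(2) by simp
qed

text \<open>On each cell \<open>h\<close> is constant and the fundamental theorem of calculus
  integrates the weight, so the sum is exact.\<close>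

lemma weighted_sum_integral:
  assumes "grid u ts" "step_on S h" "S \<inter> {u<..} \<subseteq> set ts"
  shows "set_integrable lborel {u..<last (u # ts)} (\<lambda>t. w t * h t)
    \<and> weighted_sum d h u ts = (LBINT t:{u..<last (u # ts)}. w t * h t)"
  using assms(1,3)
proof (induction ts arbitrary: u)
  case Nil
  show ?case by (simp add: set_integrable_def set_lebesgue_integral_def)
next
  case (Cons t ts)
  note gr = grid_Cons[OF Cons.prems(1)]
  let ?l = "last (t # ts)"
  have IH: "set_integrable lborel {t..<?l} (\<lambda>t. w t * h t)"
    "weighted_sum d h t ts = (LBINT t:{t..<?l}. w t * h t)"
  proof -
    have "S \<inter> {t<..} \<subseteq> set ts" using Cons.prems(2) gr by auto
    moreover have "grid t ts" using gr by blast
    ultimately show "set_integrable lborel {t..<?l} (\<lambda>t. w t * h t)"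
      "weighted_sum d h t ts = (LBINT t:{t..<?l}. w t * h t)"
      using Cons.IH[of t] by blast+
  qed
  have tl: "t \<le> ?l" using Cons.prems(1) by (intro sorted_le_last strict_sorted_imp_sorted) auto
  have hu: "w s * h s = w s * h u" if "s \<in> {u..<t}" for s
  proof -
    have "S \<inter> {u<..s} = {}"
    proof (rule ccontr)
      assume "S \<inter> {u<..s} \<noteq> {}"
      then obtain r where r: "r \<in> S" "u < r" "r \<le> s" by auto
      then have "r \<in> set (t # ts)" using Cons.prems(2) by auto
      then have "t \<le> r" using Cons.prems(1) by auto
      then show False using r that by simp
    qed
    then have "h u = h s"
      using assms(2) gr that unfolding step_on_def by auto
    then show ?thesis by simp
  qed
  have ut: "0 \<le> u" "u \<le> t" "t \<le> 1" using gr by auto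
  have "set_integrable lborel {u..<t} (\<lambda>s. w s * h u)"
    by (rule set_integrable_mult_left) (use w_integral(1)[OF ut] in simp)
  then have i1: "set_integrable lborel {u..<t} (\<lambda>s. w s * h s)"
    by (subst set_integrable_cong[OF refl refl hu]) 
  have "(LBINT s:{u..<t}. w s * h s) = (LBINT s:{u..<t}. w s * h u)"
    by (rule set_lebesgue_integral_cong) (auto simp: hu)
  also have "\<dots> = (d t - d u) * h u" using w_integral(2)[OF ut] by simp
  finally have i2: "(LBINT s:{u..<t}. w s * h s) = (d t - d u) * h u" .
  have un: "{u..<?l} = {u..<t} \<union> {t..<?l}" using ut tl by auto
  have "set_integrable lborel {u..<?l} (\<lambda>t. w t * h t)"
    unfolding un by (rule set_integrable_Un[OF i1 IH(1)]) auto
  moreover have "(LBINT t:{u..<?l}. w t * h t) = (d t - d u) * h u + weighted_sum d h t ts"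
    unfolding un by (subst set_integral_Un[OF _ i1 IH(1)]) (auto simp: i2 IH(2))
  ultimately show ?case by simp
qed

end

subsection \<open>The Parisi functional on integrable order parameters\<close>

context smooth_mixture
begin

text \<open>The L1 distance with weight \<xi>'' that appears in \<open>step_approx\<close>. It is
  meaningful for \<open>w_integrable\<close> arguments only, since a non-integrable integrand has
  integral 0.\<close>

definition wdist :: "(real \<Rightarrow> real) \<Rightarrow> (real \<Rightarrow> real) \<Rightarrow> real" where
  "wdist g h = (LBINT t:{0..<1}. w t * \<bar>g t - h t\<bar>)"

definition w_integrable :: "(real \<Rightarrow> real) \<Rightarrow> bool" where
  "w_integrable g \<longleftrightarrow> set_integrable lborel {0..<1} (\<lambda>t. w t * g t)"

text \<open>A common superset of \<open>U_paths\<close> and \<open>L_paths \<xi>\<close>, on which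
  optimality is proved.\<close>

definition admissible :: "(real \<Rightarrow> real) \<Rightarrow> bool" where
  "admissible \<gamma> \<longleftrightarrow> (\<forall>t\<in>{0..<1}. 0 \<le> \<gamma> t) \<and> w_integrable \<gamma>"

lemma w_integrable_add: "w_integrable g \<Longrightarrow> w_integrable h \<Longrightarrow> w_integrable (\<lambda>t. g t + h t)"
  unfolding w_integrable_def distrib_left by (rule set_integral_add)

lemma w_integrable_cmult: "w_integrable g \<Longrightarrow> w_integrable (\<lambda>t. c * g t)"
  unfolding w_integrable_def mult.left_commute[of _ c] by (rule set_integrable_mult_right) simp

lemma w_integrable_mult_bounded:
  assumes g: "w_integrable g" and h: "h \<in> borel_measurable borel" "\<And>t. \<bar>h t\<bar> \<le> B"
  shows "w_integrable (\<lambda>t. g t * h t)"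
proof -
  have i: "integrable lborel (\<lambda>t. indicator {0..<1} t *\<^sub>R (w t * g t))"
    using g by (simp add: w_integrable_def set_integrable_def)
  have [measurable]: "h \<in> borel_measurable borel" by fact
  have "integrable lborel (\<lambda>t. indicator {0..<1} t *\<^sub>R (w t * g t) * h t)"
  proof (rule Bochner_Integration.integrable_bound[OF integrable_mult_right[OF i, of B]])
    show "(\<lambda>t. indicator {0..<1} t *\<^sub>R (w t * g t) * h t) \<in> borel_measurable lborel"
      using borel_measurable_integrable[OF i] by (rule borel_measurable_times) simp
    have "\<bar>x * h t\<bar> \<le> \<bar>B * x\<bar>" for x t
    proof -
      have "\<bar>x\<bar> * \<bar>h t\<bar> \<le> \<bar>x\<bar> * \<bar>B\<bar>" using h(2)[of t] by (intro mult_left_mono) auto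
      then show ?thesis by (simp add: abs_mult mult.commute)
    qed
    then show "AE t in lborel. norm (indicator {0..<1} t *\<^sub>R (w t * g t) * h t)
        \<le> norm (B * (indicator {0..<1} t *\<^sub>R (w t * g t)))" by (intro AE_I2) (simp only: real_norm_def)
  qed
  then show ?thesis by (simp add: w_integrable_def set_integrable_def mult.assoc)
qed

lemma w_integrable_one: "w_integrable (\<lambda>_. 1)"
  using w_integral(1)[of 0 1] by (simp add: w_integrable_def)

lemma w_integrable_step:
  assumes "step_path S g"
  shows "w_integrable g"
proof -
  obtain B where "\<And>t. \<bar>g t\<bar> \<le> B" "g \<in> borel_measurable borel" using assms unfolding step_path_def by blast
  then show ?thesis using w_integrable_mult_bounded[OF w_integrable_one, of g B] by simp
qed

lemma wdist_eq:
  shows "wdist g h = (LBINT t:{0..<1}. \<bar>w t * g t - w t * h t\<bar>)"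
  unfolding wdist_def
proof (rule set_lebesgue_integral_cong)
  show "\<forall>t. t \<in> {0..<1} \<longrightarrow> w t * \<bar>g t - h t\<bar> = \<bar>w t * g t - w t * h t\<bar>"
    using nonneg2 by (auto simp: abs_mult right_diff_distrib[symmetric])
qed simp

lemma wdist_integrable:
  assumes "w_integrable g" "w_integrable h"
  shows "set_integrable lborel {0..<1} (\<lambda>t. w t * \<bar>g t - h t\<bar>)"
proof -
  have "set_integrable lborel {0..<1} (\<lambda>t. \<bar>w t * g t - w t * h t\<bar>)"
    using assms unfolding w_integrable_def by (intro set_integrable_abs set_integral_diff)
  moreover have "w t * \<bar>g t - h t\<bar> = \<bar>w t * g t - w t * h t\<bar>" if "t \<in> {0..<1}" for t
    using nonneg2 that by (auto simp: abs_mult right_diff_distrib[symmetric])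
  ultimately show ?thesis by (subst set_integrable_cong) (auto simp del: abs_mult)
qed

lemma wdist_nonneg: "0 \<le> wdist g h"
  unfolding wdist_eq set_lebesgue_integral_def by (rule Bochner_Integration.integral_nonneg) simp

lemma wdist_mono:
  assumes "w_integrable g" "w_integrable h" "w_integrable g'" "w_integrable h'"
    and "\<And>t. t \<in> {0..<1} \<Longrightarrow> \<bar>g t - h t\<bar> \<le> \<bar>g' t - h' t\<bar>"
  shows "wdist g h \<le> wdist g' h'"
  unfolding wdist_def
  by (rule set_integral_mono[OF wdist_integrable wdist_integrable])
    (use assms nonneg2 in \<open>auto intro!: mult_left_mono\<close>)

lemma wdist_le_comb:
  assumes "w_integrable g" "w_integrable h" "w_integrable g1" "w_integrable h1" "w_integrable g2" "w_integrable h2"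
    and "\<And>t. t \<in> {0..<1} \<Longrightarrow> \<bar>g t - h t\<bar> \<le> p * \<bar>g1 t - h1 t\<bar> + q * \<bar>g2 t - h2 t\<bar>"
  shows "wdist g h \<le> p * wdist g1 h1 + q * wdist g2 h2"
proof -
  note i = wdist_integrable[OF assms(3,4)] wdist_integrable[OF assms(5,6)]
  have j: "set_integrable lborel {0..<1} (\<lambda>t. p * (w t * \<bar>g1 t - h1 t\<bar>))"
    "set_integrable lborel {0..<1} (\<lambda>t. q * (w t * \<bar>g2 t - h2 t\<bar>))"
    using i by (auto intro!: set_integrable_mult_right)
  have "wdist g h \<le> (LBINT t:{0..<1}. p * (w t * \<bar>g1 t - h1 t\<bar>) + q * (w t * \<bar>g2 t - h2 t\<bar>))"
    unfolding wdist_def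
  proof (rule set_integral_mono[OF wdist_integrable[OF assms(1,2)] set_integral_add(1)[OF j]])
    fix t :: real assume t: "t \<in> {0..<1}"
    have "w t * \<bar>g t - h t\<bar> \<le> w t * (p * \<bar>g1 t - h1 t\<bar> + q * \<bar>g2 t - h2 t\<bar>)"
      using assms(7)[OF t] nonneg2[of t] t by (intro mult_left_mono) auto
    then show "w t * \<bar>g t - h t\<bar> \<le> p * (w t * \<bar>g1 t - h1 t\<bar>) + q * (w t * \<bar>g2 t - h2 t\<bar>)"
      by (simp add: algebra_simps)
  qed
  also have "\<dots> = p * wdist g1 h1 + q * wdist g2 h2"
    unfolding wdist_def by (subst set_integral_add(2)[OF j]) simp
  finally show ?thesis .
qed

lemma wdist_triangle:
  assumes "w_integrable g" "w_integrable h" "w_integrable k"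
  shows "wdist g h \<le> wdist g k + wdist h k"
  using wdist_le_comb[OF assms(1,2,1,3,2,3), of 1 1] by (simp add: abs_minus_commute)

text \<open>On the common refinement \<open>flow_param_lip\<close> applies, and its weighted sum is
  the exact integral because |g - h| is constant on the cells.\<close>

lemma grid_value_lip:
  assumes g: "step_path S g" "\<And>t. t \<in> {0..<1} \<Longrightarrow> 0 \<le> g t" and h: "step_path T h" "\<And>t. t \<in> {0..<1} \<Longrightarrow> 0 \<le> h t"
  shows "\<bar>grid_value d S g - grid_value d T h\<bar> \<le> wdist g h / 2"
proof -
  have fS: "finite S" "S \<subseteq> {0<..<1}" "step_on S g" and fT: "finite T" "T \<subseteq> {0<..<1}" "step_on T h"
    using g(1) h(1) by (auto simp: step_path_def)
  let ?ts = "sorted_list_of_set (insert 1 (S \<union> T))"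
  have f: "finite (S \<union> T)" "S \<union> T \<subseteq> {0<..<1}" using fS fT by auto
  have gr: "grid 0 ?ts" by (rule grid_sorted_list[OF f])
  have sp: "step_path (S \<union> T) (\<lambda>t. \<bar>g t - h t\<bar>)"
  proof -
    have "step_path ((S \<union> T) \<union> (T \<union> S)) (\<lambda>t. max (g t - h t) (h t - g t))"
      by (intro step_path_max step_path_diff g h)
    moreover have "(\<lambda>t. max (g t - h t) (h t - g t)) = (\<lambda>t. \<bar>g t - h t\<bar>)" by auto
    ultimately show ?thesis by (simp add: Un_commute)
  qed
  have ws: "weighted_sum d (\<lambda>t. \<bar>g t - h t\<bar>) 0 ?ts = wdist g h"
  proof -
    have "(S \<union> T) \<inter> {0<..} \<subseteq> set ?ts" using f by (subst set_sorted_list_of_set) auto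
    moreover have "step_on (S \<union> T) (\<lambda>t. \<bar>g t - h t\<bar>)" using sp by (simp add: step_path_def)
    moreover have "last (0 # ?ts) = 1" using last_sorted_list[OF f] by simp
    ultimately show ?thesis using weighted_sum_integral[OF gr, of "S \<union> T"] by (simp only: wdist_def)
  qed
  have e: "grid_value d S g = flow d g 0 ?ts abs 0" "grid_value d T h = flow d h 0 ?ts abs 0"
    using grid_value_mono[OF fS(1,2) fT(1,2) d_mono g(2) fS(3)] grid_value_mono[OF fT(1,2) fS(1,2) d_mono h(2) fT(3)]
    by (auto simp: grid_value_def Un_commute)
  have "flow d g 0 ?ts abs 0 \<le> flow d h 0 ?ts abs 0 + weighted_sum d (\<lambda>t. \<bar>g t - h t\<bar>) 0 ?ts / 2"
    by (rule flow_param_lip[OF abs_lip abs_convex gr d_mono g(2) h(2)])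
  moreover have "flow d h 0 ?ts abs 0 \<le> flow d g 0 ?ts abs 0 + weighted_sum d (\<lambda>t. \<bar>h t - g t\<bar>) 0 ?ts / 2"
    by (rule flow_param_lip[OF abs_lip abs_convex gr d_mono h(2) g(2)])
  ultimately show ?thesis
    unfolding e abs_minus_commute[of "h _"] ws by linarith
qed

lemma grid_value_convex:
  assumes g: "step_path S g" "\<And>t. t \<in> {0..<1} \<Longrightarrow> 0 \<le> g t" and h: "step_path T h" "\<And>t. t \<in> {0..<1} \<Longrightarrow> 0 \<le> h t"
    and \<theta>: "0 \<le> \<theta>" "\<theta> \<le> 1"
  shows "grid_value d (S \<union> T) (\<lambda>t. \<theta> * g t + (1 - \<theta>) * h t)
    \<le> \<theta> * grid_value d S g + (1 - \<theta>) * grid_value d T h"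
proof -
  have fS: "finite S" "S \<subseteq> {0<..<1}" "step_on S g" and fT: "finite T" "T \<subseteq> {0<..<1}" "step_on T h"
    using g(1) h(1) by (auto simp: step_path_def)
  have f: "finite (S \<union> T)" "S \<union> T \<subseteq> {0<..<1}" using fS fT by auto
  have e: "grid_value d S g = grid_value d (S \<union> T) g" "grid_value d T h = grid_value d (S \<union> T) h"
    using grid_value_mono[OF fS(1,2) fT(1,2) d_mono g(2) fS(3)] grid_value_mono[OF fT(1,2) fS(1,2) d_mono h(2) fT(3)]
    by (auto simp: Un_commute)
  have "grid_value d (S \<union> T) (\<lambda>t. \<theta> * g t + (1 - \<theta>) * h t)
    = flow d (\<lambda>t. \<theta> * g t + (1 - \<theta>) * h t) 0 (sorted_list_of_set (insert 1 (S \<union> T))) abs (\<theta> * 0 + (1 - \<theta>) * 0)"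
    by (simp add: grid_value_def)
  also have "\<dots> \<le> \<theta> * grid_value d (S \<union> T) g + (1 - \<theta>) * grid_value d (S \<union> T) h"
    unfolding grid_value_def
    by (rule flow_joint_convex[OF abs_lip abs_convex grid_sorted_list[OF f] d_mono g(2) h(2) \<theta>])
  finally show ?thesis unfolding e .
qed

text \<open>The perturbation does not touch times from \<tau> on, so the flow on [\<tau>,1] is a
  fixed nonnegative 1-Lipschitz datum at time \<tau>; before \<tau> the perturbation is a pure
  scaling and \<open>flow_scaling_smooth\<close> applies.\<close>

lemma grid_value_smooth:
  assumes g: "step_path S g" "\<And>t. t \<in> {0..<1} \<Longrightarrow> 0 \<le> g t" and \<tau>: "0 < \<tau>" "\<tau> < 1"
    and A: "0 < A" "\<And>t. 0 \<le> t \<Longrightarrow> t < \<tau> \<Longrightarrow> g t \<le> A" and s: "0 \<le> s" "s \<le> 1 / 2"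
  shows "grid_value d (insert \<tau> S) (\<lambda>t. g t * (1 + s * (if t < \<tau> then 1 else 0)))
      + grid_value d (insert \<tau> S) (\<lambda>t. g t * (1 - s * (if t < \<tau> then 1 else 0)))
      - 2 * grid_value d S g
    \<le> s\<^sup>2 * (4 * exp (3 / 2 * A\<^sup>2 * (d \<tau> - d 0)) / A + 4 * grid_value d S g)"
proof -
  have fS: "finite S" "S \<subseteq> {0<..<1}" "step_on S g" using g(1) by (auto simp: step_path_def)
  let ?xs = "sorted_list_of_set (insert 1 (insert \<tau> S))"
  have f: "finite (insert \<tau> S)" "insert \<tau> S \<subseteq> {0<..<1}" using fS \<tau> by auto
  have gr: "grid 0 ?xs" by (rule grid_sorted_list[OF f])
  have "\<tau> \<in> set ?xs" using f(1) by (subst set_sorted_list_of_set) auto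
  then obtain ys zs where xs: "?xs = ys @ \<tau> # zs" by (meson split_list)
  have so: "sorted_wrt (<) ((0 # ys) @ (\<tau> # zs))" and se: "set ((0 # ys) @ (\<tau> # zs)) \<subseteq> {0..1}"
    using gr unfolding xs by simp_all
  have parts: "sorted_wrt (<) (0 # ys)" "sorted_wrt (<) (\<tau> # zs)" "\<forall>x\<in>set (0 # ys). \<forall>y\<in>set (\<tau> # zs). x < y"
    using so unfolding sorted_wrt_append by blast+
  have ys: "r < \<tau>" if "r \<in> set (0 # ys)" for r using bspec[OF bspec[OF parts(3) that], of \<tau>] by simp
  have zs: "\<tau> < r" if "r \<in> set zs" for r using parts(2) that by simp
  have "sorted_wrt (<) ((0 # ys) @ [\<tau>])"
    unfolding sorted_wrt_append using parts(1) ys by simp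
  then have gr1: "grid 0 (ys @ [\<tau>])" using se by simp
  have gr2: "grid \<tau> zs" using parts(2) se by simp
  define f where "f = flow d g \<tau> zs abs"
  have fl: "1-lipschitz_on UNIV f" unfolding f_def by (rule flow_lip[OF abs_lip gr2 g(2)])
  have f0: "0 \<le> f y" for y unfolding f_def by (rule flow_nonneg[OF abs_lip gr2 g(2)]) auto
  have split: "grid_value d (insert \<tau> S) (\<lambda>t. g t * (1 + c * (if t < \<tau> then 1 else 0)))
      = flow d (\<lambda>t. (1 + c) * g t) 0 (ys @ [\<tau>]) f 0" for c
  proof -
    let ?h = "\<lambda>t. g t * (1 + c * (if t < \<tau> then 1 else 0))"
    have "grid_value d (insert \<tau> S) ?h = flow d ?h 0 ((ys @ [\<tau>]) @ zs) abs 0"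
      by (simp add: grid_value_def xs del: sorted_list_of_set_insert_remove)
    also have "\<dots> = flow d ?h 0 (ys @ [\<tau>]) (flow d ?h \<tau> zs abs) 0"
      unfolding flow_append[of d ?h 0 "ys @ [\<tau>]" zs abs] by simp
    also have "flow d ?h \<tau> zs abs = f"
      unfolding f_def
    proof (rule flow_cong)
      fix r assume "r \<in> set (butlast (\<tau> # zs))"
      then have "r \<in> set (\<tau> # zs)" by (rule in_set_butlastD)
      then have "\<tau> \<le> r" using zs[of r] by auto
      then show "?h r = g r" by simp
    qed
    also have "flow d ?h 0 (ys @ [\<tau>]) f = flow d (\<lambda>t. (1 + c) * g t) 0 (ys @ [\<tau>]) f"
    proof (rule flow_cong)
      fix r assume "r \<in> set (butlast (0 # ys @ [\<tau>]))"
      then have "r \<in> set (0 # ys)" by (simp add: butlast_append)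
      then have "r < \<tau>" by (rule ys)
      then show "?h r = (1 + c) * g r" by simp
    qed
    finally show ?thesis .
  qed
  have base: "grid_value d S g = flow d g 0 (ys @ [\<tau>]) f 0"
    using split[of 0] grid_value_insert[OF fS(1,2) d_mono g(2) fS(3), of \<tau>] \<tau> by simp
  have gA: "g r \<le> A" if "r \<in> set (butlast (0 # ys @ [\<tau>]))" for r
  proof -
    have r: "r \<in> set (0 # ys)" using that by (simp add: butlast_append)
    then have "0 \<le> r" using se by auto
    then show ?thesis using ys[OF r] by (rule A(2))
  qed
  have "flow d (\<lambda>t. (1 + s) * g t) 0 (ys @ [\<tau>]) f 0 + flow d (\<lambda>t. (1 - s) * g t) 0 (ys @ [\<tau>]) f 0
      - 2 * flow d g 0 (ys @ [\<tau>]) f 0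
    \<le> s\<^sup>2 * (4 * exp (3 / 2 * A\<^sup>2 * (d (last (0 # ys @ [\<tau>])) - d 0)) / A + 4 * flow d g 0 (ys @ [\<tau>]) f 0)"
    by (rule flow_scaling_smooth[OF fl f0 gr1 d_mono g(2) gA A(1) s])
  then show ?thesis
    using split[of s] split[of "- s"] unfolding base by simp
qed

text \<open>Density supplies signed step functions; the positive part is again a step path and is no
  farther from a nonnegative \<gamma>.\<close>

lemma admissible_approx:
  assumes "admissible \<gamma>"
  obtains S g where "\<And>n. step_path (S n) (g n)" "\<And>n t. 0 \<le> g n t" "(\<lambda>n. wdist (g n) \<gamma>) \<longlonglongrightarrow> 0"
proof -
  have wi: "w_integrable \<gamma>" and nn: "\<And>t. t \<in> {0..<1} \<Longrightarrow> 0 \<le> \<gamma> t"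
    using assms by (auto simp: admissible_def)
  have "\<exists>S g. step_path S g \<and> (\<forall>t. 0 \<le> g t) \<and> wdist g \<gamma> < e" if e: "0 < e" for e
  proof -
    obtain S g where g: "step_path S g" "(LBINT t:{0..<1}. \<bar>w t * g t - w t * \<gamma> t\<bar>) < e"
      using step_path_dense[of w "\<lambda>t. w t * \<gamma> t" e] w_integral(1)[of 0 1] nonneg2 wi e
      unfolding w_integrable_def by auto
    let ?g = "\<lambda>t. max (g t) 0"
    have sp: "step_path S ?g" using step_path_max[OF g(1) step_path_const[of 0]] by simp
    have "wdist ?g \<gamma> \<le> wdist g \<gamma>"
      by (rule wdist_mono[OF w_integrable_step[OF sp] wi w_integrable_step[OF g(1)] wi])
        (use nn in \<open>auto simp: max_def\<close>)
    also have "\<dots> < e" using g(2) by (simp add: wdist_eq)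
    finally show ?thesis using sp by (intro exI[of _ S] exI[of _ ?g]) auto
  qed
  then have "\<forall>n. \<exists>S g. step_path S g \<and> (\<forall>t. 0 \<le> g t) \<and> wdist g \<gamma> < 1 / real (Suc n)" by simp
  then obtain S g where g: "\<And>n. step_path (S n) (g n)" "\<And>n t. 0 \<le> g n t" "\<And>n. wdist (g n) \<gamma> < 1 / real (Suc n)"
    by metis
  have "(\<lambda>n. wdist (g n) \<gamma>) \<longlonglongrightarrow> 0"
  proof (rule tendsto_sandwich[of "\<lambda>_. 0" _ _ "\<lambda>n. 1 / real (Suc n)"])
    show "(\<lambda>n. 1 / real (Suc n)) \<longlonglongrightarrow> 0" by (rule LIMSEQ_inverse_real_of_nat[unfolded inverse_eq_divide])
  qed (simp_all add: wdist_nonneg less_imp_le[OF g(3)] del: of_nat_Suc)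
  with g show ?thesis using that by blast
qed

lemma grid_value_cauchy:
  assumes adm: "admissible \<gamma>"
    and g: "\<And>n. step_path (S n) (g n)" "\<And>n t. t \<in> {0..<1} \<Longrightarrow> 0 \<le> g n t" "(\<lambda>n. wdist (g n) \<gamma>) \<longlonglongrightarrow> 0"
    and h: "\<And>n. step_path (T n) (h n)" "\<And>n t. t \<in> {0..<1} \<Longrightarrow> 0 \<le> h n t" "(\<lambda>n. wdist (h n) \<gamma>) \<longlonglongrightarrow> 0"
    and lim: "(\<lambda>n. grid_value d (S n) (g n)) \<longlonglongrightarrow> y"
  shows "(\<lambda>n. grid_value d (T n) (h n)) \<longlonglongrightarrow> y"
proof -
  have wi: "w_integrable \<gamma>" using adm by (simp add: admissible_def)
  have b: "norm (grid_value d (T n) (h n) - grid_value d (S n) (g n)) \<le> (wdist (h n) \<gamma> + wdist (g n) \<gamma>) / 2" for n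
  proof -
    have "norm (grid_value d (T n) (h n) - grid_value d (S n) (g n)) \<le> wdist (h n) (g n) / 2"
      unfolding real_norm_def by (rule grid_value_lip[OF h(1,2) g(1,2)])
    also have "\<dots> \<le> (wdist (h n) \<gamma> + wdist (g n) \<gamma>) / 2"
      by (intro divide_right_mono wdist_triangle w_integrable_step[OF h(1)] w_integrable_step[OF g(1)] wi) simp
    finally show ?thesis .
  qed
  have l: "(\<lambda>n. (wdist (h n) \<gamma> + wdist (g n) \<gamma>) / 2) \<longlonglongrightarrow> 0"
    using tendsto_divide[OF tendsto_add[OF h(3) g(3)] tendsto_const[of 2]] by simp
  have "(\<lambda>n. grid_value d (T n) (h n) - grid_value d (S n) (g n)) \<longlonglongrightarrow> 0"
    by (rule Lim_null_comparison[OF always_eventually[OF allI[OF b]] l])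
  from tendsto_add[OF this lim] show ?thesis by simp
qed

text \<open>The definite description in \<open>Phi\<close> needs two facts: all approximating
  sequences share one limit by the Lipschitz bound, and at least one such sequence exists, since
  otherwise every number would satisfy the description vacuously. The limit becomes available along
  arbitrary step paths instead of \<open>step_data\<close>.\<close>

lemma Phi_limit:
  assumes adm: "admissible \<gamma>"
    and g: "\<And>n. step_path (S n) (g n)" "\<And>n t. t \<in> {0..<1} \<Longrightarrow> 0 \<le> g n t" "(\<lambda>n. wdist (g n) \<gamma>) \<longlonglongrightarrow> 0"
  shows "(\<lambda>n. grid_value d (S n) (g n)) \<longlonglongrightarrow> Phi \<xi> \<gamma> 0 0"
proof -
  have wi: "w_integrable \<gamma>" using adm by (simp add: admissible_def)
  have "Cauchy (\<lambda>n. grid_value d (S n) (g n))"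
  proof (rule CauchyI)
    fix e :: real assume e: "0 < e"
    then obtain N where N: "\<And>n. N \<le> n \<Longrightarrow> wdist (g n) \<gamma> < e"
      using order_tendstoD(2)[OF g(3) e] unfolding eventually_sequentially by blast
    have "\<bar>grid_value d (S m) (g m) - grid_value d (S n) (g n)\<bar> < e" if "N \<le> m" "N \<le> n" for m n
    proof -
      have "\<bar>grid_value d (S m) (g m) - grid_value d (S n) (g n)\<bar> \<le> wdist (g m) (g n) / 2"
        by (rule grid_value_lip[OF g(1,2) g(1,2)])
      then show ?thesis using N[OF that(1)] N[OF that(2)]
        wdist_triangle[OF w_integrable_step[OF g(1)] w_integrable_step[OF g(1)] wi, of m n]
        by linarith
    qed
    then show "\<exists>N. \<forall>m\<ge>N. \<forall>n\<ge>N. norm (grid_value d (S m) (g m) - grid_value d (S n) (g n)) < e"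
      by auto
  qed
  then obtain y where y: "(\<lambda>n. grid_value d (S n) (g n)) \<longlonglongrightarrow> y"
    using Cauchy_convergent_iff convergent_def by blast
  have approx: "(\<lambda>n. Phi_step \<xi> (D n) 0 0) \<longlonglongrightarrow> y" if D: "step_approx \<xi> \<gamma> D" for D
  proof -
    have sd: "D n \<in> step_data" for n using D by (simp add: step_approx_def)
    have "(\<lambda>n. wdist (step_fun (D n)) \<gamma>) \<longlonglongrightarrow> 0" using D by (simp add: step_approx_def wdist_def)
    then show ?thesis
      unfolding Phi_step_grid_value[OF sd]
      by (intro grid_value_cauchy[OF adm g _ _ _ y] step_path_step_fun sd step_fun_nonneg)
  qed
  \<comment> \<open>The given step paths written as lists; this is the witness that an approximating
    sequence exists.\<close>
  define D where "D n = step_list (g n) 0 (sorted_list_of_set (insert 1 (S n)))" for n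
  have fS: "finite (S n)" "S n \<subseteq> {0<..<1}" "step_on (S n) (g n)" for n
    using g(1)[of n] by (auto simp: step_path_def)
  have sf: "step_fun (D n) t = g n t" if "t \<in> {0..<1}" for n t
    unfolding D_def
  proof (rule step_fun_step_list[OF grid_sorted_list[OF fS(1,2)] fS(3)])
    have "finite (insert 1 (S n))" using fS by simp
    from set_sorted_list_of_set[OF this]
    show "S n \<inter> {0<..} \<subseteq> set (sorted_list_of_set (insert 1 (S n)))" by blast
    show "t < last (0 # sorted_list_of_set (insert 1 (S n)))"
      using last_sorted_list[OF fS(1,2)] that by simp
  qed (use that in simp)
  have "wdist (step_fun (D n)) \<gamma> = wdist (g n) \<gamma>" for n
    unfolding wdist_def by (rule set_lebesgue_integral_cong) (auto simp: sf)
  then have "step_approx \<xi> \<gamma> D"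
    unfolding step_approx_def using g(3) step_list_data[OF fS(1,2) g(2)]
    by (simp add: wdist_def D_def)
  then have "Phi \<xi> \<gamma> 0 0 = y"
    unfolding Phi_def using approx LIMSEQ_unique by (intro the_equality) blast+
  then show ?thesis using y by simp
qed

lemma Phi_lip:
  assumes a: "admissible \<gamma>" and b: "admissible \<delta>"
  shows "\<bar>Phi \<xi> \<gamma> 0 0 - Phi \<xi> \<delta> 0 0\<bar> \<le> wdist \<gamma> \<delta> / 2"
proof -
  have wi: "w_integrable \<gamma>" "w_integrable \<delta>" using a b by (auto simp: admissible_def)
  obtain S g where g: "\<And>n. step_path (S n) (g n)" "\<And>n t. 0 \<le> g n t" "(\<lambda>n. wdist (g n) \<gamma>) \<longlonglongrightarrow> 0"
    using admissible_approx[OF a] by blast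
  obtain T h where h: "\<And>n. step_path (T n) (h n)" "\<And>n t. 0 \<le> h n t" "(\<lambda>n. wdist (h n) \<delta>) \<longlonglongrightarrow> 0"
    using admissible_approx[OF b] by blast
  have l1: "(\<lambda>n. \<bar>grid_value d (S n) (g n) - grid_value d (T n) (h n)\<bar>) \<longlonglongrightarrow> \<bar>Phi \<xi> \<gamma> 0 0 - Phi \<xi> \<delta> 0 0\<bar>"
    by (rule tendsto_rabs[OF tendsto_diff[OF Phi_limit[OF a g] Phi_limit[OF b h]]])
  have l2: "(\<lambda>n. (wdist (g n) \<gamma> + wdist \<gamma> \<delta> + wdist (h n) \<delta>) / 2) \<longlonglongrightarrow> (0 + wdist \<gamma> \<delta> + 0) / 2"
    by (rule tendsto_divide[OF tendsto_add[OF tendsto_add[OF g(3) tendsto_const] h(3)] tendsto_const]) simp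
  have le: "\<bar>grid_value d (S n) (g n) - grid_value d (T n) (h n)\<bar>
      \<le> (wdist (g n) \<gamma> + wdist \<gamma> \<delta> + wdist (h n) \<delta>) / 2" for n
  proof -
    have "\<bar>grid_value d (S n) (g n) - grid_value d (T n) (h n)\<bar> \<le> wdist (g n) (h n) / 2"
      by (rule grid_value_lip[OF g(1,2) h(1,2)])
    also have "wdist (g n) (h n) \<le> wdist (g n) \<gamma> + wdist (h n) \<gamma>"
      by (intro wdist_triangle w_integrable_step[OF h(1)] w_integrable_step[OF g(1)] wi)
    also have "wdist (h n) \<gamma> \<le> wdist (h n) \<delta> + wdist \<gamma> \<delta>"
      by (intro wdist_triangle w_integrable_step[OF h(1)] wi)
    finally show ?thesis by (simp only: add_ac)
  qed
  show ?thesis using LIMSEQ_le[OF l1 l2] le by simp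
qed

lemma admissible_comb:
  assumes "admissible \<gamma>" "admissible \<delta>" "0 \<le> p" "0 \<le> q"
  shows "admissible (\<lambda>t. p * \<gamma> t + q * \<delta> t)"
  using assms unfolding admissible_def by (auto intro!: w_integrable_add w_integrable_cmult)

lemma Phi_convex:
  assumes a: "admissible \<gamma>" and b: "admissible \<delta>" and \<theta>: "0 \<le> \<theta>" "\<theta> \<le> 1"
  shows "Phi \<xi> (\<lambda>t. \<theta> * \<gamma> t + (1 - \<theta>) * \<delta> t) 0 0 \<le> \<theta> * Phi \<xi> \<gamma> 0 0 + (1 - \<theta>) * Phi \<xi> \<delta> 0 0"
proof -
  have wi: "w_integrable \<gamma>" "w_integrable \<delta>" using a b by (auto simp: admissible_def)
  obtain S g where g: "\<And>n. step_path (S n) (g n)" "\<And>n t. 0 \<le> g n t" "(\<lambda>n. wdist (g n) \<gamma>) \<longlonglongrightarrow> 0"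
    using admissible_approx[OF a] by blast
  obtain T h where h: "\<And>n. step_path (T n) (h n)" "\<And>n t. 0 \<le> h n t" "(\<lambda>n. wdist (h n) \<delta>) \<longlonglongrightarrow> 0"
    using admissible_approx[OF b] by blast
  let ?k = "\<lambda>n t. \<theta> * g n t + (1 - \<theta>) * h n t" and ?\<kappa> = "\<lambda>t. \<theta> * \<gamma> t + (1 - \<theta>) * \<delta> t"
  have adm: "admissible ?\<kappa>" using admissible_comb[OF a b] \<theta> by simp
  have sp: "step_path (S n \<union> T n) (?k n)" for n
    by (intro step_path_add step_path_cmult g h)
  have le: "wdist (?k n) ?\<kappa> \<le> \<theta> * wdist (g n) \<gamma> + (1 - \<theta>) * wdist (h n) \<delta>" for n
  proof (rule wdist_le_comb[OF w_integrable_step[OF sp] _ w_integrable_step[OF g(1)] wi(1) w_integrable_step[OF h(1)] wi(2)])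
    show "w_integrable ?\<kappa>" using adm by (simp add: admissible_def)
    fix t
    have "?k n t - ?\<kappa> t = \<theta> * (g n t - \<gamma> t) + (1 - \<theta>) * (h n t - \<delta> t)" by (simp add: algebra_simps)
    then show "\<bar>?k n t - ?\<kappa> t\<bar> \<le> \<theta> * \<bar>g n t - \<gamma> t\<bar> + (1 - \<theta>) * \<bar>h n t - \<delta> t\<bar>"
      using \<theta> abs_triangle_ineq[of "\<theta> * (g n t - \<gamma> t)" "(1 - \<theta>) * (h n t - \<delta> t)"] by (simp add: abs_mult)
  qed
  have "(\<lambda>n. \<theta> * wdist (g n) \<gamma> + (1 - \<theta>) * wdist (h n) \<delta>) \<longlonglongrightarrow> \<theta> * 0 + (1 - \<theta>) * 0"
    by (rule tendsto_add[OF tendsto_mult_left[OF g(3)] tendsto_mult_left[OF h(3)]])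
  then have l0: "(\<lambda>n. \<theta> * wdist (g n) \<gamma> + (1 - \<theta>) * wdist (h n) \<delta>) \<longlonglongrightarrow> 0" by simp
  have l: "(\<lambda>n. wdist (?k n) ?\<kappa>) \<longlonglongrightarrow> 0"
    by (rule tendsto_sandwich[OF _ _ tendsto_const[of 0] l0]) (simp_all add: le wdist_nonneg)
  have k0: "0 \<le> ?k n t" for n t using \<theta> g(2) h(2) by simp
  have l1: "(\<lambda>n. grid_value d (S n \<union> T n) (?k n)) \<longlonglongrightarrow> Phi \<xi> ?\<kappa> 0 0"
    by (rule Phi_limit[OF adm sp k0 l])
  have l2: "(\<lambda>n. \<theta> * grid_value d (S n) (g n) + (1 - \<theta>) * grid_value d (T n) (h n))
      \<longlonglongrightarrow> \<theta> * Phi \<xi> \<gamma> 0 0 + (1 - \<theta>) * Phi \<xi> \<delta> 0 0"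
    by (rule tendsto_add[OF tendsto_mult_left[OF Phi_limit[OF a g]] tendsto_mult_left[OF Phi_limit[OF b h]]])
  have "grid_value d (S n \<union> T n) (?k n) \<le> \<theta> * grid_value d (S n) (g n) + (1 - \<theta>) * grid_value d (T n) (h n)" for n
    by (rule grid_value_convex[OF g(1,2) h(1,2) \<theta>])
  then show ?thesis using LIMSEQ_le[OF l1 l2] by blast
qed

lemma Phi_smooth:
  assumes a: "admissible \<gamma>" and \<tau>: "0 < \<tau>" "\<tau> < 1" and A: "0 < A" "\<And>t. 0 \<le> t \<Longrightarrow> t < \<tau> \<Longrightarrow> \<gamma> t \<le> A"
    and s: "0 \<le> s" "s \<le> 1 / 2"
  shows "Phi \<xi> (\<lambda>t. \<gamma> t * (1 + s * (if t < \<tau> then 1 else 0))) 0 0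
      + Phi \<xi> (\<lambda>t. \<gamma> t * (1 - s * (if t < \<tau> then 1 else 0))) 0 0 - 2 * Phi \<xi> \<gamma> 0 0
    \<le> s\<^sup>2 * (4 * exp (3 / 2 * A\<^sup>2 * (d \<tau> - d 0)) / A + 4 * Phi \<xi> \<gamma> 0 0)"
proof -
  have wi: "w_integrable \<gamma>" using a by (auto simp: admissible_def)
  let ?e = "\<lambda>t. if t < \<tau> then 1 else (0::real)"
  obtain S g where g: "\<And>n. step_path (S n) (g n)" "\<And>n t. 0 \<le> g n t" "(\<lambda>n. wdist (g n) \<gamma>) \<longlonglongrightarrow> 0"
    using admissible_approx[OF a] by blast
  \<comment> \<open>Truncation of \<open>g n\<close> at height A on [0,\<tau>), so that the
    approximants satisfy the bound required by \<open>grid_value_smooth\<close>; \<gamma> satisfies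
    it there, so the distance does not grow.\<close>
  define h where "h n t = g n t - ?e t * max (g n t - A) 0" for n t
  have \<tau>S: "{\<tau>} \<inter> {0<..<1} = {\<tau>}" using \<tau> by auto
  have spe: "step_path {\<tau>} ?e" using step_path_less[of \<tau>] \<tau>S by simp
  have "step_path (S n \<union> ({\<tau>} \<union> (S n \<union> {} \<union> {}))) (h n)" for n
    unfolding h_def by (intro step_path_diff step_path_mult step_path_max spe g step_path_const)
  then have sp: "step_path (insert \<tau> (S n)) (h n)" for n by (simp add: insert_absorb)
  have h0: "0 \<le> h n t" for n t using g(2)[of n t] A(1) by (auto simp: h_def)
  have hA: "h n t \<le> A" if "t < \<tau>" for n t using that by (auto simp: h_def)
  have hl: "(\<lambda>n. wdist (h n) \<gamma>) \<longlonglongrightarrow> 0"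
  proof (rule tendsto_sandwich[OF _ _ tendsto_const[of 0] g(3)])
    have "wdist (h n) \<gamma> \<le> wdist (g n) \<gamma>" for n
    proof (rule wdist_mono[OF w_integrable_step[OF sp] wi w_integrable_step[OF g(1)] wi])
      fix t :: real assume "t \<in> {0..<1}"
      then show "\<bar>h n t - \<gamma> t\<bar> \<le> \<bar>g n t - \<gamma> t\<bar>"
        using A(2)[of t] by (auto simp: h_def max_def)
    qed
    then show "\<forall>\<^sub>F n in sequentially. wdist (h n) \<gamma> \<le> wdist (g n) \<gamma>" by simp
  qed (simp add: wdist_nonneg)
  have pert: "admissible (\<lambda>t. \<gamma> t * (1 + c * ?e t))
      \<and> (\<lambda>n. grid_value d (insert \<tau> (insert \<tau> (S n))) (\<lambda>t. h n t * (1 + c * ?e t)))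
        \<longlonglongrightarrow> Phi \<xi> (\<lambda>t. \<gamma> t * (1 + c * ?e t)) 0 0" if c: "\<bar>c\<bar> \<le> 1" for c
  proof -
    have b: "0 \<le> 1 + c * ?e t" "\<bar>1 + c * ?e t\<bar> \<le> 2" for t using c by auto
    have wc: "w_integrable (\<lambda>t. \<gamma> t * (1 + c * ?e t))"
      by (rule w_integrable_mult_bounded[OF wi _ b(2)]) measurable
    have adm: "admissible (\<lambda>t. \<gamma> t * (1 + c * ?e t))"
      using wc b a by (auto simp: admissible_def)
    have "step_path (insert \<tau> (S n) \<union> ({} \<union> {\<tau>})) (\<lambda>t. h n t * (1 + c * ?e t))" for n
      by (intro step_path_mult step_path_add step_path_cmult sp spe step_path_const)
    then have spc: "step_path (insert \<tau> (insert \<tau> (S n))) (\<lambda>t. h n t * (1 + c * ?e t))" for n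
      by (simp add: insert_absorb)
    have le: "wdist (\<lambda>t. h n t * (1 + c * ?e t)) (\<lambda>t. \<gamma> t * (1 + c * ?e t)) \<le> 2 * wdist (h n) \<gamma> + 0 * wdist (h n) \<gamma>" for n
    proof (rule wdist_le_comb[OF w_integrable_step[OF spc] wc w_integrable_step[OF sp] wi w_integrable_step[OF sp] wi])
      fix t
      have "\<bar>h n t * (1 + c * ?e t) - \<gamma> t * (1 + c * ?e t)\<bar> = \<bar>1 + c * ?e t\<bar> * \<bar>h n t - \<gamma> t\<bar>"
        by (simp add: abs_mult[symmetric] algebra_simps)
      also have "\<dots> \<le> 2 * \<bar>h n t - \<gamma> t\<bar>" by (intro mult_right_mono b) simp
      finally show "\<bar>h n t * (1 + c * ?e t) - \<gamma> t * (1 + c * ?e t)\<bar> \<le> 2 * \<bar>h n t - \<gamma> t\<bar> + 0 * \<bar>h n t - \<gamma> t\<bar>"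
        by simp
    qed
    have "(\<lambda>n. 2 * wdist (h n) \<gamma> + 0 * wdist (h n) \<gamma>) \<longlonglongrightarrow> 2 * 0 + 0 * 0"
      by (rule tendsto_add[OF tendsto_mult_left[OF hl] tendsto_mult_left[OF hl]])
    then have l0: "(\<lambda>n. 2 * wdist (h n) \<gamma> + 0 * wdist (h n) \<gamma>) \<longlonglongrightarrow> 0" by simp
    have l: "(\<lambda>n. wdist (\<lambda>t. h n t * (1 + c * ?e t)) (\<lambda>t. \<gamma> t * (1 + c * ?e t))) \<longlonglongrightarrow> 0"
      by (rule tendsto_sandwich[OF always_eventually always_eventually tendsto_const[of 0] l0])
        (rule allI, rule wdist_nonneg, rule allI, rule le)
    have "0 \<le> h n t * (1 + c * ?e t)" for n t using h0 b(1) by (rule mult_nonneg_nonneg)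
    from Phi_limit[OF adm spc this l] adm show ?thesis by blast
  qed
  have s1: "\<bar>s\<bar> \<le> 1" "\<bar>- s\<bar> \<le> 1" using s by auto
  have l0: "(\<lambda>n. grid_value d (insert \<tau> (S n)) (h n)) \<longlonglongrightarrow> Phi \<xi> \<gamma> 0 0"
    by (rule Phi_limit[OF a sp h0 hl])
  have l1: "(\<lambda>n. grid_value d (insert \<tau> (insert \<tau> (S n))) (\<lambda>t. h n t * (1 + s * ?e t)))
        \<longlonglongrightarrow> Phi \<xi> (\<lambda>t. \<gamma> t * (1 + s * ?e t)) 0 0" using pert[OF s1(1)] by blast
  have l2: "(\<lambda>n. grid_value d (insert \<tau> (insert \<tau> (S n))) (\<lambda>t. h n t * (1 - s * ?e t)))
        \<longlonglongrightarrow> Phi \<xi> (\<lambda>t. \<gamma> t * (1 - s * ?e t)) 0 0" using pert[OF s1(2)] by simp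
  show ?thesis
  proof (rule LIMSEQ_le[OF tendsto_diff[OF tendsto_add[OF l1 l2] tendsto_mult_left[OF l0, of 2]]
        tendsto_mult_left[OF tendsto_add[OF tendsto_const tendsto_mult_left[OF l0]]]], intro exI allI impI)
    fix n
    show "grid_value d (insert \<tau> (insert \<tau> (S n))) (\<lambda>t. h n t * (1 + s * ?e t))
        + grid_value d (insert \<tau> (insert \<tau> (S n))) (\<lambda>t. h n t * (1 - s * ?e t))
        - 2 * grid_value d (insert \<tau> (S n)) (h n)
      \<le> s\<^sup>2 * (4 * exp (3 / 2 * A\<^sup>2 * (d \<tau> - d 0)) / A + 4 * grid_value d (insert \<tau> (S n)) (h n))"
      by (rule grid_value_smooth[OF sp h0 \<tau> A(1) hA s])
  qed
qed

end

subsection \<open>First-order optimality of a strictly increasing minimizer\<close>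

context smooth_mixture
begin

lemma w_integrable_time:
  assumes "w_integrable g"
  shows "set_integrable lborel {0..<1} (\<lambda>t. t * w t * g t)"
proof -
  have m: "(\<lambda>t::real. max 0 (min t 1)) \<in> borel_measurable borel" by measurable
  have "w_integrable (\<lambda>t. g t * max 0 (min t 1))"
    by (rule w_integrable_mult_bounded[OF assms m, of 1]) auto
  then show ?thesis
    unfolding w_integrable_def by (rule set_integrable_cong[THEN iffD1, rotated -1]) auto
qed

text \<open>Half of the constant 1 comes from \<open>Phi_lip\<close> and half from the linear term,
  whose extra factor \<open>t\<close> is at most 1.\<close>

lemma parisi_lip:
  assumes a: "admissible \<gamma>" and b: "admissible \<delta>"
  shows "parisi \<xi> \<gamma> \<le> parisi \<xi> \<delta> + wdist \<gamma> \<delta>"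
proof -
  have wi: "w_integrable \<gamma>" "w_integrable \<delta>" using a b by (auto simp: admissible_def)
  note i = w_integrable_time[OF wi(1)] w_integrable_time[OF wi(2)]
  have "(LBINT t:{0..<1}. t * w t * \<delta> t) - (LBINT t:{0..<1}. t * w t * \<gamma> t)
      = (LBINT t:{0..<1}. t * w t * \<delta> t - t * w t * \<gamma> t)"
    by (rule set_integral_diff(2)[OF i(2,1), symmetric])
  also have "\<dots> \<le> wdist \<gamma> \<delta>"
    unfolding wdist_def
  proof (rule set_integral_mono[OF set_integral_diff(1)[OF i(2,1)] wdist_integrable[OF wi]])
    fix t :: real assume t: "t \<in> {0..<1}"
    have "t * w t * \<delta> t - t * w t * \<gamma> t = (t * w t) * (\<delta> t - \<gamma> t)" by (simp add: algebra_simps)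
    also have "\<dots> \<le> (1 * w t) * \<bar>\<gamma> t - \<delta> t\<bar>"
    proof -
      have "(t * w t) * (\<delta> t - \<gamma> t) \<le> (t * w t) * \<bar>\<gamma> t - \<delta> t\<bar>"
        using t nonneg2[of t] by (intro mult_left_mono) auto
      also have "\<dots> \<le> (1 * w t) * \<bar>\<gamma> t - \<delta> t\<bar>"
        using t nonneg2[of t] by (intro mult_right_mono) auto
      finally show ?thesis .
    qed
    finally show "t * w t * \<delta> t - t * w t * \<gamma> t \<le> w t * \<bar>\<gamma> t - \<delta> t\<bar>" by simp
  qed
  finally show ?thesis using Phi_lip[OF a b] unfolding parisi_def abs_le_iff by linarith
qed

lemma parisi_linear_part:
  assumes "w_integrable \<gamma>" "w_integrable \<delta>"
  shows "(LBINT t:{0..<1}. t * w t * (p * \<gamma> t + q * \<delta> t))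
    = p * (LBINT t:{0..<1}. t * w t * \<gamma> t) + q * (LBINT t:{0..<1}. t * w t * \<delta> t)"
proof -
  have eq: "t * w t * (p * \<gamma> t + q * \<delta> t) = p * (t * w t * \<gamma> t) + q * (t * w t * \<delta> t)" for t
    by (simp add: algebra_simps)
  show ?thesis
    unfolding eq
    by (subst set_integral_add(2)) (auto intro!: set_integrable_mult_right w_integrable_time assms)
qed

lemma parisi_convex:
  assumes a: "admissible \<gamma>" and b: "admissible \<delta>" and \<theta>: "0 \<le> \<theta>" "\<theta> \<le> 1"
  shows "parisi \<xi> (\<lambda>t. \<theta> * \<gamma> t + (1 - \<theta>) * \<delta> t) \<le> \<theta> * parisi \<xi> \<gamma> + (1 - \<theta>) * parisi \<xi> \<delta>"
proof -
  have wi: "w_integrable \<gamma>" "w_integrable \<delta>" using a b by (auto simp: admissible_def)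
  have "\<theta> * (x - 1 / 2 * x') + (1 - \<theta>) * (y - 1 / 2 * y')
      = (\<theta> * x + (1 - \<theta>) * y) - 1 / 2 * (\<theta> * x' + (1 - \<theta>) * y')" for x x' y y' :: real
    by (simp add: field_simps)
  then show ?thesis
    using Phi_convex[OF a b \<theta>] unfolding parisi_def parisi_linear_part[OF wi] by simp
qed

lemma admissible_mult:
  assumes "admissible \<gamma>" "h \<in> borel_measurable borel" "\<And>t. \<bar>h t\<bar> \<le> B" "\<And>t. t \<in> {0..<1} \<Longrightarrow> 0 \<le> h t"
  shows "admissible (\<lambda>t. \<gamma> t * h t)"
  using assms w_integrable_mult_bounded[OF _ assms(2,3)] unfolding admissible_def by auto

text \<open>The linear term cancels in the symmetric second difference, so only
  \<open>Phi_smooth\<close> contributes.\<close>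

lemma parisi_smooth:
  assumes a: "admissible \<gamma>" and \<tau>: "0 < \<tau>" "\<tau> < 1" and A: "0 < A" "\<And>t. 0 \<le> t \<Longrightarrow> t < \<tau> \<Longrightarrow> \<gamma> t \<le> A"
  obtains C where "0 \<le> C" "\<And>s. 0 \<le> s \<Longrightarrow> s \<le> 1 / 2 \<Longrightarrow>
    parisi \<xi> (\<lambda>t. \<gamma> t * (1 + s * (if t < \<tau> then 1 else 0)))
      + parisi \<xi> (\<lambda>t. \<gamma> t * (1 - s * (if t < \<tau> then 1 else 0))) \<le> 2 * parisi \<xi> \<gamma> + C * s\<^sup>2"
proof -
  let ?e = "\<lambda>t. if t < \<tau> then 1 else (0::real)"
  define C where "C = 4 * exp (3 / 2 * A\<^sup>2 * (d \<tau> - d 0)) / A + 4 * Phi \<xi> \<gamma> 0 0"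
  have main: "parisi \<xi> (\<lambda>t. \<gamma> t * (1 + s * ?e t)) + parisi \<xi> (\<lambda>t. \<gamma> t * (1 - s * ?e t))
      \<le> 2 * parisi \<xi> \<gamma> + \<bar>C\<bar> * s\<^sup>2" if s: "0 \<le> s" "s \<le> 1 / 2" for s
  proof -
    have wi: "w_integrable \<gamma>" using a by (auto simp: admissible_def)
    have we: "w_integrable (\<lambda>t. \<gamma> t * ?e t)"
      by (rule w_integrable_mult_bounded[OF wi, of _ 1]) auto
    have e: "\<gamma> t * (1 + s * ?e t) = 1 * \<gamma> t + s * (\<gamma> t * ?e t)"
      "\<gamma> t * (1 - s * ?e t) = 1 * \<gamma> t + (- s) * (\<gamma> t * ?e t)" for t
      by (simp_all add: algebra_simps)
    have l: "(LBINT t:{0..<1}. t * w t * (\<gamma> t * (1 + s * ?e t)))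
        + (LBINT t:{0..<1}. t * w t * (\<gamma> t * (1 - s * ?e t))) = 2 * (LBINT t:{0..<1}. t * w t * \<gamma> t)"
      unfolding e parisi_linear_part[OF wi we] by simp
    have "C * s\<^sup>2 \<le> \<bar>C\<bar> * s\<^sup>2" by (intro mult_right_mono) auto
    moreover have "Phi \<xi> (\<lambda>t. \<gamma> t * (1 + s * ?e t)) 0 0 + Phi \<xi> (\<lambda>t. \<gamma> t * (1 - s * ?e t)) 0 0 - 2 * Phi \<xi> \<gamma> 0 0
        \<le> C * s\<^sup>2"
      using Phi_smooth[OF a \<tau> A s] unfolding C_def by (simp only: mult.commute)
    moreover have "(x - 1 / 2 * x') + (y - 1 / 2 * y') \<le> 2 * (z - 1 / 2 * z') + b"
      if "a \<le> b" "x + y - 2 * z \<le> a" "x' + y' = 2 * z'" for a b x y z x' y' z' :: real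
      using that by (simp add: field_simps)
    ultimately show ?thesis
      using l unfolding parisi_def by blast
  qed
  show ?thesis by (rule that[OF _ main]) auto
qed

lemma wdist_indicator:
  assumes "0 \<le> a" "a \<le> b" "b \<le> 1" "0 \<le> p"
  shows "wdist (\<lambda>t. p * (if a \<le> t \<and> t < b then 1 else 0)) (\<lambda>_. 0) = p * (d b - d a)"
proof -
  have "wdist (\<lambda>t. p * (if a \<le> t \<and> t < b then 1 else 0)) (\<lambda>_. 0) = (LBINT t:{a..<b}. p * w t)"
    unfolding wdist_def set_lebesgue_integral_def
    by (rule Bochner_Integration.integral_cong) (use assms in \<open>auto simp: indicator_def\<close>)
  also have "\<dots> = p * (d b - d a)" using w_integral(2)[OF assms(1-3)] by simp
  finally show ?thesis .
qed

text \<open>The upper one-sided derivative of the Parisi functional at \<gamma> in the direction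
  \<gamma> \<rho> is at most 0, written with epsilons so that no derivative has to exist.
  Boundedness of \<rho> keeps \<gamma> (1 + s \<rho>) nonnegative for small s.\<close>

definition nonascending :: "(real \<Rightarrow> real) \<Rightarrow> (real \<Rightarrow> real) \<Rightarrow> bool" where
  "nonascending \<gamma> \<rho> \<longleftrightarrow> \<rho> \<in> borel_measurable borel \<and> (\<exists>B. \<forall>t. \<bar>\<rho> t\<bar> \<le> B)
    \<and> (\<forall>e>0. \<exists>s0>0. \<forall>s. 0 < s \<and> s \<le> s0 \<longrightarrow> parisi \<xi> (\<lambda>t. \<gamma> t * (1 + s * \<rho> t)) \<le> parisi \<xi> \<gamma> + e * s)"

lemma nonascending_scale:
  assumes "nonascending \<gamma> \<rho>" "0 < c"
  shows "nonascending \<gamma> (\<lambda>t. c * \<rho> t)"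
  unfolding nonascending_def
proof (intro conjI allI impI)
  have [measurable]: "\<rho> \<in> borel_measurable borel" using assms(1) by (simp add: nonascending_def)
  show "(\<lambda>t. c * \<rho> t) \<in> borel_measurable borel" by measurable
  obtain B where "\<And>t. \<bar>\<rho> t\<bar> \<le> B" using assms(1) unfolding nonascending_def by blast
  then have "\<bar>c * \<rho> t\<bar> \<le> c * B" for t using assms(2) by (simp add: abs_mult)
  then show "\<exists>B. \<forall>t. \<bar>c * \<rho> t\<bar> \<le> B" by blast
  fix e :: real assume "0 < e"
  then have "0 < e / c" using assms(2) by simp
  then obtain s0 where s0: "0 < s0" "\<And>s. 0 < s \<Longrightarrow> s \<le> s0 \<Longrightarrow> parisi \<xi> (\<lambda>t. \<gamma> t * (1 + s * \<rho> t)) \<le> parisi \<xi> \<gamma> + e / c * s"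
    using assms(1) unfolding nonascending_def by blast
  show "\<exists>s0>0. \<forall>s. 0 < s \<and> s \<le> s0 \<longrightarrow> parisi \<xi> (\<lambda>t. \<gamma> t * (1 + s * (c * \<rho> t))) \<le> parisi \<xi> \<gamma> + e * s"
  proof (intro exI[of _ "s0 / c"] conjI allI impI)
    fix s assume s: "0 < s \<and> s \<le> s0 / c"
    then have "0 < s * c" "s * c \<le> s0" using assms(2) by (auto simp: pos_le_divide_eq)
    from s0(2)[OF this] show "parisi \<xi> (\<lambda>t. \<gamma> t * (1 + s * (c * \<rho> t))) \<le> parisi \<xi> \<gamma> + e * s"
      using assms(2) by (simp add: mult.assoc)
  qed (use s0 assms in auto)
qed

lemma small_perturbation_admissible:
  assumes a: "admissible \<gamma>" and r: "\<rho> \<in> borel_measurable borel" "\<And>t. \<bar>\<rho> t\<bar> \<le> B" and s: "0 \<le> s" "s * B \<le> 1"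
  shows "admissible (\<lambda>t. \<gamma> t * (1 + s * \<rho> t))"
proof (rule admissible_mult[OF a, of _ 2])
  have [measurable]: "\<rho> \<in> borel_measurable borel" by fact
  show "(\<lambda>t. 1 + s * \<rho> t) \<in> borel_measurable borel" by measurable
  have "\<bar>s * \<rho> t\<bar> \<le> 1" for t
  proof -
    have "\<bar>s * \<rho> t\<bar> = s * \<bar>\<rho> t\<bar>" using s(1) by (simp add: abs_mult)
    also have "\<dots> \<le> s * B" by (intro mult_left_mono r s)
    finally show ?thesis using s(2) by simp
  qed
  then show "\<bar>1 + s * \<rho> t\<bar> \<le> 2" "0 \<le> 1 + s * \<rho> t" for t
    unfolding abs_le_iff by (smt (verit))+
qed

text \<open>The perturbation by \<rho> + \<rho>' at size s is the midpoint of those by \<rho> and by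
  \<rho>' at size 2s, so convexity makes the one-sided derivative subadditive.\<close>

lemma nonascending_add:
  assumes a: "admissible \<gamma>" and r: "nonascending \<gamma> \<rho>" and r': "nonascending \<gamma> \<rho>'"
  shows "nonascending \<gamma> (\<lambda>t. \<rho> t + \<rho>' t)"
  unfolding nonascending_def
proof (intro conjI allI impI)
  have m [measurable]: "\<rho> \<in> borel_measurable borel" "\<rho>' \<in> borel_measurable borel"
    using r r' by (simp_all add: nonascending_def)
  show "(\<lambda>t. \<rho> t + \<rho>' t) \<in> borel_measurable borel" by measurable
  obtain B B' where B: "\<And>t. \<bar>\<rho> t\<bar> \<le> B" "\<And>t. \<bar>\<rho>' t\<bar> \<le> B'"
    using r r' unfolding nonascending_def by blast
  then have "\<bar>\<rho> t + \<rho>' t\<bar> \<le> B + B'" for t by (meson abs_triangle_ineq add_mono order_trans)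
  then show "\<exists>B. \<forall>t. \<bar>\<rho> t + \<rho>' t\<bar> \<le> B" by blast
  fix e :: real assume e: "0 < e"
  then have e2: "0 < e / 2" by simp
  obtain s0 where s0: "0 < s0" "\<And>s. 0 < s \<Longrightarrow> s \<le> s0 \<Longrightarrow> parisi \<xi> (\<lambda>t. \<gamma> t * (1 + s * \<rho> t)) \<le> parisi \<xi> \<gamma> + e / 2 * s"
    using r e2 unfolding nonascending_def by blast
  obtain s1 where s1: "0 < s1" "\<And>s. 0 < s \<Longrightarrow> s \<le> s1 \<Longrightarrow> parisi \<xi> (\<lambda>t. \<gamma> t * (1 + s * \<rho>' t)) \<le> parisi \<xi> \<gamma> + e / 2 * s"
    using r' e2 unfolding nonascending_def by blast
  define M where "M = \<bar>B\<bar> + \<bar>B'\<bar> + 1"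
  have M: "0 < M" "B \<le> M" "B' \<le> M" by (auto simp: M_def)
  \<comment> \<open>The half leaves room for the doubled step 2s, and 1 / M keeps both perturbed
    functions admissible.\<close>
  define S where "S = min (min s0 s1) (1 / M) / 2"
  have S: "0 < S" "2 * S \<le> s0" "2 * S \<le> s1" "2 * S \<le> 1 / M"
    using s0(1) s1(1) M(1) by (auto simp: S_def)
  show "\<exists>s0>0. \<forall>s. 0 < s \<and> s \<le> s0 \<longrightarrow> parisi \<xi> (\<lambda>t. \<gamma> t * (1 + s * (\<rho> t + \<rho>' t))) \<le> parisi \<xi> \<gamma> + e * s"
  proof (intro exI[of _ S] conjI allI impI S(1))
    fix s assume s: "0 < s \<and> s \<le> S"
    have sM: "2 * s * M \<le> 1"
    proof -
      have "2 * s \<le> 1 / M" using s S(4) by linarith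
      then show ?thesis using M(1) by (simp add: pos_le_divide_eq)
    qed
    have "2 * s * B \<le> 2 * s * M" "2 * s * B' \<le> 2 * s * M" using s M by (auto intro!: mult_left_mono)
    then have sB: "2 * s * B \<le> 1" "2 * s * B' \<le> 1" using sM by linarith+
    have ad: "admissible (\<lambda>t. \<gamma> t * (1 + 2 * s * \<rho> t))" "admissible (\<lambda>t. \<gamma> t * (1 + 2 * s * \<rho>' t))"
      using s by (auto intro!: small_perturbation_admissible[OF a m(1) B(1) _ sB(1)] small_perturbation_admissible[OF a m(2) B(2) _ sB(2)])
    have eq: "(\<lambda>t. \<gamma> t * (1 + s * (\<rho> t + \<rho>' t)))
        = (\<lambda>t. 1 / 2 * (\<gamma> t * (1 + 2 * s * \<rho> t)) + (1 - 1 / 2) * (\<gamma> t * (1 + 2 * s * \<rho>' t)))"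
      by (auto simp: fun_eq_iff algebra_simps)
    have "parisi \<xi> (\<lambda>t. \<gamma> t * (1 + s * (\<rho> t + \<rho>' t)))
        \<le> 1 / 2 * parisi \<xi> (\<lambda>t. \<gamma> t * (1 + 2 * s * \<rho> t)) + (1 - 1 / 2) * parisi \<xi> (\<lambda>t. \<gamma> t * (1 + 2 * s * \<rho>' t))"
      unfolding eq by (rule parisi_convex[OF ad]) auto
    also have "\<dots> \<le> 1 / 2 * (parisi \<xi> \<gamma> + e / 2 * (2 * s)) + (1 - 1 / 2) * (parisi \<xi> \<gamma> + e / 2 * (2 * s))"
      using s S by (intro add_mono mult_left_mono s0(2) s1(2)) auto
    also have "\<dots> = parisi \<xi> \<gamma> + e * s" by (simp add: field_simps)
    finally show "parisi \<xi> (\<lambda>t. \<gamma> t * (1 + s * (\<rho> t + \<rho>' t))) \<le> parisi \<xi> \<gamma> + e * s" .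
  qed
qed

lemma nonascending_zero:
  assumes a: "admissible \<gamma>" and r: "step_path S \<rho>" "\<And>t. t \<in> {0..<1} \<Longrightarrow> \<rho> t = 0"
  shows "nonascending \<gamma> \<rho>"
proof -
  have le: "parisi \<xi> (\<lambda>t. \<gamma> t * (1 + s * \<rho> t)) \<le> parisi \<xi> \<gamma>" for s
  proof -
    have wi: "w_integrable (\<lambda>t. \<gamma> t * (1 + s * \<rho> t))"
      using a r(2) unfolding admissible_def w_integrable_def
      by (subst set_integrable_cong[OF refl refl, of _ _ "\<lambda>t. w t * \<gamma> t"]) auto
    then have ad: "admissible (\<lambda>t. \<gamma> t * (1 + s * \<rho> t))" using a r(2) by (simp add: admissible_def)
    have "wdist (\<lambda>t. \<gamma> t * (1 + s * \<rho> t)) \<gamma> = (LBINT t:{0..<1 :: real}. (0 :: real))"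
      unfolding wdist_def by (rule set_lebesgue_integral_cong) (auto simp: r(2))
    then show ?thesis using parisi_lip[OF ad a] by simp
  qed
  show ?thesis
    unfolding nonascending_def
  proof (intro conjI allI impI)
    fix e :: real assume "0 < e"
    have "parisi \<xi> (\<lambda>t. \<gamma> t * (1 + s * \<rho> t)) \<le> parisi \<xi> \<gamma> + e * s" if "0 < s \<and> s \<le> 1" for s
    proof -
      have "0 \<le> e * s" using that \<open>0 < e\<close> by simp
      then show ?thesis using le[of s] by linarith
    qed
    then show "\<exists>s0>0. \<forall>s. 0 < s \<and> s \<le> s0 \<longrightarrow> parisi \<xi> (\<lambda>t. \<gamma> t * (1 + s * \<rho> t)) \<le> parisi \<xi> \<gamma> + e * s"
      using zero_less_one by blast
  qed (use r(1) in \<open>auto simp: step_path_def\<close>)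
qed

text \<open>Induction over the largest jump b: if m is the previous jump, or 0, then \<rho> is
  constant on [m,b) and vanishes from b on, so subtracting \<open>\<rho> m\<close> times 1_[0,b)
  removes the jump at b and leaves a step function that vanishes from m on.\<close>

lemma nonascending_step:
  assumes a: "admissible \<gamma>"
    and e: "\<And>\<tau> p. 0 < \<tau> \<Longrightarrow> \<tau> < 1 \<Longrightarrow> nonascending \<gamma> (\<lambda>t. p * (if t < \<tau> then 1 else 0))"
    and S: "finite S"
  shows "step_path S \<rho> \<Longrightarrow> (\<And>t. t \<in> {0..<1} \<Longrightarrow> \<forall>r\<in>S. r \<le> t \<Longrightarrow> \<rho> t = 0) \<Longrightarrow> nonascending \<gamma> \<rho>"
  using S
proof (induction S arbitrary: \<rho> rule: finite_linorder_max_induct)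
  case empty
  then show ?case by (intro nonascending_zero[OF a]) auto
next
  case (insert b A)
  define m where "m = Max (insert 0 A)"
  have sub: "insert b A \<subseteq> {0<..<1}" and st: "step_on (insert b A) \<rho>"
    using insert.prems(1) by (auto simp: step_path_def)
  have b: "0 < b" "b < 1" using sub by auto
  have m: "0 \<le> m" "m < b" "\<And>r. r \<in> A \<Longrightarrow> r \<le> m"
    using insert.hyps b unfolding m_def by auto
  have mA: "m = 0 \<or> m \<in> A"
    using Max_in[of "insert 0 A"] insert.hyps(1) unfolding m_def by auto
  let ?e = "\<lambda>t. if t < b then 1 else (0::real)"
  define \<rho>' where "\<rho>' t = \<rho> t - \<rho> m * ?e t" for t
  have val: "\<rho> t = \<rho> m" if "\<forall>r\<in>A. r \<le> t" "0 \<le> t" "t < b" for t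
  proof -
    have mt: "m \<le> t" using mA that by auto
    have "insert b A \<inter> {m<..t} = {}" using that m(3) by force
    then have "0 \<le> m \<and> m \<le> t \<and> t < 1 \<and> insert b A \<inter> {m<..t} = {}"
      using mt m(1) that(3) b(2) by simp
    then have "\<rho> m = \<rho> t" using st unfolding step_on_def by blast
    then show ?thesis by simp
  qed
  have z: "\<rho>' t = 0" if "t \<in> {0..<1}" "\<forall>r\<in>A. r \<le> t" for t
    using val[OF that(2)] that insert.prems(2)[of t] by (cases "t < b") (auto simp: \<rho>'_def)
  have st': "step_on A \<rho>'"
    unfolding step_on_def
  proof (intro allI impI)
    fix s t :: real assume h: "0 \<le> s \<and> s \<le> t \<and> t < 1 \<and> A \<inter> {s<..t} = {}"
    show "\<rho>' s = \<rho>' t"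
    proof (cases "s < b \<and> b \<le> t")
      case True
      have "r \<le> s" if "r \<in> A" for r
      proof (rule ccontr)
        assume "\<not> r \<le> s"
        then have "r \<in> A \<inter> {s<..t}" using that insert.hyps(2) True by force
        then show False using h by blast
      qed
      then have "\<forall>r\<in>A. r \<le> s" "\<forall>r\<in>A. r \<le> t" using h by (auto intro: order_trans)
      then have "\<rho>' s = 0" "\<rho>' t = 0" using h by (simp_all add: z)
      then show ?thesis by simp
    next
      case False
      then have "insert b A \<inter> {s<..t} = {}" "(s < b) = (t < b)" using h by auto
      then show ?thesis using h st unfolding step_on_def \<rho>'_def by auto
    qed
  qed
  have be: "{b} \<inter> {0<..<1} = {b}" using b by auto
  have spd: "step_path (insert b A \<union> {b}) \<rho>'"
    unfolding \<rho>'_def using step_path_less[of b] insert.prems(1) unfolding be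
    by (intro step_path_diff step_path_cmult)
  then have sp: "step_path A \<rho>'"
    using st' unfolding step_path_def by auto
  have "nonascending \<gamma> (\<lambda>t. \<rho>' t + \<rho> m * ?e t)"
    by (intro nonascending_add a e insert.IH sp z b)
  then show ?case by (simp add: \<rho>'_def)
qed

text \<open>Since \<gamma> is the midpoint of \<gamma> (1 + s \<rho>) and \<gamma> (1 - s \<rho>),
  an upper bound in direction -\<rho> becomes a lower bound in direction \<rho> at small s;
  convexity along the segment from \<gamma> to \<gamma> (1 + \<rho>) carries it to s = 1.\<close>

lemma parisi_le_step:
  assumes a: "admissible \<gamma>"
    and e: "\<And>\<tau> p. 0 < \<tau> \<Longrightarrow> \<tau> < 1 \<Longrightarrow> nonascending \<gamma> (\<lambda>t. p * (if t < \<tau> then 1 else 0))"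
    and r: "step_path S \<rho>" "\<And>t. t \<in> {0..<1} \<Longrightarrow> \<forall>r\<in>S. r \<le> t \<Longrightarrow> \<rho> t = 0"
    and pos: "\<And>t. t \<in> {0..<1} \<Longrightarrow> 0 \<le> 1 + \<rho> t"
  shows "parisi \<xi> \<gamma> \<le> parisi \<xi> (\<lambda>t. \<gamma> t * (1 + \<rho> t))"
proof (rule field_le_epsilon)
  fix \<epsilon> :: real assume eps: "0 < \<epsilon>"
  have fin: "finite S" using r(1) by (simp add: step_path_def)
  have sp: "step_path S (\<lambda>t. - \<rho> t)" using step_path_cmult[OF r(1), of "-1"] by simp
  have "nonascending \<gamma> (\<lambda>t. - \<rho> t)"
    by (rule nonascending_step[OF a e fin sp]) (use r(2) in auto)
  then obtain s0 where s0: "0 < s0" "\<And>s. 0 < s \<Longrightarrow> s \<le> s0 \<Longrightarrow> parisi \<xi> (\<lambda>t. \<gamma> t * (1 + s * - \<rho> t)) \<le> parisi \<xi> \<gamma> + \<epsilon> * s"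
    using eps unfolding nonascending_def by blast
  have m [measurable]: "\<rho> \<in> borel_measurable borel" using r(1) by (simp add: step_path_def)
  obtain B where B: "\<And>t. \<bar>\<rho> t\<bar> \<le> B" using r(1) unfolding step_path_def by blast
  have B': "\<bar>- \<rho> t\<bar> \<le> \<bar>B\<bar> + 1" "\<bar>\<rho> t\<bar> \<le> \<bar>B\<bar> + 1" for t using B[of t] by auto
  define s where "s = min s0 (1 / (\<bar>B\<bar> + 1))"
  have s: "0 < s" "s \<le> s0" using s0(1) by (auto simp: s_def)
  have "s \<le> 1 / (\<bar>B\<bar> + 1)" by (simp add: s_def)
  then have sB: "s * (\<bar>B\<bar> + 1) \<le> 1" by (simp add: pos_le_divide_eq)
  have s1: "s \<le> 1"
  proof -
    have "s * 1 \<le> s * (\<bar>B\<bar> + 1)" using s by (intro mult_left_mono) auto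
    then show ?thesis using sB by simp
  qed
  have mn: "(\<lambda>t. - \<rho> t) \<in> borel_measurable borel" by measurable
  have ad1: "admissible (\<lambda>t. \<gamma> t * (1 + s * \<rho> t))"
    by (rule small_perturbation_admissible[OF a m B'(2) _ sB]) (use s in simp)
  have ad2: "admissible (\<lambda>t. \<gamma> t * (1 + s * - \<rho> t))"
    by (rule small_perturbation_admissible[OF a mn B'(1) _ sB]) (use s in simp)
  have ad3: "admissible (\<lambda>t. \<gamma> t * (1 + \<rho> t))"
  proof (rule admissible_mult[OF a _ _ pos])
    show "\<bar>1 + \<rho> t\<bar> \<le> 1 + B" for t using B[of t] by auto
  qed auto
  have "\<gamma> = (\<lambda>t. 1 / 2 * (\<gamma> t * (1 + s * \<rho> t)) + (1 - 1 / 2) * (\<gamma> t * (1 + s * - \<rho> t)))"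
    by (auto simp: fun_eq_iff algebra_simps)
  then have "parisi \<xi> \<gamma> \<le> 1 / 2 * parisi \<xi> (\<lambda>t. \<gamma> t * (1 + s * \<rho> t)) + (1 - 1 / 2) * parisi \<xi> (\<lambda>t. \<gamma> t * (1 + s * - \<rho> t))"
    using parisi_convex[OF ad1 ad2, of "1 / 2"] by simp
  moreover have "parisi \<xi> (\<lambda>t. \<gamma> t * (1 + s * - \<rho> t)) \<le> parisi \<xi> \<gamma> + \<epsilon> * s" by (rule s0(2)[OF s])
  moreover have "parisi \<xi> (\<lambda>t. \<gamma> t * (1 + s * \<rho> t)) \<le> s * parisi \<xi> (\<lambda>t. \<gamma> t * (1 + \<rho> t)) + (1 - s) * parisi \<xi> \<gamma>"
  proof -
    have eq: "(\<lambda>t. \<gamma> t * (1 + s * \<rho> t)) = (\<lambda>t. s * (\<gamma> t * (1 + \<rho> t)) + (1 - s) * \<gamma> t)"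
      by (auto simp: fun_eq_iff algebra_simps)
    show ?thesis unfolding eq by (rule parisi_convex[OF ad3 a]) (use s s1 in auto)
  qed
  ultimately have "s * parisi \<xi> \<gamma> \<le> s * (parisi \<xi> (\<lambda>t. \<gamma> t * (1 + \<rho> t)) + \<epsilon>)"
    by (simp add: algebra_simps)
  then show "parisi \<xi> \<gamma> \<le> parisi \<xi> (\<lambda>t. \<gamma> t * (1 + \<rho> t)) + \<epsilon>" using s by simp
qed

text \<open>The cutoff \<kappa> descends with slope 1 / (\<beta> - \<alpha>) and only below \<beta>,
  which costs y \<kappa>(y) a slope of at most \<beta> / (\<beta> - \<alpha>). The bound on |c| is
  the reciprocal and settles c \<ge> 0; for c < 0 it suffices that |c| \<le> 1 and that \<kappa> is
  non-increasing.\<close>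

lemma kappa_monotone:
  fixes \<alpha> \<beta> c y z :: real
  defines "\<kappa> \<equiv> \<lambda>y. min 1 (max 0 ((\<beta> - y) / (\<beta> - \<alpha>)))"
  assumes ab: "0 \<le> \<alpha>" "\<alpha> < \<beta>" and c: "\<bar>c\<bar> \<le> (\<beta> - \<alpha>) / \<beta>" and yz: "0 \<le> y" "y \<le> z"
  shows "y * (1 + c * \<kappa> y) \<le> z * (1 + c * \<kappa> z)"
proof -
  have b0: "0 < \<beta>" using ab by simp
  have c1: "\<bar>c\<bar> \<le> 1"
  proof -
    have "(\<beta> - \<alpha>) / \<beta> \<le> 1" using ab b0 by (simp add: pos_divide_le_eq)
    then show ?thesis using c by simp
  qed
  have k01: "0 \<le> \<kappa> u" "\<kappa> u \<le> 1" for u by (auto simp: \<kappa>_def)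
  have dec: "\<kappa> z \<le> \<kappa> y" unfolding \<kappa>_def
    using yz ab by (intro min.mono max.mono divide_right_mono order_refl) auto
  have lip: "\<kappa> y - \<kappa> z \<le> (z - y) / (\<beta> - \<alpha>)"
  proof -
    have "(\<beta> - y) / (\<beta> - \<alpha>) = (\<beta> - z) / (\<beta> - \<alpha>) + (z - y) / (\<beta> - \<alpha>)"
      by (simp add: add_divide_distrib[symmetric])
    moreover have "0 \<le> (z - y) / (\<beta> - \<alpha>)" using yz ab by simp
    ultimately show ?thesis unfolding \<kappa>_def by (auto simp: min_def max_def)
  qed
  have e: "z * (1 + c * \<kappa> z) - y * (1 + c * \<kappa> y) = (z - y) * (1 + c * \<kappa> z) - c * (y * (\<kappa> y - \<kappa> z))"
    by (simp add: algebra_simps)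
  show ?thesis
  proof (cases "0 \<le> c")
    case True
    have "c * (y * (\<kappa> y - \<kappa> z)) \<le> (z - y) * 1"
    proof (cases "y \<le> \<beta>")
      case yb: True
      have "c * (y * (\<kappa> y - \<kappa> z)) \<le> (\<beta> - \<alpha>) / \<beta> * (\<beta> * ((z - y) / (\<beta> - \<alpha>)))"
        using c True yb yz dec lip ab b0 by (intro mult_mono) auto
      also have "\<dots> = z - y" using ab b0 by simp
      finally show ?thesis by simp
    next
      case False
      then have "(\<beta> - y) / (\<beta> - \<alpha>) \<le> 0" using ab by (intro divide_nonpos_pos) auto
      then have "\<kappa> y = 0" by (simp add: \<kappa>_def max_absorb1)
      then have "\<kappa> y - \<kappa> z = 0" using dec k01(1)[of z] by simp
      then show ?thesis using yz by simp
    qed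
    also have "\<dots> \<le> (z - y) * (1 + c * \<kappa> z)"
      using yz True k01(1)[of z] by (intro mult_left_mono) auto
    finally show ?thesis using e by simp
  next
    case False
    have "0 \<le> (- c) * (y * (\<kappa> y - \<kappa> z))" using False yz dec by (intro mult_nonneg_nonneg) auto
    moreover have "0 \<le> (z - y) * (1 + c * \<kappa> z)"
    proof (rule mult_nonneg_nonneg)
      have "(- c) * \<kappa> z \<le> 1 * 1" using False c1 k01[of z] by (intro mult_mono) auto
      then show "0 \<le> 1 + c * \<kappa> z" by simp
    qed (use yz in simp)
    ultimately show ?thesis using e by simp
  qed
qed

text \<open>\<xi>'' is bounded on [0,1], so integrability of \<gamma> passes to \<xi>''
  \<gamma>.\<close>

lemma U_paths_admissible:
  assumes "\<gamma> \<in> U_paths"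
  shows "admissible \<gamma>"
proof -
  have i: "integrable lborel (\<lambda>t. indicator {0..<1} t *\<^sub>R \<gamma> t)"
    using assms by (simp add: U_paths_def set_integrable_def)
  define h where "h t = indicator {0..1} t *\<^sub>R w t" for t
  have hm: "h \<in> borel_measurable borel"
    unfolding h_def[abs_def] by (rule borel_measurable_continuous_on_indicator[OF _ cont2]) simp
  have "\<exists>B. \<forall>t\<in>{0..1}. \<bar>w t\<bar> \<le> B"
    using compact_imp_bounded[OF compact_continuous_image[OF cont2 compact_Icc]]
    unfolding bounded_iff by simp
  then obtain B where B: "\<And>t. t \<in> {0..1} \<Longrightarrow> \<bar>w t\<bar> \<le> B" by blast
  have hB: "\<bar>h t\<bar> \<le> \<bar>B\<bar>" for t using B[of t] by (auto simp: h_def indicator_def)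
  have "integrable lborel (\<lambda>t. h t * (indicator {0..<1} t *\<^sub>R \<gamma> t))"
  proof (rule Bochner_Integration.integrable_bound[OF integrable_mult_right[OF i, of "\<bar>B\<bar>"]])
    show "(\<lambda>t. h t * (indicator {0..<1} t *\<^sub>R \<gamma> t)) \<in> borel_measurable lborel"
      using borel_measurable_times[OF _ borel_measurable_integrable[OF i], of h] hm by simp
    have "\<bar>h t * x\<bar> \<le> \<bar>\<bar>B\<bar> * x\<bar>" for x t
      unfolding abs_mult using hB[of t] by (intro mult_right_mono) auto
    then show "AE t in lborel. norm (h t * (indicator {0..<1} t *\<^sub>R \<gamma> t)) \<le> norm (\<bar>B\<bar> * (indicator {0..<1} t *\<^sub>R \<gamma> t))"
      by (intro AE_I2) (simp only: real_norm_def)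
  qed
  moreover have "(\<lambda>t. h t * (indicator {0..<1} t *\<^sub>R \<gamma> t)) = (\<lambda>t. indicator {0..<1} t *\<^sub>R (w t * \<gamma> t))"
    by (auto simp: h_def indicator_def)
  ultimately have "w_integrable \<gamma>" by (simp add: w_integrable_def set_integrable_def)
  then show ?thesis using assms by (simp add: admissible_def U_paths_def)
qed

lemma U_paths_perturb:
  fixes \<alpha> \<beta> c :: real
  defines "\<kappa> \<equiv> \<lambda>y. min 1 (max 0 ((\<beta> - y) / (\<beta> - \<alpha>)))"
  assumes g: "\<gamma> \<in> U_paths" and ab: "0 \<le> \<alpha>" "\<alpha> < \<beta>" and c: "\<bar>c\<bar> \<le> (\<beta> - \<alpha>) / \<beta>"
  shows "(\<lambda>t. \<gamma> t * (1 + c * \<kappa> (\<gamma> t))) \<in> U_paths"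
proof -
  have nn: "\<And>t. t \<in> {0..<1} \<Longrightarrow> 0 \<le> \<gamma> t" and mono: "mono_on {0..<1} \<gamma>"
    and i: "integrable lborel (\<lambda>t. indicator {0..<1} t *\<^sub>R \<gamma> t)"
    using g by (auto simp: U_paths_def set_integrable_def)
  have mon: "y * (1 + c * \<kappa> y) \<le> z * (1 + c * \<kappa> z)" if "0 \<le> y" "y \<le> z" for y z
    unfolding \<kappa>_def by (rule kappa_monotone[OF ab c that])
  have "0 \<le> \<gamma> t * (1 + c * \<kappa> (\<gamma> t))" if "t \<in> {0..<1}" for t
    using mon[of 0 "\<gamma> t"] nn[OF that] by simp
  moreover have "mono_on {0..<1} (\<lambda>t. \<gamma> t * (1 + c * \<kappa> (\<gamma> t)))"
  proof (rule mono_onI)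
    fix r s :: real assume "r \<in> {0..<1}" "s \<in> {0..<1}" "r \<le> s"
    then show "\<gamma> r * (1 + c * \<kappa> (\<gamma> r)) \<le> \<gamma> s * (1 + c * \<kappa> (\<gamma> s))"
      using mono_onD[OF mono] nn by (intro mon) auto
  qed
  moreover have "set_integrable lborel {0..<1} (\<lambda>t. \<gamma> t * (1 + c * \<kappa> (\<gamma> t)))"
  proof -
    let ?f = "\<lambda>t. indicator {0..<1} t *\<^sub>R \<gamma> t"
    have [measurable]: "?f \<in> borel_measurable lborel" using i by (rule borel_measurable_integrable)
    have "integrable lborel (\<lambda>t. ?f t * (1 + c * \<kappa> (?f t)))"
    proof (rule Bochner_Integration.integrable_bound[OF integrable_mult_right[OF i, of "1 + \<bar>c\<bar>"]])
      show "(\<lambda>t. ?f t * (1 + c * \<kappa> (?f t))) \<in> borel_measurable lborel"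
        unfolding \<kappa>_def by measurable
      have "\<bar>x * (1 + c * \<kappa> u)\<bar> \<le> \<bar>(1 + \<bar>c\<bar>) * x\<bar>" for x u
      proof -
        have "\<bar>\<kappa> u\<bar> \<le> 1" by (auto simp: \<kappa>_def)
        then have "\<bar>c\<bar> * \<bar>\<kappa> u\<bar> \<le> \<bar>c\<bar> * 1" by (intro mult_left_mono) auto
        then have "\<bar>1 + c * \<kappa> u\<bar> \<le> 1 + \<bar>c\<bar>"
          using abs_triangle_ineq[of 1 "c * \<kappa> u"] by (simp add: abs_mult)
        then have "\<bar>x\<bar> * \<bar>1 + c * \<kappa> u\<bar> \<le> \<bar>x\<bar> * (1 + \<bar>c\<bar>)" by (rule mult_left_mono) simp
        then show ?thesis by (simp add: abs_mult mult.commute)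
      qed
      then show "AE t in lborel. norm (?f t * (1 + c * \<kappa> (?f t))) \<le> norm ((1 + \<bar>c\<bar>) * ?f t)"
        by (intro AE_I2) (simp only: real_norm_def)
    qed
    moreover have "(\<lambda>t. ?f t * (1 + c * \<kappa> (?f t))) = (\<lambda>t. indicator {0..<1} t *\<^sub>R (\<gamma> t * (1 + c * \<kappa> (\<gamma> t))))"
      by (auto simp: indicator_def)
    ultimately show ?thesis by (simp add: set_integrable_def)
  qed
  ultimately show ?thesis by (simp add: U_paths_def)
qed

text \<open>The perturbation \<open>\<gamma> (1 \<plusminus> s \<kappa>(\<gamma>))\<close> with a continuous cutoff \<open>\<kappa>\<close> in the values of \<open>\<gamma>\<close> stays
  non-decreasing; strict monotonicity of \<open>\<gamma>\<close> is what makes \<open>\<kappa>(\<gamma>)\<close> approximate an indicator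
  function of time.\<close>

lemma parisi_perturb_lower:
  assumes g: "\<gamma> \<in> U_paths" "strict_mono_on {0..<1} \<gamma>" and opt: "\<And>\<delta>. \<delta> \<in> U_paths \<Longrightarrow> parisi \<xi> \<gamma> \<le> parisi \<xi> \<delta>"
    and \<tau>: "0 < \<tau>" "\<tau> < 1" and e: "0 < e"
  shows "\<exists>s0>0. \<forall>c. \<bar>c\<bar> \<le> s0 \<longrightarrow> parisi \<xi> \<gamma> \<le> parisi \<xi> (\<lambda>t. \<gamma> t * (1 + c * (if t < \<tau> then 1 else 0))) + e * \<bar>c\<bar>"
proof -
  let ?e = "\<lambda>t. if t < \<tau> then 1 else (0::real)"
  have nn: "\<And>t. t \<in> {0..<1} \<Longrightarrow> 0 \<le> \<gamma> t" and mono: "mono_on {0..<1} \<gamma>" using g by (auto simp: U_paths_def)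
  have adm: "admissible \<gamma>" by (rule U_paths_admissible[OF g(1)])
  define \<beta> where "\<beta> = \<gamma> \<tau>"
  \<comment> \<open>Choice of a: the sharp and the smooth cutoff differ only on [a,\<tau>), where
    \<gamma> \<le> \<beta>, so per unit of |c| the perturbed functions are at weighted distance at
    most \<beta> (d \<tau> - d a).\<close>
  have "isCont d \<tau>" using deriv2[of \<tau>] \<tau> DERIV_isCont by fastforce
  then have "(\<lambda>a. \<beta> * (d \<tau> - d a)) \<midarrow>\<tau>\<rightarrow> \<beta> * (d \<tau> - d \<tau>)"
    by (intro tendsto_intros) (simp add: isCont_def)
  then have "\<forall>\<^sub>F a in at \<tau>. \<beta> * (d \<tau> - d a) < e" using e by (simp add: order_tendstoD(2))
  then have "\<forall>\<^sub>F a in at_left \<tau>. \<beta> * (d \<tau> - d a) < e" by (rule filter_leD[OF at_le, rotated]) simp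
  moreover have "\<forall>\<^sub>F a in at_left \<tau>. a \<in> {0<..<\<tau>}" using eventually_at_left_real[OF \<tau>(1)] .
  ultimately have "\<forall>\<^sub>F a in at_left \<tau>. \<beta> * (d \<tau> - d a) < e \<and> a \<in> {0<..<\<tau>}" by (rule eventually_conj)
  then obtain a where a: "\<beta> * (d \<tau> - d a) < e" "0 < a" "a < \<tau>"
    using eventually_happens[of _ "at_left \<tau>"] trivial_limit_at_left_real[of \<tau>] by auto
  define \<alpha> where "\<alpha> = \<gamma> a"
  \<comment> \<open>Strict monotonicity of \<gamma> enters here: it separates the levels \<alpha>
    and \<beta>.\<close>
  have ab: "0 \<le> \<alpha>" "\<alpha> < \<beta>"
    unfolding \<alpha>_def \<beta>_def using nn[of a] strict_mono_onD[OF g(2), of a \<tau>] a \<tau> by auto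
  define \<kappa> where "\<kappa> y = min 1 (max 0 ((\<beta> - y) / (\<beta> - \<alpha>)))" for y
  have k01: "0 \<le> \<kappa> u" "\<kappa> u \<le> 1" for u by (auto simp: \<kappa>_def)
  have klow: "\<kappa> (\<gamma> t) = 1" if "0 \<le> t" "t \<le> a" for t
  proof -
    have "\<gamma> t \<le> \<alpha>" unfolding \<alpha>_def using mono_onD[OF mono, of t a] that a \<tau> by auto
    then show ?thesis using ab by (simp add: \<kappa>_def le_divide_eq)
  qed
  have khigh: "\<kappa> (\<gamma> t) = 0" if "\<tau> \<le> t" "t < 1" for t
  proof -
    have "\<beta> \<le> \<gamma> t" unfolding \<beta>_def using mono_onD[OF mono, of \<tau> t] that \<tau> by auto
    then have "(\<beta> - \<gamma> t) / (\<beta> - \<alpha>) \<le> 0" using ab by (intro divide_nonpos_pos) auto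
    then show ?thesis by (simp add: \<kappa>_def max_absorb1)
  qed
  show ?thesis
  proof (intro exI[of _ "min 1 ((\<beta> - \<alpha>) / \<beta>)"] conjI allI impI)
    show "0 < min 1 ((\<beta> - \<alpha>) / \<beta>)" using ab by auto
    fix c assume "\<bar>c\<bar> \<le> min 1 ((\<beta> - \<alpha>) / \<beta>)"
    then have c: "\<bar>c\<bar> \<le> 1" "\<bar>c\<bar> \<le> (\<beta> - \<alpha>) / \<beta>" by auto
    let ?\<delta> = "\<lambda>t. \<gamma> t * (1 + c * \<kappa> (\<gamma> t))" and ?\<eta> = "\<lambda>t. \<gamma> t * (1 + c * ?e t)"
    have U: "?\<delta> \<in> U_paths" unfolding \<kappa>_def by (rule U_paths_perturb[OF g(1) ab c(2)])
    have aU: "admissible ?\<delta>" by (rule U_paths_admissible[OF U])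
    have ae: "admissible ?\<eta>"
    proof (rule admissible_mult[OF adm])
      show "\<bar>1 + c * ?e t\<bar> \<le> 2" "0 \<le> 1 + c * ?e t" for t using c(1) by auto
    qed measurable
    let ?i = "\<lambda>t. \<bar>c\<bar> * \<beta> * (if a \<le> t \<and> t < \<tau> then 1 else (0::real))"
    have wi: "w_integrable ?i"
    proof (rule w_integrable_cmult)
      show "w_integrable (\<lambda>t. if a \<le> t \<and> t < \<tau> then 1 else (0::real))"
        using w_integrable_mult_bounded[OF w_integrable_one, of "\<lambda>t. if a \<le> t \<and> t < \<tau> then 1 else 0" 1] by auto
    qed
    have "wdist ?\<delta> ?\<eta> \<le> wdist ?i (\<lambda>_. 0)"
    proof (rule wdist_mono)
      show "w_integrable ?\<delta>" "w_integrable ?\<eta>" using aU ae by (auto simp: admissible_def)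
      show "w_integrable ?i" by (rule wi)
      show "w_integrable (\<lambda>_. 0)" using w_integrable_step[OF step_path_const[of 0]] .
      fix t :: real assume t: "t \<in> {0..<1}"
      have eq: "?\<delta> t - ?\<eta> t = c * (\<gamma> t * (\<kappa> (\<gamma> t) - ?e t))" by (simp add: algebra_simps)
      show "\<bar>?\<delta> t - ?\<eta> t\<bar> \<le> \<bar>?i t - 0\<bar>"
      proof (cases "a \<le> t \<and> t < \<tau>")
        case True
        have "\<gamma> t \<le> \<beta>" unfolding \<beta>_def using mono_onD[OF mono, of t \<tau>] True t \<tau> by auto
        moreover have "\<bar>\<kappa> (\<gamma> t) - 1\<bar> \<le> 1" using k01[of "\<gamma> t"] by auto
        ultimately have "\<gamma> t * \<bar>\<kappa> (\<gamma> t) - 1\<bar> \<le> \<beta> * 1" using nn[OF t] by (intro mult_mono) auto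
        then have "\<bar>c\<bar> * (\<gamma> t * \<bar>\<kappa> (\<gamma> t) - 1\<bar>) \<le> \<bar>c\<bar> * \<beta>" by (intro mult_left_mono) auto
        then show ?thesis unfolding eq using True nn[OF t] ab by (simp add: abs_mult)
      next
        case False
        then have "\<kappa> (\<gamma> t) - ?e t = 0" using klow[of t] khigh[of t] t a by (auto simp: not_le not_less)
        then show ?thesis unfolding eq by simp
      qed
    qed
    also have "\<dots> = \<bar>c\<bar> * \<beta> * (d \<tau> - d a)"
      using a \<tau> ab by (intro wdist_indicator) auto
    also have "\<dots> \<le> \<bar>c\<bar> * e"
      unfolding mult.assoc using a(1) by (intro mult_left_mono) auto
    finally have "wdist ?\<delta> ?\<eta> \<le> e * \<bar>c\<bar>" by (simp only: mult.commute)
    then show "parisi \<xi> \<gamma> \<le> parisi \<xi> ?\<eta> + e * \<bar>c\<bar>"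
      using parisi_lip[OF aU ae] opt[OF U] by linarith
  qed
qed

text \<open>Smoothness bounds the sum of the values in the directions +1 and -1 by twice the value
  at \<gamma> plus C s^2, so the lower bound for either sign is an upper bound for the other.
  General p follow by positive scaling.\<close>

lemma nonascending_indicator:
  assumes g: "\<gamma> \<in> U_paths" "strict_mono_on {0..<1} \<gamma>" and opt: "\<And>\<delta>. \<delta> \<in> U_paths \<Longrightarrow> parisi \<xi> \<gamma> \<le> parisi \<xi> \<delta>"
    and \<tau>: "0 < \<tau>" "\<tau> < 1"
  shows "nonascending \<gamma> (\<lambda>t. p * (if t < \<tau> then 1 else 0))"
proof -
  let ?e = "\<lambda>t. if t < \<tau> then 1 else (0::real)"
  have mono: "mono_on {0..<1} \<gamma>" using g by (auto simp: U_paths_def)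
  have adm: "admissible \<gamma>" by (rule U_paths_admissible[OF g(1)])
  have A: "\<gamma> t \<le> \<gamma> \<tau>" if "0 \<le> t" "t < \<tau>" for t using mono_onD[OF mono, of t \<tau>] that \<tau> by auto
  have A0: "0 < \<gamma> \<tau>"
    using strict_mono_onD[OF g(2), of 0 \<tau>] \<tau> adm by (auto simp: admissible_def intro: le_less_trans)
  obtain C where C: "0 \<le> C" "\<And>s. 0 \<le> s \<Longrightarrow> s \<le> 1 / 2 \<Longrightarrow>
    parisi \<xi> (\<lambda>t. \<gamma> t * (1 + s * ?e t)) + parisi \<xi> (\<lambda>t. \<gamma> t * (1 - s * ?e t)) \<le> 2 * parisi \<xi> \<gamma> + C * s\<^sup>2"
    using parisi_smooth[OF adm \<tau> A0 A] by blast
  have unit: "nonascending \<gamma> (\<lambda>t. p * ?e t)" if p: "p = 1 \<or> p = -1" for p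
    unfolding nonascending_def
  proof (intro conjI allI impI)
    show "(\<lambda>t. p * ?e t) \<in> borel_measurable borel" by measurable
    show "\<exists>B. \<forall>t. \<bar>p * ?e t\<bar> \<le> B" by (rule exI[of _ 1]) (use p in auto)
    fix e :: real assume "0 < e"
    then have e2: "0 < e / 2" by simp
    obtain s0 where s0: "0 < s0" "\<And>c. \<bar>c\<bar> \<le> s0 \<Longrightarrow> parisi \<xi> \<gamma> \<le> parisi \<xi> (\<lambda>t. \<gamma> t * (1 + c * ?e t)) + e / 2 * \<bar>c\<bar>"
      using parisi_perturb_lower[OF g opt \<tau> e2] by blast
    \<comment> \<open>The last entry makes C s^2 \<le> (e / 2) s; C + 1 avoids division by
      0.\<close>
    define s1 where "s1 = min s0 (min (1 / 2) (e / (2 * (C + 1))))"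
    have "0 < e / (2 * (C + 1))" using \<open>0 < e\<close> C(1) by simp
    then have s1: "0 < s1" "s1 \<le> s0" "s1 \<le> 1 / 2" "s1 \<le> e / (2 * (C + 1))"
      using s0(1) by (simp_all only: s1_def min_less_iff_conj min_le_iff_disj order_refl simp_thms)
    show "\<exists>s0>0. \<forall>s. 0 < s \<and> s \<le> s0 \<longrightarrow> parisi \<xi> (\<lambda>t. \<gamma> t * (1 + s * (p * ?e t))) \<le> parisi \<xi> \<gamma> + e * s"
    proof (intro exI[of _ s1] conjI allI impI s1(1))
      fix s assume s: "0 < s \<and> s \<le> s1"
      have "C * s \<le> e / 2"
      proof -
        have "s \<le> e / (2 * (C + 1))" using s s1 by linarith
        then have "s * (2 * (C + 1)) \<le> e" using C(1) by (simp add: pos_le_divide_eq)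
        then show ?thesis using s by (simp add: algebra_simps)
      qed
      then have "C * s * s \<le> e / 2 * s" using s by (intro mult_right_mono) auto
      then have Cs: "C * s\<^sup>2 \<le> e / 2 * s" by (simp add: power2_eq_square mult.assoc)
      have lo: "parisi \<xi> \<gamma> \<le> parisi \<xi> (\<lambda>t. \<gamma> t * (1 + s * ?e t)) + e / 2 * s"
        "parisi \<xi> \<gamma> \<le> parisi \<xi> (\<lambda>t. \<gamma> t * (1 - s * ?e t)) + e / 2 * s"
        using s0(2)[of s] s0(2)[of "- s"] s s1 by auto
      have up: "parisi \<xi> (\<lambda>t. \<gamma> t * (1 + s * ?e t)) + parisi \<xi> (\<lambda>t. \<gamma> t * (1 - s * ?e t)) \<le> 2 * parisi \<xi> \<gamma> + C * s\<^sup>2"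
        using C(2)[of s] s s1 by auto
      have arith: "x \<le> z + e * s" if "z \<le> y + e / 2 * s" "x + y \<le> 2 * z + q" "q \<le> e / 2 * s" for x y z q
        using that by (simp add: field_simps)
      have arith': "y \<le> z + e * s" if "z \<le> x + e / 2 * s" "x + y \<le> 2 * z + q" "q \<le> e / 2 * s" for x y z q
        using that by (simp add: field_simps)
      show "parisi \<xi> (\<lambda>t. \<gamma> t * (1 + s * (p * ?e t))) \<le> parisi \<xi> \<gamma> + e * s"
        using p
      proof
        assume "p = 1"
        then show ?thesis using arith[OF lo(2) up Cs] by simp
      next
        assume "p = - 1"
        then show ?thesis using arith'[OF lo(1) up Cs] by simp
      qed
    qed
  qed
  consider "p = 0" | "0 < p" | "p < 0" by linarith
  then show ?thesis
  proof cases
    case 1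
    then show ?thesis
      using nonascending_zero[OF adm step_path_const[of 0]] by simp
  next
    case 2
    then show ?thesis using nonascending_scale[OF unit[of 1], of p] by simp
  next
    case 3
    then show ?thesis using nonascending_scale[OF unit[of "-1"], of "- p"] by simp
  qed
qed

end

subsection \<open>The minimizer over all admissible order parameters\<close>

context smooth_mixture
begin

text \<open>\<open>nonascending_step\<close> asks that the direction vanish after its last jump,
  which lies below 1. Replacing the factor by 1 on [\<tau>,1) achieves this, at a cost that tends to
  0 as \<tau> tends to 1 by dominated convergence.\<close>

lemma step_tail_approx:
  assumes adm: "admissible \<gamma>" and g: "step_path S g" and e: "0 < e"
  obtains \<tau> where "0 < \<tau>" "\<tau> < 1"
    "wdist (\<lambda>t. \<gamma> t * (if t < \<tau> then g t else 1)) (\<lambda>t. \<gamma> t * g t) < e"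
proof -
  define \<tau> where "\<tau> n = 1 - 1 / real (n + 2)" for n
  have \<tau>: "0 < \<tau> n" "\<tau> n < 1" for n by (auto simp: \<tau>_def)
  have \<tau>lim: "\<tau> \<longlonglongrightarrow> 1"
  proof -
    have "(\<lambda>n. 1 / real (n + 2)) \<longlonglongrightarrow> 0" by real_asymp
    from tendsto_diff[OF tendsto_const[of 1] this] show ?thesis by (simp add: \<tau>_def[abs_def])
  qed
  have wi: "w_integrable \<gamma>" using adm by (simp add: admissible_def)
  obtain B where B: "\<And>t. \<bar>g t\<bar> \<le> B" and gm [measurable]: "g \<in> borel_measurable borel"
    using g unfolding step_path_def by blast
  have wg: "w_integrable (\<lambda>t. \<gamma> t * g t)" by (rule w_integrable_mult_bounded[OF wi gm B])
  have wt: "w_integrable (\<lambda>t. \<gamma> t * (if t < \<tau> n then g t else 1))" for n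
  proof (rule w_integrable_mult_bounded[OF wi])
    show "\<bar>if t < \<tau> n then g t else 1\<bar> \<le> max B 1" for t using B[of t] by (auto simp: le_max_iff_disj)
  qed measurable
  let ?F = "\<lambda>t. indicator {0..<1} t *\<^sub>R (w t * \<bar>\<gamma> t - \<gamma> t * g t\<bar>)"
  let ?G = "\<lambda>n t. indicator {0..<1} t *\<^sub>R (w t * \<bar>\<gamma> t * (if t < \<tau> n then g t else 1) - \<gamma> t * g t\<bar>)"
  have iF: "integrable lborel ?F" using wdist_integrable[OF wi wg] by (simp add: set_integrable_def)
  have iG: "integrable lborel (?G n)" for n using wdist_integrable[OF wt wg, of n] by (simp only: set_integrable_def)
  have "(\<lambda>n. LBINT t. ?G n t) \<longlonglongrightarrow> (LBINT t::real. (0::real))"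
  proof (rule integral_dominated_convergence[where w = ?F])
    show "AE t in lborel. (\<lambda>n. ?G n t) \<longlonglongrightarrow> 0"
    proof (rule AE_I2)
      fix t :: real
      show "(\<lambda>n. ?G n t) \<longlonglongrightarrow> 0"
      proof (cases "t < 1")
        case True
        have "\<forall>\<^sub>F n in sequentially. t < \<tau> n" by (rule order_tendstoD(1)[OF \<tau>lim True])
        then have "\<forall>\<^sub>F n in sequentially. ?G n t = 0" by eventually_elim simp
        then show ?thesis by (rule tendsto_eventually)
      qed simp
    qed
    show "AE t in lborel. norm (?G n t) \<le> ?F t" for n
      by (rule AE_I2) (use nonneg2 in \<open>auto simp: indicator_def abs_mult\<close>)
  qed (use iF iG in \<open>auto intro: borel_measurable_integrable\<close>)
  then have "(\<lambda>n. wdist (\<lambda>t. \<gamma> t * (if t < \<tau> n then g t else 1)) (\<lambda>t. \<gamma> t * g t)) \<longlonglongrightarrow> 0"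
    by (simp add: wdist_def set_lebesgue_integral_def)
  then have "\<forall>\<^sub>F n in sequentially. wdist (\<lambda>t. \<gamma> t * (if t < \<tau> n then g t else 1)) (\<lambda>t. \<gamma> t * g t) < e"
    using e by (rule order_tendstoD(2))
  then obtain n where "wdist (\<lambda>t. \<gamma> t * (if t < \<tau> n then g t else 1)) (\<lambda>t. \<gamma> t * g t) < e"
    using eventually_happens'[OF sequentially_bot] by blast
  with \<tau> that show ?thesis by blast
qed

text \<open>A competitor is \<gamma> times a quotient, which is approximated by a nonnegative step
  function k in the weighted L1 distance and then set to 1 near time 1. For \<gamma> times such a
  step function \<open>parisi_le_step\<close> gives the inequality, and \<open>parisi_lip\<close>
  transfers it.\<close>

lemma parisi_minimizer_admissible:
  assumes g: "\<gamma> \<in> U_paths" "strict_mono_on {0..<1} \<gamma>" and opt: "\<And>\<delta>. \<delta> \<in> U_paths \<Longrightarrow> parisi \<xi> \<gamma> \<le> parisi \<xi> \<delta>"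
    and \<delta>: "admissible \<delta>"
  shows "parisi \<xi> \<gamma> \<le> parisi \<xi> \<delta>"
proof (rule field_le_epsilon)
  fix e :: real assume "0 < e"
  then have e: "0 < e / 2" by simp
  have adm: "admissible \<gamma>" by (rule U_paths_admissible[OF g(1)])
  have wi: "w_integrable \<gamma>" "w_integrable \<delta>" using adm \<delta> by (auto simp: admissible_def)
  have nn: "\<And>t. t \<in> {0..<1} \<Longrightarrow> 0 \<le> \<gamma> t" "\<And>t. t \<in> {0..<1} \<Longrightarrow> 0 \<le> \<delta> t"
    using adm \<delta> by (auto simp: admissible_def)
  have gpos: "0 < \<gamma> t" if "0 < t" "t < 1" for t
    using strict_mono_onD[OF g(2), of 0 t] that nn(1)[of 0] by auto
  \<comment> \<open>On [0,1) a nonnegative strictly increasing \<gamma> can vanish only at t = 0.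
    Resetting the competitor there changes nothing almost everywhere and gives \<delta>' = 0
    wherever \<gamma> = 0, as \<open>step_path_dense\<close> requires.\<close>
  define \<delta>' where "\<delta>' t = (if t = 0 then 0 else \<delta> t)" for t
  have ae: "AE t in lborel. indicator {0..<1} t *\<^sub>R (w t * \<delta> t) = indicator {0..<1} t *\<^sub>R (w t * \<delta>' t)"
    using AE_lborel_singleton[of "0::real"] by eventually_elim (simp add: \<delta>'_def)
  have wi': "w_integrable \<delta>'"
  proof -
    have m: "(\<lambda>t::real. if t = 0 then 0 else (1::real)) \<in> borel_measurable borel" by measurable
    have "w_integrable (\<lambda>t. \<delta> t * (if t = 0 then 0 else 1))"
      by (rule w_integrable_mult_bounded[OF wi(2) m, of 1]) simp
    moreover have "(\<lambda>t. \<delta> t * (if t = 0 then 0 else 1)) = \<delta>'" by (auto simp: \<delta>'_def)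
    ultimately show ?thesis by simp
  qed
  have d0: "wdist \<delta>' \<delta> = 0"
    unfolding wdist_def set_lebesgue_integral_def
    by (rule integral_eq_zero_AE) (use AE_lborel_singleton[of "0::real"] in \<open>eventually_elim, simp add: \<delta>'_def\<close>)
  obtain S h where h: "step_path S h" "(LBINT t:{0..<1}. \<bar>w t * \<gamma> t * h t - w t * \<delta>' t\<bar>) < e / 2"
  proof (rule step_path_dense[OF _ _ _ _ e])
    show "set_integrable lborel {0..<1} (\<lambda>t. w t * \<gamma> t)" "set_integrable lborel {0..<1} (\<lambda>t. w t * \<delta>' t)"
      using wi(1) wi' by (auto simp: w_integrable_def)
    show "0 \<le> w t * \<gamma> t" if "t \<in> {0..<1}" for t using nn(1)[OF that] nonneg2[of t] that by simp
    show "w t * \<delta>' t = 0" if "t \<in> {0..<1}" "w t * \<gamma> t = 0" for t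
      using that gpos[of t] by (auto simp: \<delta>'_def)
  qed
  define k where "k t = max (h t) 0" for t
  have k: "step_path S k" using step_path_max[OF h(1) step_path_const[of 0]] by (simp add: k_def[abs_def])
  have k0: "0 \<le> k t" for t by (simp add: k_def)
  obtain B where B: "\<And>t. \<bar>k t\<bar> \<le> B" and km [measurable]: "k \<in> borel_measurable borel"
    using k unfolding step_path_def by blast
  obtain Bh where Bh: "\<And>t. \<bar>h t\<bar> \<le> Bh" and hm [measurable]: "h \<in> borel_measurable borel"
    using h(1) unfolding step_path_def by blast
  have ak: "admissible (\<lambda>t. \<gamma> t * k t)" by (rule admissible_mult[OF adm km B k0])
  have wk: "w_integrable (\<lambda>t. \<gamma> t * k t)" using ak by (simp add: admissible_def)
  have wh: "w_integrable (\<lambda>t. \<gamma> t * h t)" by (rule w_integrable_mult_bounded[OF wi(1) hm Bh])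
  have close: "wdist (\<lambda>t. \<gamma> t * k t) \<delta>' < e / 2"
  proof -
    have "wdist (\<lambda>t. \<gamma> t * k t) \<delta>' \<le> wdist (\<lambda>t. \<gamma> t * h t) \<delta>'"
    proof (rule wdist_mono[OF wk wi' wh wi'])
      fix t :: real assume t: "t \<in> {0..<1}"
      show "\<bar>\<gamma> t * k t - \<delta>' t\<bar> \<le> \<bar>\<gamma> t * h t - \<delta>' t\<bar>"
      proof (cases "0 \<le> h t")
        case False
        then have "\<gamma> t * h t \<le> 0" using nn(1)[OF t] by (simp add: mult_nonneg_nonpos)
        then show ?thesis using False nn(2)[OF t] by (auto simp: k_def \<delta>'_def)
      qed (simp add: k_def)
    qed
    also have "\<dots> < e / 2" using h(2) by (simp add: wdist_eq mult.assoc)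
    finally show ?thesis .
  qed
  obtain \<tau> where \<tau>: "0 < \<tau>" "\<tau> < 1"
    "wdist (\<lambda>t. \<gamma> t * (if t < \<tau> then k t else 1)) (\<lambda>t. \<gamma> t * k t) < e / 2"
    using step_tail_approx[OF adm k e] by blast
  define \<rho> where "\<rho> t = (if t < \<tau> then 1 else 0) * (k t - 1)" for t
  have \<tau>S: "{\<tau>} \<inter> {0<..<1} = {\<tau>}" using \<tau> by auto
  have spe: "step_path {\<tau>} (\<lambda>t. if t < \<tau> then 1 else 0)" using step_path_less[of \<tau>] \<tau>S by simp
  have sp: "step_path ({\<tau>} \<union> (S \<union> {})) \<rho>"
    unfolding \<rho>_def by (intro step_path_mult step_path_diff spe k step_path_const)
  have eq: "1 + \<rho> t = (if t < \<tau> then k t else 1)" for t by (simp add: \<rho>_def)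
  have at: "admissible (\<lambda>t. \<gamma> t * (1 + \<rho> t))"
    unfolding eq
  proof (rule admissible_mult[OF adm])
    show "\<bar>if t < \<tau> then k t else 1\<bar> \<le> max B 1" for t using B[of t] by (auto simp: le_max_iff_disj)
    show "0 \<le> (if t < \<tau> then k t else 1)" for t using k0 by simp
  qed measurable
  have "parisi \<xi> \<gamma> \<le> parisi \<xi> (\<lambda>t. \<gamma> t * (1 + \<rho> t))"
  proof (rule parisi_le_step[OF adm nonascending_indicator[OF g opt] sp])
    show "\<rho> t = 0" if "t \<in> {0..<1}" "\<forall>r\<in>{\<tau>} \<union> (S \<union> {}). r \<le> t" for t using that by (simp add: \<rho>_def)
    show "0 \<le> 1 + \<rho> t" for t unfolding eq using k0 by simp
  qed
  also have "\<dots> \<le> parisi \<xi> \<delta> + wdist (\<lambda>t. \<gamma> t * (1 + \<rho> t)) \<delta>" by (rule parisi_lip[OF at \<delta>])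
  also have "wdist (\<lambda>t. \<gamma> t * (1 + \<rho> t)) \<delta> \<le> e"
  proof -
    have wt: "w_integrable (\<lambda>t. \<gamma> t * (1 + \<rho> t))" using at by (simp add: admissible_def)
    have t1: "wdist (\<lambda>t. \<gamma> t * (1 + \<rho> t)) \<delta> \<le> wdist (\<lambda>t. \<gamma> t * (1 + \<rho> t)) \<delta>' + wdist \<delta> \<delta>'"
      by (rule wdist_triangle[OF wt wi(2) wi'])
    have t2: "wdist (\<lambda>t. \<gamma> t * (1 + \<rho> t)) \<delta>' \<le> wdist (\<lambda>t. \<gamma> t * (1 + \<rho> t)) (\<lambda>t. \<gamma> t * k t) + wdist \<delta>' (\<lambda>t. \<gamma> t * k t)"
      by (rule wdist_triangle[OF wt wi' wk])
    have c: "wdist \<delta> \<delta>' = 0" "wdist \<delta>' (\<lambda>t. \<gamma> t * k t) < e / 2"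
      using d0 close by (simp_all add: wdist_def abs_minus_commute)
    have c3: "wdist (\<lambda>t. \<gamma> t * (1 + \<rho> t)) (\<lambda>t. \<gamma> t * k t) < e / 2" unfolding eq by (rule \<tau>(3))
    have "x \<le> e" if "x \<le> y + z" "y \<le> p + q" "z = 0" "q < e / 2" "p < e / 2" for x y z p q
      using that by (simp add: field_simps)
    from this[OF t1 t2 c c3] show ?thesis .
  qed
  finally show "parisi \<xi> \<gamma> \<le> parisi \<xi> \<delta> + e" by simp
qed

end

section \<open>Regularity of the mixture and inclusion of the two classes\<close>

lemma mixture_smooth:
  fixes c :: "nat \<Rightarrow> real"
  assumes eps: "\<epsilon>\<^sub>0 > 0" and sum: "summable (\<lambda>k. (c (k + 2))\<^sup>2 * (1 + \<epsilon>\<^sub>0) ^ (k + 2))"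
  shows "smooth_mixture (mixture c)" "mono_on {0..1} (deriv (deriv (mixture c)))"
proof -
  define K where "K = 1 + \<epsilon>\<^sub>0"
  have K: "1 < K" using eps by (simp add: K_def)
  \<comment> \<open>Coefficients padded with zeros in degrees 0 and 1, so that the mixture is an
    ordinary power series open to termwise differentiation; it converges at K > 1, which puts [0,1]
    inside the disc of convergence.\<close>
  define b where "b n = (if n < 2 then 0 else (c n)\<^sup>2)" for n
  have b0: "0 \<le> b n" for n by (simp add: b_def)
  have sK: "summable (\<lambda>n. b n * K ^ n)"
  proof -
    have "summable (\<lambda>k. b (k + 2) * K ^ (k + 2))" using sum by (simp add: b_def K_def)
    then show ?thesis by (subst (asm) summable_iff_shift)
  qed
  have sb: "summable (\<lambda>n. b n * x ^ n)" if "norm x < K" for x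
    by (rule powser_inside[OF sK]) (use that K in simp)
  have sb1: "summable (\<lambda>n. diffs b n * x ^ n)" if "norm x < K" for x :: real
    by (rule termdiff_converges[OF that sb])
  have sb2: "summable (\<lambda>n. diffs (diffs b) n * x ^ n)" if "norm x < K" for x :: real
    by (rule termdiff_converges[OF that sb1])
  have mix: "mixture c x = (\<Sum>n. b n * x ^ n)" if "norm x < K" for x
  proof -
    have "(\<Sum>n. b n * x ^ n) = (\<Sum>n. b (n + 2) * x ^ (n + 2)) + (\<Sum>n<2. b n * x ^ n)"
      by (rule suminf_split_initial_segment[OF sb[OF that]])
    also have "(\<Sum>n<2. b n * x ^ n) = 0" by (simp add: b_def)
    finally show ?thesis by (simp add: mixture_def b_def)
  qed
  define g1 where "g1 x = (\<Sum>n. diffs b n * x ^ n)" for x :: real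
  define g2 where "g2 x = (\<Sum>n. diffs (diffs b) n * x ^ n)" for x :: real
  have op: "open {x::real. norm x < K}" by (intro open_Collect_less continuous_intros)
  have D1: "(mixture c has_real_derivative g1 x) (at x)" if x: "norm x < K" for x
  proof -
    have "((\<lambda>x. \<Sum>n. b n * x ^ n) has_real_derivative g1 x) (at x)"
      unfolding g1_def using x K
      by (intro termdiffs_strong'[of K, OF sb]) auto
    then show ?thesis
      by (rule has_field_derivative_transform_within_open[OF _ op]) (use x mix in auto)
  qed
  have d1: "deriv (mixture c) x = g1 x" if "norm x < K" for x using D1[OF that] by (rule DERIV_imp_deriv)
  have D2: "(deriv (mixture c) has_real_derivative g2 x) (at x)" if x: "norm x < K" for x
  proof -
    have "(g1 has_real_derivative g2 x) (at x)"
      unfolding g1_def[abs_def] g2_def using x K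
      by (intro termdiffs_strong'[of K, OF sb1]) auto
    then show ?thesis
      by (rule has_field_derivative_transform_within_open[OF _ op]) (use x d1 in auto)
  qed
  have d2: "deriv (deriv (mixture c)) x = g2 x" if "norm x < K" for x using D2[OF that] by (rule DERIV_imp_deriv)
  have c0: "0 \<le> diffs (diffs b) n" for n using b0 by (simp add: diffs_def)
  have in_K: "norm x < K" if "x \<in> {0..1}" for x :: real using that K by simp
  have mono: "g2 x \<le> g2 y" if "0 \<le> x" "x \<le> y" "y \<le> 1" for x y
    unfolding g2_def using that c0
    by (intro suminf_le sb2 in_K mult_left_mono power_mono) auto
  have g20: "0 \<le> g2 x" if "x \<in> {0..1}" for x
    unfolding g2_def using that c0 by (intro suminf_nonneg sb2 in_K) auto
  show "smooth_mixture (mixture c)"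
  proof
    show "(deriv (mixture c) has_real_derivative deriv (deriv (mixture c)) t) (at t)" if "t \<in> {0..1}" for t
      unfolding d2[OF in_K[OF that]] by (rule D2[OF in_K[OF that]])
    show "0 \<le> deriv (deriv (mixture c)) t" if "t \<in> {0..1}" for t
      unfolding d2[OF in_K[OF that]] by (rule g20[OF that])
    have "continuous_on {0..1} g2"
    proof (rule DERIV_continuous_on)
      fix x :: real assume "x \<in> {0..1}"
      then have "(g2 has_real_derivative (\<Sum>n. diffs (diffs (diffs b)) n * x ^ n)) (at x)"
        unfolding g2_def[abs_def] using in_K[of x] K
        by (intro termdiffs_strong'[of K, OF sb2]) auto
      then show "(g2 has_real_derivative (\<Sum>n. diffs (diffs (diffs b)) n * x ^ n)) (at x within {0..1})"
        by (rule has_field_derivative_at_within)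
    qed
    then show "continuous_on {0..1} (deriv (deriv (mixture c)))"
      by (rule continuous_on_eq) (use d2 in_K in auto)
  qed
  show "mono_on {0..1} (deriv (deriv (mixture c)))"
    by (rule mono_onI) (use mono d2 in_K in auto)
qed

lemma total_variation_mono:
  assumes "mono_on {a..b} f" "a \<le> b"
  shows "total_variation f a b \<le> ennreal (f b - f a)"
  unfolding total_variation_def
proof (rule SUP_least, clarify)
  fix xs :: "real list" assume xs: "sorted xs" "set xs \<subseteq> {a..b}"
  have in_ab: "xs ! i \<in> {a..b}" if "i < length xs" for i using xs(2) that nth_mem by blast
  have step: "0 \<le> f (xs ! Suc i) - f (xs ! i)" if "Suc i < length xs" for i
    using mono_onD[OF assms(1) in_ab[of i] in_ab[of "Suc i"]] sorted_nth_mono[OF xs(1), of i "Suc i"] that by simp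
  have "(\<Sum>i<length xs - 1. ennreal \<bar>f (xs ! Suc i) - f (xs ! i)\<bar>)
      = (\<Sum>i<length xs - 1. ennreal (f (xs ! Suc i) - f (xs ! i)))"
    using step by (intro sum.cong) auto
  also have "\<dots> = ennreal (\<Sum>i<length xs - 1. f (xs ! Suc i) - f (xs ! i))"
    using step by (intro sum_ennreal) auto
  also have "(\<Sum>i<length xs - 1. f (xs ! Suc i) - f (xs ! i)) = f (xs ! (length xs - 1)) - f (xs ! 0)"
    by (rule sum_lessThan_telescope)
  also have "ennreal \<dots> \<le> ennreal (f b - f a)"
  proof (cases "xs = []")
    \<comment> \<open>For the empty list the truncated \<open>length xs - 1\<close> is 0, so both
      end terms are the same unspecified value and cancel.\<close>
    case True
    have "f a \<le> f b" using mono_onD[OF assms(1), of a b] assms(2) by simp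
    then show ?thesis using True by (intro ennreal_leI) simp
  next
    case False
    then have "f (xs ! (length xs - 1)) \<le> f b" "f a \<le> f (xs ! 0)"
      using mono_onD[OF assms(1), of "xs ! (length xs - 1)" b] mono_onD[OF assms(1), of a "xs ! 0"]
        in_ab[of "length xs - 1"] in_ab[of 0] assms(2) by auto
    then show ?thesis by (intro ennreal_leI) simp
  qed
  finally show "(\<Sum>i<length xs - 1. ennreal \<bar>f (xs ! Suc i) - f (xs ! i)\<bar>) \<le> ennreal (f b - f a)" .
qed

text \<open>\<xi>'' \<gamma> is a product of nonnegative non-decreasing functions, hence itself
  non-decreasing, and a monotone function has finite variation on [0,t].\<close>

lemma (in smooth_mixture) U_paths_subset_L_paths:
  assumes mono: "mono_on {0..1} (deriv (deriv \<xi>))"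
  shows "U_paths \<subseteq> L_paths \<xi>"
proof
  fix \<gamma> assume g: "\<gamma> \<in> U_paths"
  then have nn: "\<And>t. t \<in> {0..<1} \<Longrightarrow> 0 \<le> \<gamma> t" and gm: "mono_on {0..<1} \<gamma>" by (auto simp: U_paths_def)
  have "total_variation (\<lambda>s. w s * \<gamma> s) 0 t < \<infinity>" if t: "t \<in> {0..<1}" for t
  proof -
    have "mono_on {0..t} (\<lambda>s. w s * \<gamma> s)"
    proof (rule mono_onI)
      fix r s :: real assume rs: "r \<in> {0..t}" "s \<in> {0..t}" "r \<le> s"
      have "w r \<le> w s" "\<gamma> r \<le> \<gamma> s"
        using mono_onD[OF mono, of r s] mono_onD[OF gm, of r s] rs t by auto
      then show "w r * \<gamma> r \<le> w s * \<gamma> s"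
        using nn[of r] nonneg2[of s] rs t by (intro mult_mono) auto
    qed
    then have "total_variation (\<lambda>s. w s * \<gamma> s) 0 t \<le> ennreal (w t * \<gamma> t - w 0 * \<gamma> 0)"
      using t by (intro total_variation_mono) auto
    also have "\<dots> < \<infinity>" by simp
    finally show ?thesis .
  qed
  then show "\<gamma> \<in> L_paths \<xi>"
    using nn U_paths_admissible[OF g] by (auto simp: L_paths_def admissible_def w_integrable_def)
qed

theorem mainTheorem4:
  fixes c :: "nat \<Rightarrow> real" and \<epsilon>\<^sub>0 :: real
  assumes "\<epsilon>\<^sub>0 > 0"
    and "summable (\<lambda>k. (c (k + 2))\<^sup>2 * (1 + \<epsilon>\<^sub>0) ^ (k + 2))"
    and "\<exists>\<gamma>\<in>U_paths. strict_mono_on {0..<1} \<gamma>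
           \<and> ereal (parisi (mixture c) \<gamma>) = (INF \<gamma>'\<in>U_paths. ereal (parisi (mixture c) \<gamma>'))"
  shows "(INF \<gamma>\<in>U_paths. ereal (parisi (mixture c) \<gamma>)) = (INF \<gamma>\<in>L_paths (mixture c). ereal (parisi (mixture c) \<gamma>))"
proof -
  interpret smooth_mixture "mixture c" by (rule mixture_smooth[OF assms(1,2)])
  obtain \<gamma> where g: "\<gamma> \<in> U_paths" "strict_mono_on {0..<1} \<gamma>"
    and min: "ereal (parisi (mixture c) \<gamma>) = (INF \<gamma>'\<in>U_paths. ereal (parisi (mixture c) \<gamma>'))"
    using assms(3) by blast
  have opt: "parisi (mixture c) \<gamma> \<le> parisi (mixture c) \<delta>" if "\<delta> \<in> U_paths" for \<delta>
  proof -
    have "ereal (parisi (mixture c) \<gamma>) \<le> ereal (parisi (mixture c) \<delta>)"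
      unfolding min by (rule INF_lower[OF that])
    then show ?thesis by simp
  qed
  show ?thesis
  proof (rule antisym)
    show "(INF \<gamma>\<in>U_paths. ereal (parisi (mixture c) \<gamma>)) \<le> (INF \<gamma>\<in>L_paths (mixture c). ereal (parisi (mixture c) \<gamma>))"
      unfolding min[symmetric]
    proof (rule INF_greatest)
      fix \<delta> assume "\<delta> \<in> L_paths (mixture c)"
      then have "admissible \<delta>" by (auto simp: L_paths_def admissible_def w_integrable_def)
      then show "ereal (parisi (mixture c) \<gamma>) \<le> ereal (parisi (mixture c) \<delta>)"
        using parisi_minimizer_admissible[OF g opt] by simp
    qed
    show "(INF \<gamma>\<in>L_paths (mixture c). ereal (parisi (mixture c) \<gamma>)) \<le> (INF \<gamma>\<in>U_paths. ereal (parisi (mixture c) \<gamma>))"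
      by (rule INF_superset_mono[OF U_paths_subset_L_paths[OF mixture_smooth(2)[OF assms(1,2)]]]) simp
  qed
qed

end
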